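(* The equality $\mathrm{tail}(\lambda)=\mathrm{longtail}(\lambda)$ (the "Tail Conjecture") does not hold for all integral dominant weights: for the weight $\lambda\in\Lambda^+_{5|5}$ of $\mathfrak{gl}(5|5)$ determined by $\overline\lambda=(5\;4\;3\;0\;{-1}\,|\,1\;0\;{-3}\;{-4}\;{-5})$, one has $\mathrm{tail}(\lambda)=2$ and $\mathrm{longtail}(\lambda)=3$, so $\mathrm{tail}(\lambda)<\mathrm{longtail}(\lambda)$.
   Context: Consider the complex Lie superalgebra $\mathfrak{gl}(m|n)$ with Cartan subalgebra $\mathfrak h$ of diagonal matrices. Let $\varepsilon_1,\dots,\varepsilon_m,\delta_1,\dots,\delta_n$ be the basis of $\mathfrak h^*$ dual to $E_{1,1},\dots,E_{m+n,m+n}$, with the symmetric bilinear form such that this basis is orthogonal, $(\varepsilon_i|\varepsilon_i)=1$, $(\delta_j|\delta_j)=-1$. The root system $\Delta$ consists of the even roots $\varepsilon_i-\varepsilon_j$, $\delta_i-\delta_j$ ($i\ne j$) and the odd roots $\pm(\varepsilon_i-\delta_j)$. A base is a linearly independent $\Sigma\subset\Delta$ such that every root is an integer combination of elements of $\Sigma$ with all coefficients $\ge0$ (positive roots for $\Sigma$) or all $\le 0$. The distinguished base is $\Sigma^{\mathrm{dist}}=\{\varepsilon_i-\varepsilon_{i+1},\ \varepsilon_m-\delta_1,\ \delta_j-\delta_{j+1}\}$. $\mathbb S$ is the set of bases whose positive even roots are exactly $\{\varepsilon_i-\varepsilon_j,\delta_i-\delta_j\mid i<j\}$. Weights: $\nu=\sum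 a_i\varepsilon_i+\sum b_j\delta_j$ is written $(a_1\dots a_m|b_1\dots b_n)$, with $\nu_i:=a_i$, $\nu_{-j}:=b_j$. $\Lambda^+_{m|n}$ is the set of weights $\lambda$ with integer coordinates, $\lambda_1\ge\dots\ge\lambda_m$ and $\lambda_{-1}\ge\dots\ge\lambda_{-n}$. $L(\lambda)$ is the simple finite-dimensional $\mathfrak{gl}(m|n)$-module with highest weight $\lambda$ with respect to $\Sigma^{\mathrm{dist}}$; $\lambda_\Sigma$ is the highest weight of $L(\lambda)$ with respect to the base $\Sigma$. $\rho_\Sigma$ is half the sum of positive even roots minus half the sum of positive odd roots for $\Sigma$, shifted by $r(1\dots1|-1\dots-1)$ with $r\in\{0,\tfrac12\}$ (depending only on $m+n$) so that its coordinates are integers. $\overline\lambda_\Sigma:=\lambda_\Sigma+\rho_\Sigma$ and $\overline\lambda:=\overline\lambda_{\Sigma^{\mathrm{dist}}}$. Weight diagram $D^\Sigma_\lambda$: a function assigning to each $p\in\mathbb Z$ a finite collection of symbols. With $k=\#\{i:(\overline\lambda_\Sigma)_i=p\}$ and $s=\#\{j:(\overline\lambda_\Sigma)_{-j}=-p\}$, $D^\Sigma_\lambda(p)$ consists of $\min(k,s)$ symbols $\times$, together with $k-s$ symbols $>$ if $k>s$, or $s-k$ symbols $<$ if $s>k$; if $k=s=0$ it is the single symbol $\circ$. Put $D_\lambda:=D_\lambda^{\Sigma^{\mathrm{dist}}}$; each $D_\lambda(p)$ is a single symbol. $s(\nu)$ and longtail: for an integral weight $\nu$, $s(\nu)$ is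 the largest cardinality of a linearly independent set $S$ of odd roots such that $(\alpha|\beta)=0$ and $(\alpha|\nu)=0$ for all $\alpha,\beta\in S$ and such that $S\subset\Sigma'$ for some $\Sigma'\in\mathbb S$. $\mathrm{longtail}(\lambda):=\max_{\Sigma\in\mathbb S}s(\overline\lambda_\Sigma)$. tail: for $\lambda\in\Lambda^+_{m|n}$ define a diagram $\Phi(\lambda)$. If $D_\lambda$ has no $\times$, $\Phi(\lambda)=D_\lambda$. Otherwise let $\times_1$ be the leftmost position with symbol $\times$ in $D_\lambda$, $d$ the first position to the right of $\times_1$ with symbol $\circ$, $t$ the number of symbols $\times$ in positions $\times_1,\dots,d-1$, and $\times_\dagger$ the rightmost position $<d$ with symbol $\times$. Then $\Phi(\lambda)(\times_\dagger)$ consists of $t$ symbols $\times$; $\Phi(\lambda)(p)=\circ$ if $\times_1\le p<\times_\dagger$ and $D_\lambda(p)=\times$; and $\Phi(\lambda)(p)=D_\lambda(p)$ otherwise. There is a base $\Sigma_\lambda\in\mathbb S$ with $D_\lambda^{\Sigma_\lambda}=\Phi(\lambda)$, and $\mathrm{tail}(\lambda):=s(\overline\lambda_{\Sigma_\lambda})$. *)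

theory Defs
  imports
    "HOL-Library.Function_Algebras"
    "HOL-Library.Multiset"
    "Jordan_Normal_Form.Matrix"
begin

section \<open>Weights and roots\<close>

text \<open>
  A weight \<open>\<nu> = (a\<^sub>1 \<dots> a\<^sub>m | b\<^sub>1 \<dots> b\<^sub>n)\<close> is a function with \<open>\<nu> i = a\<^sub>i\<close>, \<open>\<nu> (-j) = b\<^sub>j\<close>,
  and value 0 at all other integers.  Weights are added pointwise.
\<close>

type_synonym weight = "int \<Rightarrow> complex"

definition hstar :: "nat \<Rightarrow> nat \<Rightarrow> weight set" where
  "hstar m n = {\<nu>. \<forall>k. \<nu> k \<noteq> 0 \<longrightarrow> k \<in> {1..int m} \<union> {- int n..-1}}"

definition weight_of :: "int list \<Rightarrow> int list \<Rightarrow> weight" where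
  "weight_of as bs = (\<lambda>k.
     if 1 \<le> k \<and> k \<le> int (length as) then of_int (as ! nat (k - 1))
     else if 1 \<le> - k \<and> - k \<le> int (length bs) then of_int (bs ! nat (- k - 1))
     else 0)"

definition eps :: "nat \<Rightarrow> weight" where
  "eps i = (\<lambda>k. if k = int i then 1 else 0)"

definition del :: "nat \<Rightarrow> weight" where
  "del j = (\<lambda>k. if k = - int j then 1 else 0)"

definition form :: "nat \<Rightarrow> nat \<Rightarrow> weight \<Rightarrow> weight \<Rightarrow> complex" where
  "form m n \<nu> \<mu> = (\<Sum>i = 1..m. \<nu> (int i) * \<mu> (int i)) - (\<Sum>j = 1..n. \<nu> (- int j) * \<mu> (- int j))"

definition lin_indep :: "weight set \<Rightarrow> bool" where
  "lin_indep S \<longleftrightarrow> \<not> module.dependent (\<lambda>(c::complex) (\<nu>::weight) k. c * \<nu> k) S"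

definition even_roots :: "nat \<Rightarrow> nat \<Rightarrow> weight set" where
  "even_roots m n =
     {eps i - eps j | i j. i \<in> {1..m} \<and> j \<in> {1..m} \<and> i \<noteq> j} \<union>
     {del i - del j | i j. i \<in> {1..n} \<and> j \<in> {1..n} \<and> i \<noteq> j}"

definition odd_roots :: "nat \<Rightarrow> nat \<Rightarrow> weight set" where
  "odd_roots m n =
     {eps i - del j | i j. i \<in> {1..m} \<and> j \<in> {1..n}} \<union>
     {del j - eps i | i j. i \<in> {1..m} \<and> j \<in> {1..n}}"

definition roots :: "nat \<Rightarrow> nat \<Rightarrow> weight set" where
  "roots m n = even_roots m n \<union> odd_roots m n"

definition positive_roots :: "nat \<Rightarrow> nat \<Rightarrow> weight set \<Rightarrow> weight set" where
  "positive_roots m n \<Sigma> = {\<beta> \<in> roots m n.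
     \<exists>c :: weight \<Rightarrow> int. (\<forall>\<alpha>\<in>\<Sigma>. 0 \<le> c \<alpha>) \<and> \<beta> = (\<lambda>k. \<Sum>\<alpha>\<in>\<Sigma>. of_int (c \<alpha>) * \<alpha> k)}"

definition negative_roots :: "nat \<Rightarrow> nat \<Rightarrow> weight set \<Rightarrow> weight set" where
  "negative_roots m n \<Sigma> = {\<beta> \<in> roots m n.
     \<exists>c :: weight \<Rightarrow> int. (\<forall>\<alpha>\<in>\<Sigma>. c \<alpha> \<le> 0) \<and> \<beta> = (\<lambda>k. \<Sum>\<alpha>\<in>\<Sigma>. of_int (c \<alpha>) * \<alpha> k)}"

definition is_base :: "nat \<Rightarrow> nat \<Rightarrow> weight set \<Rightarrow> bool" where
  "is_base m n \<Sigma> \<longleftrightarrow> \<Sigma> \<subseteq> roots m n \<and> lin_indep \<Sigma> \<and>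
     roots m n \<subseteq> positive_roots m n \<Sigma> \<union> negative_roots m n \<Sigma>"

text \<open>The family of bases written \<open>\<bbbS>\<close> in the literature.\<close>

definition bases :: "nat \<Rightarrow> nat \<Rightarrow> weight set set" where
  "bases m n = {\<Sigma>. is_base m n \<Sigma> \<and>
     positive_roots m n \<Sigma> \<inter> even_roots m n =
       {eps i - eps j | i j. 1 \<le> i \<and> i < j \<and> j \<le> m} \<union>
       {del i - del j | i j. 1 \<le> i \<and> i < j \<and> j \<le> n}}"

text \<open>For \<open>m, n \<ge> 1\<close>.\<close>

definition dist_base :: "nat \<Rightarrow> nat \<Rightarrow> weight set" where
  "dist_base m n =
     {eps i - eps (i + 1) | i. 1 \<le> i \<and> i < m} \<union>
     {eps m - del 1} \<union>
     {del j - del (j + 1) | j. 1 \<le> j \<and> j < n}"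

text \<open>
  The shift by \<open>r\<close> makes the coordinates integral: those of the unshifted vector lie in
  \<open>(m + n + 1) / 2 + \<int>\<close>.
\<close>

definition rho :: "nat \<Rightarrow> nat \<Rightarrow> weight set \<Rightarrow> weight" where
  "rho m n \<Sigma> = (\<lambda>k.
     (\<Sum>\<alpha> \<in> positive_roots m n \<Sigma> \<inter> even_roots m n. \<alpha> k) / 2
     - (\<Sum>\<alpha> \<in> positive_roots m n \<Sigma> \<inter> odd_roots m n. \<alpha> k) / 2
     + (if even (m + n) then 1 / 2 else 0) *
       ((\<Sum>i = 1..m. eps i k) - (\<Sum>j = 1..n. del j k)))"

definition dominant :: "nat \<Rightarrow> nat \<Rightarrow> weight set" where
  "dominant m n = {\<nu> \<in> hstar m n. (\<forall>k. \<nu> k \<in> \<int>) \<and>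
     (\<forall>i j. 1 \<le> i \<and> i \<le> j \<and> j \<le> m \<longrightarrow> Re (\<nu> (int j)) \<le> Re (\<nu> (int i))) \<and>
     (\<forall>i j. 1 \<le> i \<and> i \<le> j \<and> j \<le> n \<longrightarrow> Re (\<nu> (- int j)) \<le> Re (\<nu> (- int i)))}"


section \<open>The Lie superalgebra \<open>gl(m|n)\<close> and its finite-dimensional modules\<close>

text \<open>
  \<open>gl(m|n)\<close> consists of all \<open>(m+n) \<times> (m+n)\<close> complex matrices.  Matrix and vector indices
  start at 0, so the indices below \<open>m\<close> are the even ones.  Parities are 0 and 1.
\<close>

abbreviation gl :: "nat \<Rightarrow> nat \<Rightarrow> complex mat set" where
  "gl m n \<equiv> carrier_mat (m + n) (m + n)"

definition gl_part :: "nat \<Rightarrow> nat \<Rightarrow> nat \<Rightarrow> complex mat set" where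
  "gl_part m n a = {x \<in> gl m n. \<forall>i < m + n. \<forall>j < m + n.
     x $$ (i, j) \<noteq> 0 \<longrightarrow> (a = (if (i < m) = (j < m) then 0 else 1))}"

text \<open>The superbracket of homogeneous elements of parities \<open>a\<close> and \<open>b\<close>.\<close>

definition superbracket :: "nat \<Rightarrow> nat \<Rightarrow> complex mat \<Rightarrow> complex mat \<Rightarrow> complex mat" where
  "superbracket a b x y = x * y - (-1) ^ (a * b) \<cdot>\<^sub>m (y * x)"

definition cartan :: "nat \<Rightarrow> nat \<Rightarrow> complex mat set" where
  "cartan m n = {h \<in> gl m n. diagonal_mat h}"

definition weight_eval :: "nat \<Rightarrow> nat \<Rightarrow> weight \<Rightarrow> complex mat \<Rightarrow> complex" where
  "weight_eval m n \<nu> h =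
     (\<Sum>i = 1..m. \<nu> (int i) * h $$ (i - 1, i - 1)) +
     (\<Sum>j = 1..n. \<nu> (- int j) * h $$ (m + j - 1, m + j - 1))"

definition root_space :: "nat \<Rightarrow> nat \<Rightarrow> weight \<Rightarrow> complex mat set" where
  "root_space m n \<alpha> = {x \<in> gl m n. \<forall>h \<in> cartan m n. h * x - x * h = weight_eval m n \<alpha> h \<cdot>\<^sub>m x}"

text \<open>
  A module structure on the superspace \<open>\<complex>\<^bsup>p|q\<^esup>\<close> is a homomorphism of Lie superalgebras from
  \<open>gl(m|n)\<close> to \<open>gl(p|q)\<close>.  Up to isomorphism these are all the finite-dimensional modules.
\<close>

definition is_module ::
  "nat \<Rightarrow> nat \<Rightarrow> nat \<Rightarrow> nat \<Rightarrow> (complex mat \<Rightarrow> complex mat) \<Rightarrow> bool" where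
  "is_module m n p q R \<longleftrightarrow>
     (\<forall>x \<in> gl m n. R x \<in> gl p q) \<and>
     (\<forall>x \<in> gl m n. \<forall>y \<in> gl m n. R (x + y) = R x + R y) \<and>
     (\<forall>c. \<forall>x \<in> gl m n. R (c \<cdot>\<^sub>m x) = c \<cdot>\<^sub>m R x) \<and>
     (\<forall>a \<in> {0, 1}. \<forall>x \<in> gl_part m n a. R x \<in> gl_part p q a) \<and>
     (\<forall>a \<in> {0, 1}. \<forall>b \<in> {0, 1}. \<forall>x \<in> gl_part m n a. \<forall>y \<in> gl_part m n b.
        R (superbracket a b x y) = superbracket a b (R x) (R y))"

text \<open>
  Submodules are sub-superspaces: they contain the even (hence also the odd) component of
  each of their elements.
\<close>

definition is_submodule ::
  "nat \<Rightarrow> nat \<Rightarrow> nat \<Rightarrow> nat \<Rightarrow> (complex mat \<Rightarrow> complex mat) \<Rightarrow> complex vec set \<Rightarrow> bool" where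
  "is_submodule m n p q R W \<longleftrightarrow>
     W \<subseteq> carrier_vec (p + q) \<and> 0\<^sub>v (p + q) \<in> W \<and>
     (\<forall>v \<in> W. \<forall>w \<in> W. v + w \<in> W) \<and>
     (\<forall>c. \<forall>v \<in> W. c \<cdot>\<^sub>v v \<in> W) \<and>
     (\<forall>v \<in> W. vec (p + q) (\<lambda>i. if i < p then v $ i else 0) \<in> W) \<and>
     (\<forall>x \<in> gl m n. \<forall>v \<in> W. R x *\<^sub>v v \<in> W)"

definition is_simple_module ::
  "nat \<Rightarrow> nat \<Rightarrow> nat \<Rightarrow> nat \<Rightarrow> (complex mat \<Rightarrow> complex mat) \<Rightarrow> bool" where
  "is_simple_module m n p q R \<longleftrightarrow> is_module m n p q R \<and> 0 < p + q \<and>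
     (\<forall>W. is_submodule m n p q R W \<longrightarrow> W = {0\<^sub>v (p + q)} \<or> W = carrier_vec (p + q))"

definition has_highest_weight ::
  "nat \<Rightarrow> nat \<Rightarrow> nat \<Rightarrow> nat \<Rightarrow> (complex mat \<Rightarrow> complex mat) \<Rightarrow> weight set \<Rightarrow> weight \<Rightarrow> bool" where
  "has_highest_weight m n p q R \<Sigma> \<mu> \<longleftrightarrow> \<mu> \<in> hstar m n \<and>
     (\<exists>v \<in> carrier_vec (p + q). v \<noteq> 0\<^sub>v (p + q) \<and>
        (\<forall>h \<in> cartan m n. R h *\<^sub>v v = weight_eval m n \<mu> h \<cdot>\<^sub>v v) \<and>
        (\<forall>\<alpha> \<in> positive_roots m n \<Sigma>. \<forall>x \<in> root_space m n \<alpha>. R x *\<^sub>v v = 0\<^sub>v (p + q)))"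

text \<open>
  \<open>\<lambda>\<^sub>\<Sigma>\<close>: the highest weight with respect to \<open>\<Sigma>\<close> of the simple module \<open>L(\<lambda>)\<close>, i.e.\ of any
  simple finite-dimensional module of highest weight \<open>\<lambda>\<close> for the distinguished base.
\<close>

definition hw_at :: "nat \<Rightarrow> nat \<Rightarrow> weight set \<Rightarrow> weight \<Rightarrow> weight" where
  "hw_at m n \<Sigma> \<nu> = (THE \<mu>. \<exists>p q R. is_simple_module m n p q R \<and>
     has_highest_weight m n p q R (dist_base m n) \<nu> \<and> has_highest_weight m n p q R \<Sigma> \<mu>)"

definition hw_bar :: "nat \<Rightarrow> nat \<Rightarrow> weight set \<Rightarrow> weight \<Rightarrow> weight" where
  "hw_bar m n \<Sigma> \<nu> = hw_at m n \<Sigma> \<nu> + rho m n \<Sigma>"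


section \<open>Weight diagrams, tail and longtail\<close>

datatype dsymbol = Cross | Gt | Lt | Circ

type_synonym diagram = "int \<Rightarrow> dsymbol multiset"

definition weight_diagram :: "nat \<Rightarrow> nat \<Rightarrow> weight set \<Rightarrow> weight \<Rightarrow> diagram" where
  "weight_diagram m n \<Sigma> \<nu> = (\<lambda>p.
     let k = card {i \<in> {1..m}. hw_bar m n \<Sigma> \<nu> (int i) = of_int p};
         s = card {j \<in> {1..n}. hw_bar m n \<Sigma> \<nu> (- int j) = - of_int p}
     in if k = 0 \<and> s = 0 then {#Circ#}
        else replicate_mset (min k s) Cross + replicate_mset (k - s) Gt + replicate_mset (s - k) Lt)"

definition tail_diagram :: "nat \<Rightarrow> nat \<Rightarrow> weight \<Rightarrow> diagram" where
  "tail_diagram m n \<nu> =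
     (let D = weight_diagram m n (dist_base m n) \<nu>;
          X = {p. D p = {#Cross#}}
      in if X = {} then D
         else let x1 = Min X;
                  d = (LEAST d. x1 < d \<and> D d = {#Circ#});
                  t = card {p \<in> X. x1 \<le> p \<and> p < d};
                  xd = Max {p \<in> X. p < d}
              in (\<lambda>p. if p = xd then replicate_mset t Cross
                      else if x1 \<le> p \<and> p < xd \<and> D p = {#Cross#} then {#Circ#}
                      else D p))"

definition s_num :: "nat \<Rightarrow> nat \<Rightarrow> weight \<Rightarrow> nat" where
  "s_num m n \<nu> = Max {card S | S. S \<subseteq> odd_roots m n \<and> lin_indep S \<and>
     (\<forall>\<alpha>\<in>S. \<forall>\<beta>\<in>S. form m n \<alpha> \<beta> = 0) \<and> (\<forall>\<alpha>\<in>S. form m n \<alpha> \<nu> = 0) \<and>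
     (\<exists>\<Sigma>' \<in> bases m n. S \<subseteq> \<Sigma>')}"

definition longtail :: "nat \<Rightarrow> nat \<Rightarrow> weight \<Rightarrow> nat" where
  "longtail m n \<nu> = Max {s_num m n (hw_bar m n \<Sigma> \<nu>) | \<Sigma>. \<Sigma> \<in> bases m n}"

definition tail_base :: "nat \<Rightarrow> nat \<Rightarrow> weight \<Rightarrow> weight set" where
  "tail_base m n \<nu> =
     (SOME \<Sigma>. \<Sigma> \<in> bases m n \<and> weight_diagram m n \<Sigma> \<nu> = tail_diagram m n \<nu>)"

definition tail :: "nat \<Rightarrow> nat \<Rightarrow> weight \<Rightarrow> nat" where
  "tail m n \<nu> = s_num m n (hw_bar m n (tail_base m n \<nu>) \<nu>)"

end

theory Submission
  imports Defs "HOL-Library.Numeral_Type"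
begin

text \<open>
  The positive systems occurring here correspond to shuffles of the chains of \<open>\<epsilon>\<close>'s and
  \<open>\<delta>\<close>'s, hence to partitions \<open>h\<close> in an \<open>m \<times> n\<close> box, and adding a box is an odd reflection.
  Writing the shifted highest weight as \<open>(a | -c)\<close>, the odd reflection at \<open>\<epsilon>\<^sub>i - \<delta>\<^sub>j\<close> increases
  both \<open>a\<^sub>i\<close> and \<open>c\<^sub>j\<close> by 1 if \<open>a\<^sub>i = c\<^sub>j\<close> and changes nothing otherwise.  Orthogonal odd simple
  roots are non-crossing pairs, so \<open>s(a | -c)\<close> is the length of a longest common subsequence of
  \<open>a\<close> and \<open>c\<close>.  This leaves a finite computation over the 252 partitions in a \<open>5 \<times> 5\<close> box.

  The module \<open>L(\<lambda>)\<close> has to exist for \<open>\<lambda>\<^sub>\<Sigma>\<close> to be meaningful.  Since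
  \<open>\<lambda> = 3 (1 1 1 1 1 | -1 -1 -1 -1 -1) + 2 (1 1 1 0 0 | 0) + 2 (0 | 0 0 -1 -1 -1)\<close>,
  it is a subquotient of a tensor product of a multiple of the supertrace and of sixth tensor powers
  of the natural representation and of its dual.
\<close>

section \<open>Highest weight vectors and odd reflections\<close>

text \<open>\<open>hw_at\<close> is a definite description over all simple modules with the given
  highest weight, and \<open>tail_base\<close> is an arbitrary choice among the bases with the
  prescribed diagram. So the highest weight must be shown unique for every admissible order of the
  indices, by the same value in every module, and the diagram must be shown to determine the shifted
  weight: the symbols at position 0 already single out one state among all those reached.

  The weight comes from the two clusters of crosses at -1, 0 and at 3, 4, 5. For the distinguished
  base \<open>a\<close> strictly decreases and \<open>c\<close> strictly increases, so their longest
  common subsequence has length 1; longer ones need repeated entries, that is, merged crosses. The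
  tail merges only the leftmost cluster and gets 2. Merging the larger right cluster at 5 gives 3,
  but the box diagram of such a base also has long rows for the last two \<epsilon>'s, and these
  rows push the left cluster up. The gap at 1, 2 lets it move there without disturbing the right
  cluster.\<close>

definition munit :: "nat \<Rightarrow> nat \<Rightarrow> nat \<Rightarrow> complex mat" where
  "munit N a b = mat N N (\<lambda>(i,j). if i = a \<and> j = b then 1 else 0)"

lemma munit_dim [simp]: "dim_row (munit N a b) = N" "dim_col (munit N a b) = N"
  by (simp_all add: munit_def)

lemma munit_carrier [simp]: "munit N a b \<in> carrier_mat N N"
  by (simp add: munit_def)

lemma munit_index [simp]:
  "i < N \<Longrightarrow> j < N \<Longrightarrow> munit N a b $$ (i,j) = (if i = a \<and> j = b then 1 else 0)"
  by (simp add: munit_def)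

lemma munit_mult:
  assumes "b < N" "c < N"
  shows "munit N a b * munit N c d = (if b = c then munit N a d else 0\<^sub>m N N)"
proof (rule eq_matI)
  fix i j assume "i < dim_row (if b = c then munit N a d else 0\<^sub>m N N)"
    "j < dim_col (if b = c then munit N a d else 0\<^sub>m N N)"
  then have ij: "i < N" "j < N" by (auto split: if_splits)
  then have "(munit N a b * munit N c d) $$ (i,j) =
    (\<Sum>k\<in>{0..<N}. (if i = a \<and> k = b then 1 else 0) * (if k = c \<and> j = d then 1 else 0))"
    by (simp add: scalar_prod_def)
  also have "\<dots> = (\<Sum>k\<in>{0..<N}. if k = b then (if i = a \<and> b = c \<and> j = d then 1 else 0) else 0)"
    by (intro sum.cong) auto
  finally show "(munit N a b * munit N c d) $$ (i,j) = (if b = c then munit N a d else 0\<^sub>m N N) $$ (i,j)"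
    using ij assms by simp
qed auto

definition mpar :: "nat \<Rightarrow> nat \<Rightarrow> nat \<Rightarrow> nat" where
  "mpar m a b = (if (a < m) = (b < m) then 0 else 1)"

lemma mpar_01: "mpar m a b \<in> {0, 1}"
  by (simp add: mpar_def)

lemma munit_part: "munit (m + n) a b \<in> gl_part m n (mpar m a b)"
  by (auto simp: gl_part_def mpar_def split: if_splits)

text \<open>A matrix is the sum of its entries times matrix units. The proof adds one entry at a
  time; \<open>r F\<close> keeps the entries of \<open>x\<close> at the places in
  \<open>F\<close>.\<close>

lemma gl_induct [consumes 1, case_names zero add unit]:
  assumes x: "x \<in> carrier_mat N N"
    and 0: "P (0\<^sub>m N N)"
    and add: "\<And>x y. x \<in> carrier_mat N N \<Longrightarrow> y \<in> carrier_mat N N \<Longrightarrow> P x \<Longrightarrow> P y \<Longrightarrow> P (x + y)"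
    and unit: "\<And>a b. a < N \<Longrightarrow> b < N \<Longrightarrow> P (x $$ (a,b) \<cdot>\<^sub>m munit N a b)"
  shows "P x"
proof -
  define r where "r = (\<lambda>F. mat N N (\<lambda>ij. if ij \<in> F then x $$ ij else 0))"
  have "P (r F)" if "finite F" "F \<subseteq> {..<N} \<times> {..<N}" for F
    using that
  proof (induction F)
    case empty
    have "r {} = 0\<^sub>m N N" by (auto simp: r_def intro!: eq_matI)
    then show ?case using 0 by simp
  next
    case (insert f F)
    obtain a b where f: "f = (a,b)" by force
    have "r (insert f F) = x $$ (a,b) \<cdot>\<^sub>m munit N a b + r F"
      using insert f by (auto simp: r_def intro!: eq_matI)
    moreover have "P (x $$ (a,b) \<cdot>\<^sub>m munit N a b + r F)"
      by (intro add unit) (use insert f in \<open>auto simp: r_def\<close>)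
    ultimately show ?case by simp
  qed
  from this[of "{..<N} \<times> {..<N}"] have "P (r ({..<N} \<times> {..<N}))" by simp
  moreover have "r ({..<N} \<times> {..<N}) = x" using x by (auto simp: r_def intro!: eq_matI)
  ultimately show ?thesis by simp
qed

text \<open>
  Indices run from 0: \<open>k < m\<close> stands for \<open>\<epsilon>\<^bsub>k+1\<^esub>\<close> and \<open>m + j\<close> for \<open>\<delta>\<^bsub>j+1\<^esub>\<close>.
\<close>

definition crd :: "nat \<Rightarrow> nat \<Rightarrow> int" where
  "crd m k = (if k < m then int k + 1 else int m - int k - 1)"

definition ev :: "nat \<Rightarrow> nat \<Rightarrow> weight" where
  "ev m k = (\<lambda>z. if z = crd m k then 1 else 0)"

lemma crd_inj [simp]: "crd m a = crd m b \<longleftrightarrow> a = b"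
  by (auto simp: crd_def split: if_splits)

lemma ev_crd [simp]: "ev m a (crd m b) = (if a = b then 1 else 0)"
  by (auto simp: ev_def)

lemma sum_crd:
  "(\<Sum>k<m+n. f k (crd m k)) =
     (\<Sum>i = 1..m. f (i - 1) (int i)) + (\<Sum>j = 1..n. f (m + j - 1) (- int j))"
  for f :: "nat \<Rightarrow> int \<Rightarrow> 'a::comm_monoid_add"
proof -
  have "(\<Sum>k<m+n. f k (crd m k)) = (\<Sum>k<m. f k (crd m k)) + (\<Sum>k\<in>{m..<m+n}. f k (crd m k))"
    by (subst sum.union_disjoint[symmetric]) (auto intro!: sum.cong)
  also have "(\<Sum>k<m. f k (crd m k)) = (\<Sum>i = 1..m. f (i - 1) (int i))"
    by (rule sum.reindex_bij_witness[of _ "\<lambda>i. i - 1" Suc]) (auto simp: crd_def add.commute)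
  also have "(\<Sum>k\<in>{m..<m+n}. f k (crd m k)) = (\<Sum>j = 1..n. f (m + j - 1) (- int j))"
    by (rule sum.reindex_bij_witness[of _ "\<lambda>j. m + j - 1" "\<lambda>k. k - m + 1"]) (auto simp: crd_def)
  finally show ?thesis .
qed

lemma weight_eval_eq: "weight_eval m n \<mu> h = (\<Sum>k<m+n. \<mu> (crd m k) * h $$ (k,k))"
  unfolding weight_eval_def by (subst sum_crd[of "\<lambda>k z. \<mu> z * h $$ (k,k)"]) simp

lemma weight_eval_ev:
  assumes "a < m + n" "b < m + n"
  shows "weight_eval m n (ev m a - ev m b) h = h $$ (a,a) - h $$ (b,b)"
proof -
  have "weight_eval m n (ev m a - ev m b) h =
    (\<Sum>k<m+n. (if k = a then h $$ (k,k) else 0) - (if k = b then h $$ (k,k) else 0))"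
    unfolding weight_eval_eq by (intro sum.cong) auto
  then show ?thesis using assms by (simp add: sum_subtractf)
qed

lemma diag_comm_index:
  assumes "h \<in> cartan m n" "x \<in> gl m n" "i < m + n" "j < m + n"
  shows "(h * x - x * h) $$ (i,j) = (h $$ (i,i) - h $$ (j,j)) * x $$ (i,j)"
proof -
  have h: "h \<in> gl m n" and d: "\<And>a b. a < m + n \<Longrightarrow> b < m + n \<Longrightarrow> a \<noteq> b \<Longrightarrow> h $$ (a,b) = 0"
    using assms(1) by (auto simp: cartan_def diagonal_mat_def)
  have "(h * x) $$ (i,j) = (\<Sum>k\<in>{0..<m+n}. h $$ (i,k) * x $$ (k,j))"
    using h assms by (simp add: scalar_prod_def)
  also have "\<dots> = (\<Sum>k\<in>{0..<m+n}. if k = i then h $$ (i,i) * x $$ (i,j) else 0)"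
    using assms d by (intro sum.cong) auto
  finally have 1: "(h * x) $$ (i,j) = h $$ (i,i) * x $$ (i,j)" using assms by simp
  have "(x * h) $$ (i,j) = (\<Sum>k\<in>{0..<m+n}. x $$ (i,k) * h $$ (k,j))"
    using h assms by (simp add: scalar_prod_def)
  also have "\<dots> = (\<Sum>k\<in>{0..<m+n}. if k = j then h $$ (j,j) * x $$ (i,j) else 0)"
    using assms d by (intro sum.cong) auto
  finally have 2: "(x * h) $$ (i,j) = h $$ (j,j) * x $$ (i,j)" using assms by simp
  show ?thesis using 1 2 h assms by (simp add: algebra_simps)
qed

lemma munit_cartan [simp]: "munit (m + n) k k \<in> cartan m n"
  by (auto simp: cartan_def diagonal_mat_def)

lemma root_space_ev:
  assumes ab: "a < m + n" "b < m + n" "a \<noteq> b"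
  shows "root_space m n (ev m a - ev m b) = {c \<cdot>\<^sub>m munit (m + n) a b | c. True}"
proof (intro equalityI subsetI)
  fix x assume x: "x \<in> root_space m n (ev m a - ev m b)"
  then have xg: "x \<in> gl m n"
    and xr: "\<And>h. h \<in> cartan m n \<Longrightarrow> h * x - x * h = weight_eval m n (ev m a - ev m b) h \<cdot>\<^sub>m x"
    by (auto simp: root_space_def)
  have "x $$ (i,j) = 0" if ij: "i < m + n" "j < m + n" and ne: "(i,j) \<noteq> (a,b)" for i j
  proof (rule ccontr)
    assume nz: "x $$ (i,j) \<noteq> 0"
    have *: "h $$ (i,i) - h $$ (j,j) = h $$ (a,a) - h $$ (b,b)" if "h \<in> cartan m n" for h
    proof -
      have "(h $$ (i,i) - h $$ (j,j)) * x $$ (i,j) = (h $$ (a,a) - h $$ (b,b)) * x $$ (i,j)"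
        unfolding diag_comm_index[OF that xg ij, symmetric] xr[OF that]
        using ij xg weight_eval_ev[OF ab(1,2)] by simp
      then show ?thesis using nz by (metis mult_cancel_right)
    qed
    \<comment> \<open>The values at these two diagonal units determine the root: the first forces
      \<open>i = a\<close>, the second \<open>j = b\<close>.\<close>
    from *[of "munit (m+n) a a"] *[of "munit (m+n) b b"] show False
      using ij ab ne by (auto split: if_splits)
  qed
  then have "x = x $$ (a,b) \<cdot>\<^sub>m munit (m + n) a b"
    using xg ab by (intro eq_matI) auto
  then show "x \<in> {c \<cdot>\<^sub>m munit (m + n) a b | c. True}" by blast
next
  fix x assume "x \<in> {c \<cdot>\<^sub>m munit (m + n) a b | c. True}"
  then obtain c where x: "x = c \<cdot>\<^sub>m munit (m + n) a b" by auto
  have "h * x - x * h = weight_eval m n (ev m a - ev m b) h \<cdot>\<^sub>m x" if h: "h \<in> cartan m n" for h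
  proof (rule eq_matI)
    fix i j assume ij: "i < dim_row (weight_eval m n (ev m a - ev m b) h \<cdot>\<^sub>m x)"
      "j < dim_col (weight_eval m n (ev m a - ev m b) h \<cdot>\<^sub>m x)"
    then have ij: "i < m + n" "j < m + n" using x by auto
    show "(h * x - x * h) $$ (i, j) = (weight_eval m n (ev m a - ev m b) h \<cdot>\<^sub>m x) $$ (i, j)"
      using diag_comm_index[OF h _ ij, of x] ij x ab
      by (auto simp: weight_eval_ev)
  qed (use h x in \<open>auto simp: cartan_def\<close>)
  then show "x \<in> root_space m n (ev m a - ev m b)"
    using x by (auto simp: root_space_def)
qed

section \<open>Parity components and highest weight vectors of a module\<close>

lemma smult_mat_vec:
  "A \<in> carrier_mat r s \<Longrightarrow> v \<in> carrier_vec s \<Longrightarrow> (c \<cdot>\<^sub>m A) *\<^sub>v v = c \<cdot>\<^sub>v (A *\<^sub>v v)"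
  for c :: "'a :: comm_semiring_0"
  by (intro eq_vecI) (auto simp: scalar_prod_def sum_distrib_left mult.assoc)

text \<open>Here \<open>True\<close> selects the even component, whereas \<open>True\<close> means
  odd for the functions \<open>par\<close> and \<open>hcomp\<close> used later.\<close>

definition vpart :: "nat \<Rightarrow> nat \<Rightarrow> bool \<Rightarrow> complex vec \<Rightarrow> complex vec" where
  "vpart p q e v = vec (p + q) (\<lambda>i. if (i < p) = e then v $ i else 0)"

lemma vpart_carrier [simp]: "vpart p q e v \<in> carrier_vec (p + q)"
  by (simp add: vpart_def)

lemma vpart_split: "v \<in> carrier_vec (p + q) \<Longrightarrow> vpart p q True v + vpart p q False v = v"
  by (intro eq_vecI) (auto simp: vpart_def)

text \<open>An even operator preserves the parity components and an odd one exchanges them; the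
  label \<open>e = (a = 0)\<close> is \<open>e\<close> in the first case and its negation in the
  second.\<close>

lemma vpart_mult:
  assumes "X \<in> gl_part p q a" "v \<in> carrier_vec (p + q)" "a \<in> {0, 1}"
  shows "X *\<^sub>v vpart p q e v = vpart p q (e = (a = 0)) (X *\<^sub>v v)"
proof (rule eq_vecI)
  fix i assume "i < dim_vec (vpart p q (e = (a = 0)) (X *\<^sub>v v))"
  then have i: "i < p + q" by (simp add: vpart_def)
  have X: "X \<in> gl p q" and Xp: "\<And>j. j < p + q \<Longrightarrow> X $$ (i,j) \<noteq> 0 \<Longrightarrow> a = (if (i < p) = (j < p) then 0 else 1)"
    using assms(1) i by (auto simp: gl_part_def)
  define B where "B \<longleftrightarrow> (i < p) = (e = (a = 0))"
  have "(X *\<^sub>v vpart p q e v) $ i = (\<Sum>j\<in>{0..<p+q}. X $$ (i,j) * (if (j < p) = e then v $ j else 0))"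
    using X i by (simp add: vpart_def scalar_prod_def)
  also have "\<dots> = (\<Sum>j\<in>{0..<p+q}. if B then X $$ (i,j) * v $ j else 0)"
  proof (rule sum.cong)
    fix j assume "j \<in> {0..<p+q}"
    then have "X $$ (i,j) = 0 \<or> (a = 0 \<longleftrightarrow> (i < p) = (j < p))"
      using Xp[of j] by (cases "X $$ (i,j) = 0") (simp_all split: if_splits)
    then show "X $$ (i,j) * (if (j < p) = e then v $ j else 0) = (if B then X $$ (i,j) * v $ j else 0)"
      unfolding B_def by (cases "i < p"; cases "j < p"; cases e) auto
  qed simp
  also have "\<dots> = (if B then (X *\<^sub>v v) $ i else 0)"
    using X i assms(2) by (simp add: scalar_prod_def)
  also have "\<dots> = vpart p q (e = (a = 0)) (X *\<^sub>v v) $ i"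
    using i by (simp add: vpart_def B_def)
  finally show "(X *\<^sub>v vpart p q e v) $ i = vpart p q (e = (a = 0)) (X *\<^sub>v v) $ i" .
qed (use assms in \<open>auto simp: vpart_def gl_part_def\<close>)

text \<open>The positive system is encoded by a relation \<open>prec\<close> on the matrix indices,
  so that an odd reflection merely exchanges two neighbours. Only the values of \<open>\<mu>\<close>
  at the coordinates \<open>crd m k\<close> matter.\<close>

definition hwv :: "nat \<Rightarrow> nat \<Rightarrow> nat \<Rightarrow> nat \<Rightarrow> (complex mat \<Rightarrow> complex mat) \<Rightarrow>
    (nat \<Rightarrow> nat \<Rightarrow> bool) \<Rightarrow> weight \<Rightarrow> complex vec \<Rightarrow> bool" where
  "hwv m n p q R prec \<mu> v \<longleftrightarrow> v \<in> carrier_vec (p + q) \<and> v \<noteq> 0\<^sub>v (p + q) \<and>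
     (\<forall>k<m+n. R (munit (m + n) k k) *\<^sub>v v = \<mu> (crd m k) \<cdot>\<^sub>v v) \<and>
     (\<forall>a<m+n. \<forall>b<m+n. prec a b \<longrightarrow> R (munit (m + n) a b) *\<^sub>v v = 0\<^sub>v (p + q))"

definition pos_of :: "nat \<Rightarrow> nat \<Rightarrow> (nat \<Rightarrow> nat \<Rightarrow> bool) \<Rightarrow> weight set" where
  "pos_of m n prec = {ev m a - ev m b | a b. a < m + n \<and> b < m + n \<and> prec a b}"

locale glmod =
  fixes m n p q :: nat and R :: "complex mat \<Rightarrow> complex mat"
  assumes is_module: "is_module m n p q R"
begin

abbreviation "E a b \<equiv> munit (m + n) a b"

lemma R_carrier [simp]: "x \<in> gl m n \<Longrightarrow> R x \<in> gl p q"
  and R_add: "x \<in> gl m n \<Longrightarrow> y \<in> gl m n \<Longrightarrow> R (x + y) = R x + R y"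
  and R_smult: "x \<in> gl m n \<Longrightarrow> R (c \<cdot>\<^sub>m x) = c \<cdot>\<^sub>m R x"
  and R_part: "a \<in> {0,1} \<Longrightarrow> x \<in> gl_part m n a \<Longrightarrow> R x \<in> gl_part p q a"
  and R_bracket: "a \<in> {0,1} \<Longrightarrow> b \<in> {0,1} \<Longrightarrow> x \<in> gl_part m n a \<Longrightarrow> y \<in> gl_part m n b \<Longrightarrow>
     R (superbracket a b x y) = superbracket a b (R x) (R y)"
  using is_module by (auto simp: is_module_def)

lemma R_zero [simp]: "R (0\<^sub>m (m + n) (m + n)) = 0\<^sub>m (p + q) (p + q)"
proof -
  have "R (0 \<cdot>\<^sub>m 0\<^sub>m (m + n) (m + n)) = 0 \<cdot>\<^sub>m R (0\<^sub>m (m + n) (m + n))"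
    by (rule R_smult) simp
  moreover have "0 \<cdot>\<^sub>m A = 0\<^sub>m (p + q) (p + q)" if "A \<in> gl p q" for A :: "complex mat"
    using that by (intro eq_matI) auto
  moreover have "0 \<cdot>\<^sub>m 0\<^sub>m (m + n) (m + n) = (0\<^sub>m (m + n) (m + n) :: complex mat)"
    by (intro eq_matI) auto
  ultimately show ?thesis by (metis R_carrier zero_carrier_mat)
qed

lemma Rv_carrier [simp]: "x \<in> gl m n \<Longrightarrow> v \<in> carrier_vec (p + q) \<Longrightarrow> R x *\<^sub>v v \<in> carrier_vec (p + q)"
  using R_carrier by (metis mult_mat_vec_carrier)

lemma Rv_comm:
  assumes "a \<in> {0,1}" "b \<in> {0,1}" "x \<in> gl_part m n a" "y \<in> gl_part m n b" "v \<in> carrier_vec (p + q)"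
  shows "R x *\<^sub>v (R y *\<^sub>v v) = (-1) ^ (a * b) \<cdot>\<^sub>v (R y *\<^sub>v (R x *\<^sub>v v)) + R (superbracket a b x y) *\<^sub>v v"
proof -
  have g: "R x \<in> gl p q" "R y \<in> gl p q" using assms by (auto simp: gl_part_def)
  have c: "R x *\<^sub>v (R y *\<^sub>v v) \<in> carrier_vec (p + q)" "R y *\<^sub>v (R x *\<^sub>v v) \<in> carrier_vec (p + q)"
    using g assms by auto
  have "R (superbracket a b x y) *\<^sub>v v = (R x * R y) *\<^sub>v v - ((-1) ^ (a * b) \<cdot>\<^sub>m (R y * R x)) *\<^sub>v v"
    unfolding R_bracket[OF assms(1-4)] unfolding superbracket_def
    by (rule minus_mult_distrib_mat_vec) (use g assms in auto)
  also have "\<dots> = R x *\<^sub>v (R y *\<^sub>v v) - (-1) ^ (a * b) \<cdot>\<^sub>v (R y *\<^sub>v (R x *\<^sub>v v))"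
    using g assms by (simp add: smult_mat_vec[of _ "p+q" "p+q"] assoc_mult_mat_vec[of _ "p+q" "p+q" _ "p+q"])
  finally have "R (superbracket a b x y) *\<^sub>v v = R x *\<^sub>v (R y *\<^sub>v v) - (-1) ^ (a * b) \<cdot>\<^sub>v (R y *\<^sub>v (R x *\<^sub>v v))" .
  moreover have "u = w + (u - w)" if "u \<in> carrier_vec (p + q)" "w \<in> carrier_vec (p + q)"
    for u w :: "complex vec"
    using that by (intro eq_vecI) auto
  ultimately show ?thesis using c by (metis smult_carrier_vec)
qed


lemma Rv_add:
  "x \<in> gl m n \<Longrightarrow> v \<in> carrier_vec (p + q) \<Longrightarrow> w \<in> carrier_vec (p + q) \<Longrightarrow>
     R x *\<^sub>v (v + w) = R x *\<^sub>v v + R x *\<^sub>v w"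
  by (rule mult_add_distrib_mat_vec[of _ "p+q" "p+q"]) auto

lemma Rv_smult:
  "x \<in> gl m n \<Longrightarrow> v \<in> carrier_vec (p + q) \<Longrightarrow> R x *\<^sub>v (c \<cdot>\<^sub>v v) = c \<cdot>\<^sub>v (R x *\<^sub>v v)"
  by (rule mult_mat_vec[of _ "p+q" "p+q"]) auto

lemma add_Rv:
  "x \<in> gl m n \<Longrightarrow> y \<in> gl m n \<Longrightarrow> v \<in> carrier_vec (p + q) \<Longrightarrow>
     R (x + y) *\<^sub>v v = R x *\<^sub>v v + R y *\<^sub>v v"
  by (simp add: R_add add_mult_distrib_mat_vec[of _ "p+q" "p+q"])

lemma smult_Rv:
  "x \<in> gl m n \<Longrightarrow> v \<in> carrier_vec (p + q) \<Longrightarrow> R (c \<cdot>\<^sub>m x) *\<^sub>v v = c \<cdot>\<^sub>v (R x *\<^sub>v v)"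
  by (simp add: R_smult smult_mat_vec[of _ "p+q" "p+q"])

lemma zero_Rv: "v \<in> carrier_vec (p + q) \<Longrightarrow> R (0\<^sub>m (m + n) (m + n)) *\<^sub>v v = 0\<^sub>v (p + q)"
  by (auto intro!: eq_vecI)

lemma Rv_zero: "x \<in> gl m n \<Longrightarrow> R x *\<^sub>v 0\<^sub>v (p + q) = 0\<^sub>v (p + q)"
  using R_carrier[of x] by (intro eq_vecI) (auto simp del: R_carrier)

text \<open>The supercommutator of two matrix units, applied to a vector and solved for one order of
  the two operators, so that it can move \<open>E a b\<close> past \<open>E c d\<close>.\<close>

lemma E_comm:
  assumes "a < m + n" "b < m + n" "c < m + n" "d < m + n" "w \<in> carrier_vec (p + q)"
  defines "s \<equiv> (-1) ^ (mpar m a b * mpar m c d) :: complex"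
  shows "R (E a b) *\<^sub>v (R (E c d) *\<^sub>v w) = s \<cdot>\<^sub>v (R (E c d) *\<^sub>v (R (E a b) *\<^sub>v w)) +
     ((if b = c then R (E a d) *\<^sub>v w else 0\<^sub>v (p + q)) +
      (- s) \<cdot>\<^sub>v (if d = a then R (E c b) *\<^sub>v w else 0\<^sub>v (p + q)))"
proof -
  have "superbracket (mpar m a b) (mpar m c d) (E a b) (E c d) =
      (if b = c then E a d else 0\<^sub>m (m+n) (m+n)) + (- s) \<cdot>\<^sub>m (if d = a then E c b else 0\<^sub>m (m+n) (m+n))"
    unfolding superbracket_def s_def munit_mult[OF assms(2,3)] munit_mult[OF assms(4,1)]
    by (intro eq_matI) auto
  then have "R (superbracket (mpar m a b) (mpar m c d) (E a b) (E c d)) *\<^sub>v w =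
     (if b = c then R (E a d) *\<^sub>v w else 0\<^sub>v (p + q)) +
      (- s) \<cdot>\<^sub>v (if d = a then R (E c b) *\<^sub>v w else 0\<^sub>v (p + q))"
    using assms(5) by (simp add: add_Rv smult_Rv zero_Rv del: R_zero)
  then show ?thesis
    using Rv_comm[OF mpar_01 mpar_01 munit_part munit_part assms(5), of a b c d]
    by (simp add: s_def)
qed

lemma cartan_eval:
  assumes "v \<in> carrier_vec (p + q)" "\<And>k. k < m + n \<Longrightarrow> R (E k k) *\<^sub>v v = \<mu> (crd m k) \<cdot>\<^sub>v v"
    and h: "h \<in> cartan m n"
  shows "R h *\<^sub>v v = weight_eval m n \<mu> h \<cdot>\<^sub>v v"
proof -
  have diag: "h \<in> gl m n" "\<And>a b. a < m + n \<Longrightarrow> b < m + n \<Longrightarrow> a \<noteq> b \<Longrightarrow> h $$ (a,b) = 0"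
    using h by (auto simp: cartan_def diagonal_mat_def)
  define r where "r = (\<lambda>F. mat (m+n) (m+n) (\<lambda>(i,j). if i = j \<and> i \<in> F then h $$ (i,i) else 0))"
  have "R (r F) *\<^sub>v v = (\<Sum>k\<in>F. \<mu> (crd m k) * h $$ (k,k)) \<cdot>\<^sub>v v" if "finite F" "F \<subseteq> {..<m+n}" for F
    using that
  proof (induction F)
    case empty
    have "r {} = 0\<^sub>m (m+n) (m+n)" by (auto simp: r_def intro!: eq_matI)
    then show ?case using zero_Rv[OF assms(1)] assms(1) by (auto intro!: eq_vecI)
  next
    case (insert k F)
    have "r (insert k F) = h $$ (k,k) \<cdot>\<^sub>m E k k + r F"
      using insert by (auto simp: r_def intro!: eq_matI)
    moreover have "r F \<in> gl m n" by (simp add: r_def)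
    ultimately have "R (r (insert k F)) *\<^sub>v v = h $$ (k,k) \<cdot>\<^sub>v (\<mu> (crd m k) \<cdot>\<^sub>v v) + R (r F) *\<^sub>v v"
      using insert assms(1,2) by (simp add: add_Rv smult_Rv)
    then show ?case using insert assms(1) by (auto simp: algebra_simps intro!: eq_vecI)
  qed
  from this[of "{..<m+n}"] have "R (r {..<m+n}) *\<^sub>v v = weight_eval m n \<mu> h \<cdot>\<^sub>v v"
    by (simp add: weight_eval_eq)
  moreover have "r {..<m+n} = h" using diag by (auto simp: r_def intro!: eq_matI)
  ultimately show ?thesis by simp
qed

text \<open>Diagonal matrix units span the Cartan subalgebra and each root space is the line of one
  matrix unit, so it suffices to test these. Irreflexivity of \<open>prec\<close> guarantees
  \<open>a \<noteq> b\<close>, as \<open>root_space_ev\<close> demands.\<close>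

lemma highest_weight_iff:
  assumes P: "positive_roots m n \<Sigma> = pos_of m n prec" and irr: "\<And>a. \<not> prec a a"
  shows "has_highest_weight m n p q R \<Sigma> \<mu> \<longleftrightarrow> \<mu> \<in> hstar m n \<and> (\<exists>v. hwv m n p q R prec \<mu> v)"
proof -
  have "(\<forall>h \<in> cartan m n. R h *\<^sub>v v = weight_eval m n \<mu> h \<cdot>\<^sub>v v) \<and>
        (\<forall>\<alpha> \<in> positive_roots m n \<Sigma>. \<forall>x \<in> root_space m n \<alpha>. R x *\<^sub>v v = 0\<^sub>v (p + q)) \<longleftrightarrow>
     (\<forall>k<m+n. R (E k k) *\<^sub>v v = \<mu> (crd m k) \<cdot>\<^sub>v v) \<and>
     (\<forall>a<m+n. \<forall>b<m+n. prec a b \<longrightarrow> R (E a b) *\<^sub>v v = 0\<^sub>v (p + q))" (is "?A \<and> ?B \<longleftrightarrow> ?C \<and> ?D")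
    if v: "v \<in> carrier_vec (p + q)" for v
  proof -
    have "?A \<longleftrightarrow> ?C"
    proof
      assume A: ?A
      show ?C
      proof (intro allI impI)
        fix k assume k: "k < m + n"
        have "weight_eval m n \<mu> (E k k) = (\<Sum>l<m+n. if l = k then \<mu> (crd m k) else 0)"
          unfolding weight_eval_eq by (intro sum.cong) auto
        then show "R (E k k) *\<^sub>v v = \<mu> (crd m k) \<cdot>\<^sub>v v" using A k by simp
      qed
    qed (use cartan_eval[OF v] in blast)
    moreover have "?B \<longleftrightarrow> ?D"
    proof
      assume B: ?B
      show ?D
      proof (intro allI impI)
        fix a b assume ab: "a < m + n" "b < m + n" "prec a b"
        then have "E a b \<in> root_space m n (ev m a - ev m b)"
          using irr by (subst root_space_ev) (auto intro!: exI[of _ 1] eq_matI)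
        then show "R (E a b) *\<^sub>v v = 0\<^sub>v (p + q)" using B ab unfolding P pos_of_def by blast
      qed
    next
      assume D: ?D
      show ?B unfolding P
      proof (intro ballI)
        fix \<alpha> x assume "\<alpha> \<in> pos_of m n prec" and x: "x \<in> root_space m n \<alpha>"
        then obtain a b where ab: "\<alpha> = ev m a - ev m b" "a < m + n" "b < m + n" "prec a b"
          by (auto simp: pos_of_def)
        then obtain c where "x = c \<cdot>\<^sub>m E a b" using x root_space_ev[of a m n b] irr by blast
        then show "R x *\<^sub>v v = 0\<^sub>v (p + q)" using D ab v by (auto simp: smult_Rv)
      qed
    qed
    ultimately show ?thesis by blast
  qed
  then show ?thesis unfolding has_highest_weight_def hwv_def by blast
qed



section \<open>The submodule generated by a highest weight vector, and uniqueness of the highest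
  weight\<close>

definition submod :: "complex vec set \<Rightarrow> bool" where
  "submod W \<longleftrightarrow> W \<subseteq> carrier_vec (p + q) \<and> 0\<^sub>v (p + q) \<in> W \<and>
     (\<forall>v \<in> W. \<forall>w \<in> W. v + w \<in> W) \<and> (\<forall>c. \<forall>v \<in> W. c \<cdot>\<^sub>v v \<in> W) \<and>
     (\<forall>e. \<forall>v \<in> W. vpart p q e v \<in> W) \<and>
     (\<forall>a<m+n. \<forall>b<m+n. \<forall>v \<in> W. R (E a b) *\<^sub>v v \<in> W)"

lemma submod_is_submodule:
  assumes W: "submod W" shows "is_submodule m n p q R W"
proof -
  have "R x *\<^sub>v v \<in> W" if x: "x \<in> gl m n" and v: "v \<in> W" for x v
  proof -
    have vc: "v \<in> carrier_vec (p + q)" using v W by (auto simp: submod_def)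
    show ?thesis using x
    proof (induction x rule: gl_induct)
      case zero
      then show ?case using vc W zero_Rv unfolding submod_def by metis
    next
      case (add x y)
      then show ?case using vc W by (simp add: add_Rv submod_def)
    next
      case (unit a b)
      then show ?case using vc W v by (simp add: smult_Rv submod_def)
    qed
  qed
  moreover have "vec (p + q) (\<lambda>i. if i < p then v $ i else 0) = vpart p q True v" for v :: "complex vec"
    by (simp add: vpart_def)
  ultimately show ?thesis using W unfolding is_submodule_def submod_def by simp
qed

text \<open>Submodules have to be graded, so the generators are the two components of \<open>v\<close>, not \<open>v\<close> itself.\<close>

inductive_set gen :: "(nat \<Rightarrow> nat \<Rightarrow> bool) \<Rightarrow> complex vec \<Rightarrow> complex vec set"
  for prec v where
  gen_base: "vpart p q e v \<in> gen prec v"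
| gen_zero: "0\<^sub>v (p + q) \<in> gen prec v"
| gen_add: "x \<in> gen prec v \<Longrightarrow> y \<in> gen prec v \<Longrightarrow> x + y \<in> gen prec v"
| gen_smult: "x \<in> gen prec v \<Longrightarrow> c \<cdot>\<^sub>v x \<in> gen prec v"
| gen_lower: "x \<in> gen prec v \<Longrightarrow> a < m + n \<Longrightarrow> b < m + n \<Longrightarrow> prec b a \<Longrightarrow> R (E a b) *\<^sub>v x \<in> gen prec v"

lemma gen_carrier: "x \<in> gen prec v \<Longrightarrow> x \<in> carrier_vec (p + q)"
  by (induction rule: gen.induct) auto

lemma E_vpart:
  assumes "x \<in> carrier_vec (p + q)"
  shows "R (E a b) *\<^sub>v vpart p q e x = vpart p q (e = (mpar m a b = 0)) (R (E a b) *\<^sub>v x)"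
  by (rule vpart_mult[OF R_part[OF mpar_01 munit_part] assms mpar_01])

lemma vpart_vpart: "vpart p q e (vpart p q f x) = (if e = f then vpart p q e x else 0\<^sub>v (p + q))"
  by (auto simp: vpart_def)

text \<open>Induction over the generation with \<open>a\<close> and \<open>b\<close> arbitrary:
  \<open>E_comm\<close> moves \<open>E a b\<close> inside the outermost lowering operator, and the
  correction terms are single matrix units applied to a shorter expression. On the generators
  totality leaves three cases: a diagonal unit scales, a raising one kills, a lowering one stays in
  the set by definition.\<close>

lemma gen_submod:
  assumes v: "hwv m n p q R prec \<mu> v"
    and total: "\<And>a b. a < m + n \<Longrightarrow> b < m + n \<Longrightarrow> a = b \<or> prec a b \<or> prec b a"
  shows "submod (gen prec v)"
proof -
  have vc: "v \<in> carrier_vec (p + q)"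
    and vk: "\<And>k. k < m + n \<Longrightarrow> R (E k k) *\<^sub>v v = \<mu> (crd m k) \<cdot>\<^sub>v v"
    and v0: "\<And>a b. a < m + n \<Longrightarrow> b < m + n \<Longrightarrow> prec a b \<Longrightarrow> R (E a b) *\<^sub>v v = 0\<^sub>v (p + q)"
    using v by (auto simp: hwv_def)
  have E: "R (E a b) *\<^sub>v x \<in> gen prec v" if "x \<in> gen prec v" "a < m + n" "b < m + n" for x a b
    using that
  proof (induction arbitrary: a b rule: gen.induct)
    case (gen_base e)
    consider "a = b" | "prec a b" | "prec b a" using total gen_base by blast
    then show ?case
    proof cases
      case 1
      have "R (E a b) *\<^sub>v vpart p q e v = \<mu> (crd m a) \<cdot>\<^sub>v vpart p q e v"
        using 1 vk gen_base E_vpart[OF vc, of a b e] vc by (simp add: mpar_def) (auto simp: vpart_def)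
      then show ?thesis by (simp add: gen.gen_base gen.gen_smult)
    next
      case 2
      have "R (E a b) *\<^sub>v vpart p q e v = 0\<^sub>v (p + q)"
        using 2 v0 gen_base by (simp add: E_vpart[OF vc]) (auto simp: vpart_def)
      then show ?thesis by (simp add: gen.gen_zero)
    next
      case 3
      then show ?thesis using gen_base by (intro gen.gen_lower gen.gen_base)
    qed
  next
    case gen_zero
    then show ?case by (simp add: Rv_zero gen.gen_zero)
  next
    case (gen_add x y)
    then show ?case by (simp add: Rv_add gen_carrier gen.gen_add)
  next
    case (gen_smult x c)
    then show ?case by (simp add: Rv_smult gen_carrier gen.gen_smult)
  next
    case (gen_lower x c d)
    show ?case
      unfolding E_comm[OF gen_lower.prems gen_lower.hyps(2,3) gen_carrier[OF gen_lower.hyps(1)]]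
    proof (intro gen.gen_add gen.gen_smult)
      show "R (E c d) *\<^sub>v (R (E a b) *\<^sub>v x) \<in> gen prec v"
        by (rule gen.gen_lower) (use gen_lower in auto)
    qed (use gen_lower in \<open>auto intro!: gen.gen_zero\<close>)
  qed
  have "vpart p q e x \<in> gen prec v" if "x \<in> gen prec v" for x e
    using that
  proof (induction arbitrary: e rule: gen.induct)
    case (gen_base f)
    then show ?case by (simp add: vpart_vpart gen.gen_base gen.gen_zero)
  next
    case gen_zero
    have "vpart p q e (0\<^sub>v (p + q)) = 0\<^sub>v (p + q)" by (auto simp: vpart_def)
    then show ?case by (simp add: gen.gen_zero)
  next
    case (gen_add x y)
    have "vpart p q e (x + y) = vpart p q e x + vpart p q e y"
      using gen_carrier[OF gen_add(1)] gen_carrier[OF gen_add(2)] by (auto simp: vpart_def)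
    then show ?case using gen_add by (simp add: gen.gen_add)
  next
    case (gen_smult x c)
    have "vpart p q e (c \<cdot>\<^sub>v x) = c \<cdot>\<^sub>v vpart p q e x"
      using gen_carrier[OF gen_smult(1)] by (auto simp: vpart_def)
    then show ?case using gen_smult by (simp add: gen.gen_smult)
  next
    case (gen_lower x a b)
    have "R (E a b) *\<^sub>v vpart p q (e = (mpar m a b = 0)) x = vpart p q e (R (E a b) *\<^sub>v x)"
      using E_vpart[OF gen_carrier[OF gen_lower.hyps(1)], of a b "e = (mpar m a b = 0)"]
      by (cases e; cases "mpar m a b = 0") simp_all
    then show ?case using gen_lower by (metis gen.gen_lower)
  qed
  with E show ?thesis
    unfolding submod_def using gen_carrier
    by (auto intro: gen.gen_zero gen.gen_add gen.gen_smult)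
qed

lemma gen_eq_carrier:
  assumes simple: "is_simple_module m n p q R"
    and v: "hwv m n p q R prec \<mu> v"
    and total: "\<And>a b. a < m + n \<Longrightarrow> b < m + n \<Longrightarrow> a = b \<or> prec a b \<or> prec b a"
  shows "gen prec v = carrier_vec (p + q)"
proof -
  have "is_submodule m n p q R (gen prec v)"
    using submod_is_submodule gen_submod[OF v total] by blast
  then consider "gen prec v = {0\<^sub>v (p + q)}" | "gen prec v = carrier_vec (p + q)"
    using simple by (auto simp: is_simple_module_def)
  then show ?thesis
  proof cases
    case 1
    have "v = vpart p q True v + vpart p q False v"
      using v vpart_split by (metis hwv_def)
    also have "\<dots> \<in> gen prec v" by (intro gen_add gen_base)
    finally show ?thesis using 1 v by (auto simp: hwv_def)
  qed
qed

text \<open>Finite sums of eigenvectors of \<open>R h\<close> whose eigenvalues lie a positive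
  integer below \<open>\<eta>\<close>. The inductive form provides, summand by summand, a polynomial
  in \<open>R h\<close> that kills the sum, without any theory of direct sums.\<close>

inductive_set low :: "complex mat \<Rightarrow> complex \<Rightarrow> complex vec set" for h \<eta> where
  low_zero: "0\<^sub>v (p + q) \<in> low h \<eta>"
| low_add: "x \<in> low h \<eta> \<Longrightarrow> y \<in> carrier_vec (p + q) \<Longrightarrow> 0 < k \<Longrightarrow>
     R h *\<^sub>v y = (\<eta> - of_nat k) \<cdot>\<^sub>v y \<Longrightarrow> x + y \<in> low h \<eta>"

lemma low_carrier: "x \<in> low h \<eta> \<Longrightarrow> x \<in> carrier_vec (p + q)"
  by (induction rule: low.induct) auto

lemma low_plus:
  assumes "x \<in> low h \<eta>" "y \<in> low h \<eta>" shows "x + y \<in> low h \<eta>"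
  using assms(2)
proof induction
  case low_zero
  then show ?case using assms(1) low_carrier[OF assms(1)] by simp
next
  case (low_add y z k)
  have "x + (y + z) = (x + y) + z"
    using low_carrier[OF assms(1)] low_carrier[OF low_add(1)] low_add(2) by (intro eq_vecI) auto
  then show ?case using low.low_add[of "x + y" h \<eta> z k] low_add by simp
qed

lemma low_smult:
  assumes "h \<in> gl m n" "x \<in> low h \<eta>" shows "c \<cdot>\<^sub>v x \<in> low h \<eta>"
  using assms(2)
proof induction
  case low_zero
  have "c \<cdot>\<^sub>v 0\<^sub>v (p + q) = (0\<^sub>v (p + q) :: complex vec)" by (intro eq_vecI) auto
  then show ?case by (simp add: low.low_zero)
next
  case (low_add x y k)
  have "c \<cdot>\<^sub>v (x + y) = c \<cdot>\<^sub>v x + c \<cdot>\<^sub>v y"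
    using low_carrier[OF low_add(1)] low_add(2) by (intro smult_add_distrib_vec)
  moreover have "R h *\<^sub>v (c \<cdot>\<^sub>v y) = (\<eta> - of_nat k) \<cdot>\<^sub>v (c \<cdot>\<^sub>v y)"
    using low_add assms by (simp add: Rv_smult smult_smult_assoc mult.commute)
  ultimately show ?case using low_add by (auto intro!: low.low_add)
qed

text \<open>The product of the operators \<open>R h - (\<eta> - k)\<close> for \<open>k\<close> in
  the list: a polynomial in \<open>R h\<close> that kills every eigenvector with one of the
  eigenvalues \<open>\<eta> - k\<close>.\<close>

fun shifts :: "complex mat \<Rightarrow> complex \<Rightarrow> nat list \<Rightarrow> complex vec \<Rightarrow> complex vec" where
  "shifts h \<eta> [] x = x"
| "shifts h \<eta> (k # ks) x = R h *\<^sub>v shifts h \<eta> ks x + (of_nat k - \<eta>) \<cdot>\<^sub>v shifts h \<eta> ks x"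

lemma shifts_carrier: "h \<in> gl m n \<Longrightarrow> x \<in> carrier_vec (p + q) \<Longrightarrow> shifts h \<eta> ks x \<in> carrier_vec (p + q)"
  by (induction ks) auto

lemma shifts_add:
  "h \<in> gl m n \<Longrightarrow> x \<in> carrier_vec (p + q) \<Longrightarrow> y \<in> carrier_vec (p + q) \<Longrightarrow>
     shifts h \<eta> ks (x + y) = shifts h \<eta> ks x + shifts h \<eta> ks y"
proof (induction ks)
  case (Cons k ks)
  define X Y where "X = shifts h \<eta> ks x" and "Y = shifts h \<eta> ks y"
  have "X \<in> carrier_vec (p + q)" "Y \<in> carrier_vec (p + q)"
    using Cons by (auto simp: X_def Y_def intro!: shifts_carrier)
  then have "R h *\<^sub>v (X + Y) + (of_nat k - \<eta>) \<cdot>\<^sub>v (X + Y) =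
     R h *\<^sub>v X + (of_nat k - \<eta>) \<cdot>\<^sub>v X + (R h *\<^sub>v Y + (of_nat k - \<eta>) \<cdot>\<^sub>v Y)"
    unfolding Rv_add[OF Cons(2) \<open>X \<in> _\<close> \<open>Y \<in> _\<close>]
    using Rv_carrier[OF Cons(2) \<open>X \<in> _\<close>] Rv_carrier[OF Cons(2) \<open>Y \<in> _\<close>]
    by (intro eq_vecI) (auto simp: algebra_simps simp del: Rv_carrier)
  then show ?case using Cons by (simp add: X_def Y_def)
qed simp

lemma shifts_eigen:
  assumes "h \<in> gl m n" "y \<in> carrier_vec (p + q)" "R h *\<^sub>v y = \<kappa> \<cdot>\<^sub>v y"
  shows "shifts h \<eta> ks y = (\<Prod>k\<leftarrow>ks. \<kappa> - \<eta> + of_nat k) \<cdot>\<^sub>v y"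
proof (induction ks)
  case (Cons k ks)
  show ?case unfolding shifts.simps Cons.IH using assms
    by (simp add: Rv_smult) (auto simp: algebra_simps intro!: eq_vecI)
qed simp

text \<open>One factor for each summand. As 0 is not in the list, the same polynomial acts on
  eigenvectors of eigenvalue \<open>\<eta>\<close> by a nonzero scalar.\<close>

lemma low_killed:
  assumes "h \<in> gl m n" "x \<in> low h \<eta>"
  shows "\<exists>ks. 0 \<notin> set ks \<and> shifts h \<eta> ks x = 0\<^sub>v (p + q)"
  using assms(2)
proof induction
  case low_zero
  show ?case by (intro exI[of _ "[]"]) simp
next
  case (low_add x y k)
  then obtain ks where ks: "0 \<notin> set ks" "shifts h \<eta> ks x = 0\<^sub>v (p + q)" by blast
  obtain c where c: "shifts h \<eta> ks y = c \<cdot>\<^sub>v y" using shifts_eigen[OF assms(1) low_add(2,4)] by blast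
  have "shifts h \<eta> (k # ks) (x + y) = 0\<^sub>v (p + q)"
    using low_add assms(1) low_carrier[OF low_add(1)] ks c
    by (simp add: shifts_add Rv_smult) (auto simp: algebra_simps intro!: eq_vecI)
  then show ?case using ks low_add by (intro exI[of _ "k # ks"]) simp
qed


lemma cartan_E:
  assumes h: "h \<in> cartan m n" and ab: "a < m + n" "b < m + n" and y: "y \<in> carrier_vec (p + q)"
  shows "R h *\<^sub>v (R (E a b) *\<^sub>v y) =
    R (E a b) *\<^sub>v (R h *\<^sub>v y) + (h $$ (a,a) - h $$ (b,b)) \<cdot>\<^sub>v (R (E a b) *\<^sub>v y)"
proof -
  have hp: "h \<in> gl_part m n 0" and hg: "h \<in> gl m n"
    using h by (auto simp: cartan_def gl_part_def diagonal_mat_def split: if_splits)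
  have "superbracket 0 (mpar m a b) h (E a b) = (h $$ (a,a) - h $$ (b,b)) \<cdot>\<^sub>m E a b"
  proof (rule eq_matI)
    fix i j assume "i < dim_row ((h $$ (a,a) - h $$ (b,b)) \<cdot>\<^sub>m E a b)"
      "j < dim_col ((h $$ (a,a) - h $$ (b,b)) \<cdot>\<^sub>m E a b)"
    then have ij: "i < m + n" "j < m + n" by auto
    have "superbracket 0 (mpar m a b) h (E a b) = h * E a b - E a b * h"
      using hg by (auto simp: superbracket_def intro!: eq_matI)
    then show "superbracket 0 (mpar m a b) h (E a b) $$ (i,j) = ((h $$ (a,a) - h $$ (b,b)) \<cdot>\<^sub>m E a b) $$ (i,j)"
      using diag_comm_index[OF h munit_carrier ij] ij by auto
  qed (use hg in \<open>auto simp: superbracket_def\<close>)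
  then show ?thesis
    using Rv_comm[OF _ mpar_01 hp munit_part y, of a b] Rv_carrier[OF munit_carrier, of "R h *\<^sub>v y"] y hg
    by (simp add: smult_Rv del: Rv_carrier)
qed

text \<open>The element \<open>h\<close> takes negative integer values on all negative roots, so
  every lowering step reduces the eigenvalue of \<open>R h\<close>. The top part \<open>u\<close>
  need not be a multiple of \<open>v\<close>, since the two parity components of \<open>v\<close>
  are separate generators; only its weight is recorded.\<close>

lemma gen_decomp:
  assumes v: "hwv m n p q R prec \<mu> v" and h: "h \<in> cartan m n"
    and low: "\<And>a b. a < m + n \<Longrightarrow> b < m + n \<Longrightarrow> prec b a \<Longrightarrow> \<exists>k>0. h $$ (a,a) - h $$ (b,b) = - of_nat k"
    and x: "x \<in> gen prec v"
  shows "\<exists>u l. x = u + l \<and> u \<in> carrier_vec (p + q) \<and>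
    (\<forall>k<m+n. R (E k k) *\<^sub>v u = \<mu> (crd m k) \<cdot>\<^sub>v u) \<and> l \<in> low h (weight_eval m n \<mu> h)"
proof -
  let ?\<eta> = "weight_eval m n \<mu> h"
  let ?U = "\<lambda>u. u \<in> carrier_vec (p + q) \<and> (\<forall>k<m+n. R (E k k) *\<^sub>v u = \<mu> (crd m k) \<cdot>\<^sub>v u)"
  have vc: "v \<in> carrier_vec (p + q)"
    and vk: "\<And>k. k < m + n \<Longrightarrow> R (E k k) *\<^sub>v v = \<mu> (crd m k) \<cdot>\<^sub>v v"
    using v by (auto simp: hwv_def)
  have hg: "h \<in> gl m n" using h by (simp add: cartan_def)
  have zero_U: "?U (0\<^sub>v (p + q))" by (auto simp: Rv_zero intro!: eq_vecI)
  have lower: "R (E a b) *\<^sub>v y \<in> carrier_vec (p + q) \<and>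
      (\<exists>j>0. R h *\<^sub>v (R (E a b) *\<^sub>v y) = (?\<eta> - of_nat j) \<cdot>\<^sub>v (R (E a b) *\<^sub>v y))"
    if ab: "a < m + n" "b < m + n" "prec b a" and y: "y \<in> carrier_vec (p + q)"
      "R h *\<^sub>v y = (?\<eta> - of_nat k) \<cdot>\<^sub>v y" for a b y k
  proof -
    obtain i where i: "i > 0" "h $$ (a,a) - h $$ (b,b) = - of_nat i" using low[OF ab] by blast
    have "R (E a b) *\<^sub>v y \<in> carrier_vec (p + q)" using y by simp
    moreover from this have "R h *\<^sub>v (R (E a b) *\<^sub>v y) = (?\<eta> - of_nat (k + i)) \<cdot>\<^sub>v (R (E a b) *\<^sub>v y)"
      unfolding cartan_E[OF h ab(1,2) y(1)] y(2) i(2) Rv_smult[OF munit_carrier y(1)]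
      by (intro eq_vecI) (auto simp: algebra_simps)
    ultimately show ?thesis using i(1) by (metis add_gr_0)
  qed
  show ?thesis using x
  proof induction
    case (gen_base e)
    have "?U (vpart p q e v)"
      using vk E_vpart[OF vc, of _ _ e] vc by (simp add: mpar_def) (auto simp: vpart_def)
    then show ?case
      by (intro exI[of _ "vpart p q e v"] exI[of _ "0\<^sub>v (p + q)"]) (auto intro: low_zero)
  next
    case gen_zero
    show ?case
      by (intro exI[of _ "0\<^sub>v (p + q)"]) (use zero_U in \<open>auto intro: low_zero\<close>)
  next
    case (gen_add x y)
    then obtain u l u' l' where ul: "x = u + l" "?U u" "l \<in> low h ?\<eta>"
      "y = u' + l'" "?U u'" "l' \<in> low h ?\<eta>" by blast
    have "x + y = (u + u') + (l + l')"
      using ul low_carrier[OF ul(3)] low_carrier[OF ul(6)] by (intro eq_vecI) auto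
    moreover have "?U (u + u')" using ul by (auto simp: Rv_add smult_add_distrib_vec[of _ "p+q"])
    ultimately show ?case using low_plus ul by blast
  next
    case (gen_smult x c)
    then obtain u l where ul: "x = u + l" "?U u" "l \<in> low h ?\<eta>" by blast
    have "c \<cdot>\<^sub>v x = c \<cdot>\<^sub>v u + c \<cdot>\<^sub>v l"
      using ul low_carrier[OF ul(3)] by (auto intro: smult_add_distrib_vec)
    moreover have "?U (c \<cdot>\<^sub>v u)" using ul by (auto simp: Rv_smult smult_smult_assoc mult.commute)
    ultimately show ?case using low_smult[OF hg ul(3)] by blast
  next
    case (gen_lower x a b)
    then obtain u l where ul: "x = u + l" "?U u" "l \<in> low h ?\<eta>" by blast
    \<comment> \<open>Writing \<open>\<eta>\<close> as \<open>\<eta> - of_nat 0\<close> makes the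
      fact \<open>lower\<close> apply to the top part as well.\<close>
    have hu: "R h *\<^sub>v u = (?\<eta> - of_nat 0) \<cdot>\<^sub>v u" using cartan_eval[OF _ _ h] ul by simp
    have lc: "l \<in> carrier_vec (p + q)" using low_carrier ul(3) by blast
    have 1: "0\<^sub>v (p + q) + R (E a b) *\<^sub>v u \<in> low h ?\<eta>"
      using lower[OF gen_lower(2,3,4) _ hu] ul(2) by (blast intro: low_add low_zero)
    have 2: "R (E a b) *\<^sub>v l \<in> low h ?\<eta>"
      using ul(3)
    proof induction
      case low_zero
      then show ?case by (simp add: Rv_zero low.low_zero)
    next
      case (low_add y z k)
      have "R (E a b) *\<^sub>v (y + z) = R (E a b) *\<^sub>v y + R (E a b) *\<^sub>v z"
        using low_carrier[OF low_add(1)] low_add(2) by (simp add: Rv_add)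
      then show ?case using lower[OF gen_lower(2,3,4) low_add(2,4)] low_add(5)
        by (metis low.low_add)
    qed
    have "R (E a b) *\<^sub>v x = 0\<^sub>v (p + q) + ((0\<^sub>v (p + q) + R (E a b) *\<^sub>v u) + R (E a b) *\<^sub>v l)"
      using ul lc Rv_carrier[OF munit_carrier, of u a b] Rv_carrier[OF munit_carrier, of l a b]
      by (simp add: Rv_add del: Rv_carrier)
    then show ?case using low_plus[OF 1 2] zero_U by blast
  qed
qed

text \<open>Each of the two vectors generates the whole module, so for a height element
  \<open>h\<close> each weight has the value of the other minus a natural number; hence the values
  agree. Then the second vector has no lower part in the decomposition by the first, and so has the
  weight of the first.\<close>

lemma hw_unique:
  assumes simple: "is_simple_module m n p q R"
    and v: "hwv m n p q R prec \<mu> v" and v': "hwv m n p q R prec \<mu>' v'"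
    and total: "\<And>a b. a < m + n \<Longrightarrow> b < m + n \<Longrightarrow> a = b \<or> prec a b \<or> prec b a"
    and trans: "\<And>a b c. prec a b \<Longrightarrow> prec b c \<Longrightarrow> prec a c" and irr: "\<And>a. \<not> prec a a"
    and k: "k < m + n"
  shows "\<mu> (crd m k) = \<mu>' (crd m k)"
proof -
  \<comment> \<open>The number of later indices strictly decreases along \<open>prec\<close>; as a
    diagonal matrix it is negative on negative roots.\<close>
  define ht where "ht = (\<lambda>k. card {l. l < m + n \<and> prec k l})"
  define h where "h = mat (m + n) (m + n) (\<lambda>(i,j). if i = j then of_nat (ht i) else 0 :: complex)"
  have h: "h \<in> cartan m n" by (auto simp: h_def cartan_def diagonal_mat_def)
  then have hg: "h \<in> gl m n" by (simp add: cartan_def)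
  have low: "\<exists>k>0. h $$ (a,a) - h $$ (b,b) = - of_nat k" if ab: "a < m + n" "b < m + n" "prec b a" for a b
  proof -
    have "ht a < ht b" unfolding ht_def
    proof (rule psubset_card_mono)
      have "a \<in> {l. l < m + n \<and> prec b l}" "a \<notin> {l. l < m + n \<and> prec a l}" using ab irr by auto
      then show "{l. l < m + n \<and> prec a l} \<subset> {l. l < m + n \<and> prec b l}" using ab trans by blast
    qed simp
    then show ?thesis using ab
      by (intro exI[of _ "ht b - ht a"]) (auto simp: h_def of_nat_diff)
  qed
  have vc: "v \<in> carrier_vec (p + q)" if "hwv m n p q R prec \<mu> v" for v \<mu>
    using that by (simp add: hwv_def)
  have decomp: "\<exists>u l ks. y = u + l \<and> u \<in> carrier_vec (p + q) \<and> l \<in> carrier_vec (p + q) \<and>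
      (\<forall>k<m+n. R (E k k) *\<^sub>v u = \<mu> (crd m k) \<cdot>\<^sub>v u) \<and> R h *\<^sub>v u = weight_eval m n \<mu> h \<cdot>\<^sub>v u \<and>
      0 \<notin> set ks \<and> shifts h (weight_eval m n \<mu> h) ks l = 0\<^sub>v (p + q)"
    if x: "hwv m n p q R prec \<mu> x" and y: "y \<in> carrier_vec (p + q)" for x y \<mu>
  proof -
    have "y \<in> gen prec x" using gen_eq_carrier[OF simple x total] y by simp
    from gen_decomp[OF x h low this] obtain u l where ul: "y = u + l" "u \<in> carrier_vec (p + q)"
      "\<forall>k<m+n. R (E k k) *\<^sub>v u = \<mu> (crd m k) \<cdot>\<^sub>v u" "l \<in> low h (weight_eval m n \<mu> h)" by blast
    moreover obtain ks where "0 \<notin> set ks" "shifts h (weight_eval m n \<mu> h) ks l = 0\<^sub>v (p + q)"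
      using low_killed[OF hg ul(4)] by blast
    ultimately show ?thesis using low_carrier cartan_eval[OF _ _ h] by blast
  qed
  have below: "\<exists>k. weight_eval m n \<nu> h = weight_eval m n \<mu> h - of_nat k"
    if x: "hwv m n p q R prec \<mu> x" and y: "hwv m n p q R prec \<nu> y" for x y \<mu> \<nu>
  proof -
    let ?\<eta> = "weight_eval m n \<mu> h" and ?\<kappa> = "weight_eval m n \<nu> h"
    obtain u l ks where ul: "y = u + l" "u \<in> carrier_vec (p + q)" "l \<in> carrier_vec (p + q)"
      "R h *\<^sub>v u = ?\<eta> \<cdot>\<^sub>v u" "shifts h ?\<eta> ks l = 0\<^sub>v (p + q)"
      using decomp[OF x vc[OF y]] by blast
    have hy: "R h *\<^sub>v y = ?\<kappa> \<cdot>\<^sub>v y" using y cartan_eval[OF _ _ h] by (auto simp: hwv_def)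
    \<comment> \<open>The extra 0 in the list kills the top part \<open>u\<close> too, so the
      polynomial annihilates \<open>y\<close>, and the eigenvalue of \<open>y\<close> must be one of
      its roots.\<close>
    have "shifts h ?\<eta> (0 # ks) y = shifts h ?\<eta> (0 # ks) u + shifts h ?\<eta> (0 # ks) l"
      unfolding ul(1) by (rule shifts_add[OF hg ul(2,3)])
    also have "shifts h ?\<eta> (0 # ks) u = 0\<^sub>v (p + q)"
      unfolding shifts_eigen[OF hg ul(2,4)] using ul(2) by auto
    also have "shifts h ?\<eta> (0 # ks) l = 0\<^sub>v (p + q)" using ul(5) hg by (auto simp: Rv_zero)
    finally have "(\<Prod>k\<leftarrow>0 # ks. ?\<kappa> - ?\<eta> + of_nat k) \<cdot>\<^sub>v y = 0\<^sub>v (p + q)"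
      using shifts_eigen[OF hg vc[OF y] hy, of ?\<eta> "0 # ks"] by (simp del: shifts.simps)
    moreover have "c = 0" if "c \<cdot>\<^sub>v y = 0\<^sub>v (p + q)" for c
    proof (rule ccontr)
      assume "c \<noteq> 0"
      then have "y = inverse c \<cdot>\<^sub>v (c \<cdot>\<^sub>v y)" by (simp add: smult_smult_assoc)
      also have "\<dots> = 0\<^sub>v (p + q)" unfolding that by auto
      finally show False using y by (simp add: hwv_def)
    qed
    ultimately have "0 \<in> set (map (\<lambda>k. ?\<kappa> - ?\<eta> + of_nat k) (0 # ks))"
      unfolding prod_list_zero_iff[symmetric] by blast
    then obtain k where "?\<kappa> - ?\<eta> + of_nat k = 0" by auto
    then show ?thesis by (intro exI[of _ k]) (simp add: algebra_simps add_eq_0_iff)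
  qed
  obtain i j where ij: "weight_eval m n \<mu>' h = weight_eval m n \<mu> h - of_nat i"
    "weight_eval m n \<mu> h = weight_eval m n \<mu>' h - of_nat j"
    using below[OF v v'] below[OF v' v] by blast
  have "of_nat i = weight_eval m n \<mu> h - weight_eval m n \<mu>' h" using ij(1) by (simp add: algebra_simps)
  moreover have "of_nat j = weight_eval m n \<mu>' h - weight_eval m n \<mu> h" using ij(2) by (simp add: algebra_simps)
  ultimately have "of_nat (i + j) = (0::complex)" by simp
  then have "i = 0" by (metis add_eq_0_iff_both_eq_0 of_nat_eq_0_iff)
  then have eq: "weight_eval m n \<mu>' h = weight_eval m n \<mu> h" using ij by simp
  let ?\<eta> = "weight_eval m n \<mu> h"
  obtain u l ks where ul: "v' = u + l" "u \<in> carrier_vec (p + q)" "l \<in> carrier_vec (p + q)"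
    "\<forall>k<m+n. R (E k k) *\<^sub>v u = \<mu> (crd m k) \<cdot>\<^sub>v u"
    "R h *\<^sub>v u = ?\<eta> \<cdot>\<^sub>v u" "0 \<notin> set ks" "shifts h ?\<eta> ks l = 0\<^sub>v (p + q)"
    using decomp[OF v vc[OF v']] by blast
  have hv': "R h *\<^sub>v v' = ?\<eta> \<cdot>\<^sub>v v'" using v' cartan_eval[OF _ _ h] eq by (auto simp: hwv_def)
  \<comment> \<open>Without the extra 0 the polynomial kills only the lower part; \<open>c\<close>
    is its nonzero value at the top eigenvalue, acting alike on \<open>v'\<close> and
    \<open>u\<close>.\<close>
  define c :: complex where "c = (\<Prod>k\<leftarrow>ks. of_nat k)"
  have c: "c \<noteq> 0" using ul(6) by (auto simp: c_def prod_list_zero_iff)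
  have "c \<cdot>\<^sub>v v' = shifts h ?\<eta> ks u + shifts h ?\<eta> ks l"
    using shifts_eigen[OF hg vc[OF v'] hv', of ?\<eta> ks] shifts_add[OF hg ul(2,3), of ?\<eta> ks] ul(1) by (simp add: c_def)
  also have "\<dots> = c \<cdot>\<^sub>v u" using shifts_eigen[OF hg ul(2,5), of ?\<eta> ks] ul by (simp add: c_def)
  finally have "inverse c \<cdot>\<^sub>v (c \<cdot>\<^sub>v v') = inverse c \<cdot>\<^sub>v (c \<cdot>\<^sub>v u)" by simp
  then have "v' = u" using c by (simp add: smult_smult_assoc)
  then have "\<mu> (crd m k) \<cdot>\<^sub>v v' = \<mu>' (crd m k) \<cdot>\<^sub>v v'" using ul(4) v' k by (auto simp: hwv_def)
  moreover obtain r where "r < p + q" "v' $ r \<noteq> 0"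
    using v' by (metis (no_types) hwv_def carrier_vecD eq_vecI index_zero_vec)
  ultimately show ?thesis
    using vc[OF v'] by (metis carrier_vecD index_smult_vec(1) mult_cancel_right)
qed

text \<open>
  If \<open>\<mu>\<close> is orthogonal to the simple root, then \<open>E\<^bsub>lk\<^esub> v\<close> is a highest weight vector for the old
  order, so it vanishes by uniqueness.
\<close>

lemma odd_reflection:
  assumes simple: "is_simple_module m n p q R"
    and v: "hwv m n p q R prec \<mu> v"
    and total: "\<And>a b. a < m + n \<Longrightarrow> b < m + n \<Longrightarrow> a = b \<or> prec a b \<or> prec b a"
    and trans: "\<And>a b c. prec a b \<Longrightarrow> prec b c \<Longrightarrow> prec a c" and irr: "\<And>a. \<not> prec a a"
    and kl: "k < m + n" "l < m + n" "prec k l" "mpar m k l = 1"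
    and adj: "\<And>z. z < m + n \<Longrightarrow> \<not> (prec k z \<and> prec z l)"
  defines "prec' \<equiv> \<lambda>a b. a = l \<and> b = k \<or> prec a b \<and> \<not> (a = k \<and> b = l)"
  shows "if \<mu> (crd m k) + \<mu> (crd m l) = 0 then hwv m n p q R prec' \<mu> v
    else hwv m n p q R prec' (\<mu> - (ev m k - ev m l)) (R (E l k) *\<^sub>v v)"
proof -
  have vc: "v \<in> carrier_vec (p + q)" and vnz: "v \<noteq> 0\<^sub>v (p + q)"
    and vk: "\<And>k. k < m + n \<Longrightarrow> R (E k k) *\<^sub>v v = \<mu> (crd m k) \<cdot>\<^sub>v v"
    and v0: "\<And>a b. a < m + n \<Longrightarrow> b < m + n \<Longrightarrow> prec a b \<Longrightarrow> R (E a b) *\<^sub>v v = 0\<^sub>v (p + q)"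
    using v by (auto simp: hwv_def)
  define w where "w = R (E l k) *\<^sub>v v"
  have wc: "w \<in> carrier_vec (p + q)" using vc by (simp add: w_def)
  have ne: "k \<noteq> l" "l \<noteq> k" using kl irr by auto
  have mlk: "mpar m l k = 1" using kl(4) by (simp add: mpar_def split: if_splits)
  have z: "c \<cdot>\<^sub>v 0\<^sub>v (p + q) = (0\<^sub>v (p + q) :: complex vec)" for c by (intro eq_vecI) auto
  \<comment> \<open>Both operators are odd, so their bracket is the sum of the two diagonal units,
    and \<open>v\<close> is killed by \<open>E k l\<close>. The scalar is the pairing of
    \<open>\<mu>\<close> with the isotropic root, up to sign.\<close>
  have Ew: "R (E k l) *\<^sub>v w = (\<mu> (crd m k) + \<mu> (crd m l)) \<cdot>\<^sub>v v"
    using E_comm[OF kl(1,2) kl(2,1) vc] kl(4) mlk vk[OF kl(1)] vk[OF kl(2)] v0[OF kl(1-3)] vc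
    by (simp add: w_def Rv_zero z) (auto simp: algebra_simps)
  \<comment> \<open>The bracket of the odd element \<open>E l k\<close> with itself is zero, so its
    square acts as its own negative.\<close>
  have Fw: "R (E l k) *\<^sub>v w = 0\<^sub>v (p + q)"
  proof -
    have "R (E l k) *\<^sub>v w = - 1 \<cdot>\<^sub>v (R (E l k) *\<^sub>v w)"
      using E_comm[OF kl(2,1) kl(2,1) vc] mlk ne wc Rv_carrier[OF munit_carrier wc, of l k]
      by (simp add: w_def[symmetric] z del: Rv_carrier)
    moreover have "y = 0\<^sub>v (p + q)" if "y = - 1 \<cdot>\<^sub>v y" "y \<in> carrier_vec (p + q)" for y :: "complex vec"
    proof (rule eq_vecI)
      fix i assume i: "i < dim_vec (0\<^sub>v (p + q))"
      then have "y $ i = - (y $ i)" using that(2) arg_cong[OF that(1), of "\<lambda>y. y $ i"] by simp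
      then show "y $ i = 0\<^sub>v (p + q) $ i" using i by simp
    qed (use that in auto)
    ultimately show ?thesis using Rv_carrier[OF munit_carrier wc] by blast
  qed
  have wk: "R (E a a) *\<^sub>v w = (\<mu> - (ev m k - ev m l)) (crd m a) \<cdot>\<^sub>v w" if a: "a < m + n" for a
  proof -
    have "R (E a a) *\<^sub>v w = \<mu> (crd m a) \<cdot>\<^sub>v w + ((if a = l then w else 0\<^sub>v (p + q)) +
        (-1) \<cdot>\<^sub>v (if k = a then w else 0\<^sub>v (p + q)))"
      using E_comm[OF a a kl(2,1) vc] vk[OF a] vc
      by (auto simp: w_def mpar_def Rv_smult)
    then show ?thesis using wc ne by (auto simp: algebra_simps intro!: eq_vecI)
  qed
  \<comment> \<open>The bracket of \<open>E a b\<close> with \<open>E l k\<close> involves at most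
    \<open>E a k\<close> and \<open>E l b\<close>. As nothing lies between \<open>k\<close> and
    \<open>l\<close>, these are raising operators again and kill \<open>v\<close>.\<close>
  have w0: "R (E a b) *\<^sub>v w = 0\<^sub>v (p + q)"
    if ab: "a < m + n" "b < m + n" "prec a b" "\<not> (a = k \<and> b = l)" for a b
  proof -
    have "(if b = l then R (E a k) *\<^sub>v v else 0\<^sub>v (p + q)) = 0\<^sub>v (p + q)"
    proof (cases "b = l")
      case True
      then have "prec a k" using ab total[OF ab(1) kl(1)] adj[OF ab(1)] by auto
      then show ?thesis using v0 ab kl by simp
    qed simp
    moreover have "(if k = a then R (E l b) *\<^sub>v v else 0\<^sub>v (p + q)) = 0\<^sub>v (p + q)"
    proof (cases "k = a")
      case True
      then have "prec l b" using ab total[OF ab(2) kl(2)] adj[OF ab(2)] by auto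
      then show ?thesis using v0 ab kl by simp
    qed simp
    ultimately show ?thesis
      using E_comm[OF ab(1,2) kl(2,1) vc] v0[OF ab(1-3)] by (simp add: w_def Rv_zero z)
  qed
  show ?thesis
  proof (cases "\<mu> (crd m k) + \<mu> (crd m l) = 0")
    case True
    have "w = 0\<^sub>v (p + q)"
    proof (rule ccontr)
      assume "w \<noteq> 0\<^sub>v (p + q)"
      moreover have "R (E k l) *\<^sub>v w = 0\<^sub>v (p + q)" using Ew True vc by auto
      ultimately have "hwv m n p q R prec (\<mu> - (ev m k - ev m l)) w"
        using wc wk w0 unfolding hwv_def by blast
      from hw_unique[OF simple v this total trans irr kl(1)] show False using ne by simp
    qed
    then have "hwv m n p q R prec' \<mu> v"
      using vc vnz vk v0 unfolding hwv_def prec'_def w_def by blast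
    then show ?thesis using True by simp
  next
    case False
    have "w \<noteq> 0\<^sub>v (p + q)"
    proof
      assume "w = 0\<^sub>v (p + q)"
      then have "(\<mu> (crd m k) + \<mu> (crd m l)) \<cdot>\<^sub>v v = 0\<^sub>v (p + q)" using Ew by (simp add: Rv_zero)
      then have "inverse (\<mu> (crd m k) + \<mu> (crd m l)) \<cdot>\<^sub>v ((\<mu> (crd m k) + \<mu> (crd m l)) \<cdot>\<^sub>v v) = 0\<^sub>v (p + q)"
        using z by simp
      then show False using False vnz by (simp add: smult_smult_assoc)
    qed
    then have "hwv m n p q R prec' (\<mu> - (ev m k - ev m l)) w"
      using wc wk w0 Fw unfolding hwv_def prec'_def by blast
    then show ?thesis using False by (simp add: w_def)
  qed
qed

end

section \<open>Existence of a simple module of the given highest weight\<close>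

text \<open>A basis of \<open>N\<close> is extended to one of \<open>W\<close> and then to one of
  the whole space; the vectors added in the first extension represent a basis of the quotient.
  Because \<open>\<phi>\<close> is made of coordinate functions of the large basis, it is linear
  everywhere and no quotient space has to be formed.\<close>

lemma (in finite_dimensional_vector_space) quotient_coordinates:
  assumes N: "subspace N" and W: "subspace W" and NW: "N \<subseteq> W"
  obtains ds :: "'b list" and \<phi> :: "nat \<Rightarrow> 'b \<Rightarrow> 'a" where
    "\<And>i v w. \<phi> i (v + w) = \<phi> i v + \<phi> i w" "\<And>i c v. \<phi> i (c *s v) = c * \<phi> i v"
    "set ds \<subseteq> W" "\<And>i j. i < length ds \<Longrightarrow> j < length ds \<Longrightarrow> \<phi> i (ds ! j) = (if i = j then 1 else 0)"
    "\<And>i w. i < length ds \<Longrightarrow> w \<in> N \<Longrightarrow> \<phi> i w = 0"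
    "\<And>w. w \<in> W \<Longrightarrow> w - (\<Sum>i<length ds. \<phi> i w *s ds ! i) \<in> N"
proof -
  obtain B where B: "B \<subseteq> N" "independent B" "N \<subseteq> span B" using basis_exists[of N] by metis
  obtain C where C: "B \<subseteq> C" "C \<subseteq> W" "independent C" "W \<subseteq> span C"
    using maximal_independent_subset_extend[of B W] B NW by blast
  have finC: "finite C" using C finiteI_independent by blast
  then obtain ds where ds: "set ds = C - B" "distinct ds"
    using finite_distinct_list[of "C - B"] by blast
  define X where "X = extend_basis C"
  have X: "C \<subseteq> X" "independent X" "span X = UNIV"
    using extend_basis_superset independent_extend_basis span_extend_basis C(3) by (auto simp: X_def)
  define \<phi> where "\<phi> = (\<lambda>i v. representation X v (ds ! i))"
  have dsB: "ds ! i \<in> C - B" if "i < length ds" for i using that ds by (metis nth_mem)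
  show ?thesis
  proof (rule that[of \<phi> ds])
    show "\<phi> i (v + w) = \<phi> i v + \<phi> i w" for i v w
      using X by (simp add: \<phi>_def representation_add)
    show "\<phi> i (c *s v) = c * \<phi> i v" for i c v
      using X by (simp add: \<phi>_def representation_scale)
    show "set ds \<subseteq> W" using ds C by auto
    show "\<phi> i (ds ! j) = (if i = j then 1 else 0)" if "i < length ds" "j < length ds" for i j
      using representation_basis[OF X(2), of "ds ! j"] dsB[OF that(2)] X(1) ds(2) that
      by (auto simp: \<phi>_def nth_eq_iff_index_eq)
    show "\<phi> i w = 0" if i: "i < length ds" and w: "w \<in> N" for i w
    proof -
      have wB: "w \<in> span B" using w B by blast
      have "representation X w = representation B w"
        using representation_extend[OF X(2) wB] B C X by auto
      then show ?thesis using dsB[OF i] representation_ne_zero[of B w "ds ! i"] by (auto simp: \<phi>_def)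
    qed
    show "w - (\<Sum>i<length ds. \<phi> i w *s ds ! i) \<in> N" if w: "w \<in> W" for w
    proof -
      have "representation X w = representation C w"
        using representation_extend[OF X(2) _ X(1)] C w by auto
      then have "w = (\<Sum>b\<in>C. representation X w b *s b)"
        using sum_representation_eq[OF C(3) _ finC order_refl, of w] w C(4) by auto
      also have "\<dots> = (\<Sum>b\<in>B. representation X w b *s b) + (\<Sum>b\<in>C-B. representation X w b *s b)"
        using sum.subset_diff[OF C(1) finC, of "\<lambda>b. representation X w b *s b"] by (simp add: add.commute)
      also have "(\<Sum>b\<in>C-B. representation X w b *s b) = (\<Sum>i<length ds. \<phi> i w *s ds ! i)"
        unfolding ds(1)[symmetric] \<phi>_def
        by (rule sum.reindex_bij_betw[symmetric, OF bij_betw_nth[OF ds(2) refl refl]])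
      finally have "w - (\<Sum>i<length ds. \<phi> i w *s ds ! i) = (\<Sum>b\<in>B. representation X w b *s b)"
        by (metis add_diff_cancel_right')
      also have "\<dots> \<in> N" using B N by (intro subspace_sum subspace_scale) auto
      finally show ?thesis .
    qed
  qed
qed

lemma sum_fun_apply: "(\<Sum>i\<in>A. f i) x = (\<Sum>i\<in>A. f i x)"
  by (induction A rule: infinite_finite_induct) auto

text \<open>Representation spaces are functions on a finite index type, so a tensor product lives on
  a product type; the basis consists of the indicator functions.\<close>

interpretation fs: finite_dimensional_vector_space
  "\<lambda>(c::complex) (f::'b::finite \<Rightarrow> complex) i. c * f i" "range (\<lambda>i j. if i = j then 1 else 0)"
proof unfold_locales
  let ?s = "\<lambda>(c::complex) (f::'b \<Rightarrow> complex) i. c * f i"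
  let ?u = "\<lambda>(i::'b) j. if i = j then 1 else (0::complex)"
  interpret vector_space ?s by unfold_locales (auto simp: fun_eq_iff algebra_simps)
  show "finite (range ?u)" by simp
  have inj: "inj ?u" by (auto simp: inj_def fun_eq_iff split: if_splits)
  have expand: "(\<Sum>v\<in>range ?u. ?s (c v) v) = (\<lambda>i. c (?u i))" for c
  proof
    fix x
    have "(\<Sum>v\<in>range ?u. ?s (c v) v) x = (\<Sum>i\<in>UNIV. c (?u i) * ?u i x)"
      by (subst sum.reindex[OF inj]) (simp add: sum_fun_apply)
    also have "\<dots> = (\<Sum>i\<in>UNIV. if x = i then c (?u i) else 0)" by (intro sum.cong) auto
    finally show "(\<Sum>v\<in>range ?u. ?s (c v) v) x = c (?u x)" by simp
  qed
  show "independent (range ?u)"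
  proof (rule independent_if_scalars_zero)
    fix c :: "('b \<Rightarrow> complex) \<Rightarrow> complex" and v
    assume "(\<Sum>v\<in>range ?u. ?s (c v) v) = 0" "v \<in> range ?u"
    then show "c v = 0" unfolding expand by (auto dest: fun_cong)
  qed simp
  show "span (range ?u) = UNIV"
  proof (intro equalityI subsetI UNIV_I)
    fix f :: "'b \<Rightarrow> complex"
    define c where "c = (\<lambda>v. f (the_inv ?u v))"
    have "(\<Sum>v\<in>range ?u. ?s (c v) v) = f"
      unfolding expand by (simp add: c_def the_inv_f_f[OF inj])
    moreover have "(\<Sum>v\<in>range ?u. ?s (c v) v) \<in> span (range ?u)"
      by (intro span_sum span_scale span_base)
    ultimately show "f \<in> span (range ?u)" by simp
  qed
qed (auto simp: fun_eq_iff algebra_simps)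


section \<open>Representations on coordinate spaces and their tensor products\<close>

definition sg :: "bool \<Rightarrow> complex" where
  "sg b = (if b then - 1 else 1)"

text \<open>
  The value \<open>True\<close> of \<open>par\<close> means odd; \<open>T x i j\<close> is the coefficient of the \<open>i\<close>-th basis vector in
  the image of the \<open>j\<close>-th one under \<open>x\<close>.
\<close>

definition kernel_rep :: "nat \<Rightarrow> nat \<Rightarrow> ('b::finite \<Rightarrow> bool) \<Rightarrow> (complex mat \<Rightarrow> 'b \<Rightarrow> 'b \<Rightarrow> complex) \<Rightarrow> bool" where
  "kernel_rep m n par T \<longleftrightarrow>
     (\<forall>x \<in> gl m n. \<forall>y \<in> gl m n. \<forall>i j. T (x + y) i j = T x i j + T y i j) \<and>
     (\<forall>c. \<forall>x \<in> gl m n. \<forall>i j. T (c \<cdot>\<^sub>m x) i j = c * T x i j) \<and>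
     (\<forall>a \<in> {0,1}. \<forall>x \<in> gl_part m n a. \<forall>i j. T x i j \<noteq> 0 \<longrightarrow> (a = 0 \<longleftrightarrow> par i = par j)) \<and>
     (\<forall>a \<in> {0,1}. \<forall>b \<in> {0,1}. \<forall>x \<in> gl_part m n a. \<forall>y \<in> gl_part m n b. \<forall>i j.
        T (superbracket a b x y) i j =
          (\<Sum>k\<in>UNIV. T x i k * T y k j) - (-1) ^ (a * b) * (\<Sum>k\<in>UNIV. T y i k * T x k j))"

definition app :: "(complex mat \<Rightarrow> 'b::finite \<Rightarrow> 'b \<Rightarrow> complex) \<Rightarrow> complex mat \<Rightarrow> ('b \<Rightarrow> complex) \<Rightarrow> 'b \<Rightarrow> complex" where
  "app T x f = (\<lambda>i. \<Sum>j\<in>UNIV. T x i j * f j)"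

lemma app_add: "app T x (\<lambda>i. f i + g i) = (\<lambda>i. app T x f i + app T x g i)"
  and app_diff: "app T x (\<lambda>i. f i - g i) = (\<lambda>i. app T x f i - app T x g i)"
  and app_scale: "app T x (\<lambda>i. c * f i) = (\<lambda>i. c * app T x f i)"
  and app_zero: "app T x (\<lambda>i. 0) = (\<lambda>i. 0)"
  by (simp_all add: app_def distrib_left right_diff_distrib sum.distrib sum_subtractf sum_distrib_left
      mult.left_commute)

text \<open>Homogeneity of \<open>f\<close> is included because it makes the sign in the tensor
  product action disappear wherever the second factor is nonzero.\<close>

definition kernel_hwv :: "nat \<Rightarrow> nat \<Rightarrow> ('b::finite \<Rightarrow> bool) \<Rightarrow> (complex mat \<Rightarrow> 'b \<Rightarrow> 'b \<Rightarrow> complex) \<Rightarrow>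
    weight \<Rightarrow> ('b \<Rightarrow> complex) \<Rightarrow> bool" where
  "kernel_hwv m n par T \<mu> f \<longleftrightarrow> (\<exists>i. f i \<noteq> 0) \<and> (\<exists>e. \<forall>i. f i \<noteq> 0 \<longrightarrow> par i = e) \<and>
     (\<forall>k<m+n. app T (munit (m + n) k k) f = (\<lambda>i. \<mu> (crd m k) * f i)) \<and>
     (\<forall>a<m+n. \<forall>b<m+n. a < b \<longrightarrow> app T (munit (m + n) a b) f = (\<lambda>i. 0))"

definition tensor_par :: "('b \<Rightarrow> bool) \<Rightarrow> ('c \<Rightarrow> bool) \<Rightarrow> 'b \<times> 'c \<Rightarrow> bool" where
  "tensor_par par par' = (\<lambda>(i, k). par i \<noteq> par' k)"

text \<open>The sign is that of \<open>x\<close> passing the first factor. The parity of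
  \<open>x\<close> is read off from its matrix entry, as \<open>par' k \<noteq> par' l\<close>, so
  the formula is linear in \<open>x\<close> and covers inhomogeneous elements.\<close>

definition tensor :: "('b \<Rightarrow> bool) \<Rightarrow> ('c \<Rightarrow> bool) \<Rightarrow> (complex mat \<Rightarrow> 'b \<Rightarrow> 'b \<Rightarrow> complex) \<Rightarrow>
    (complex mat \<Rightarrow> 'c \<Rightarrow> 'c \<Rightarrow> complex) \<Rightarrow> complex mat \<Rightarrow> 'b \<times> 'c \<Rightarrow> 'b \<times> 'c \<Rightarrow> complex" where
  "tensor par par' T S x = (\<lambda>(i, k) (j, l). (if k = l then T x i j else 0) +
     (if i = j then sg (par i \<and> par' k \<noteq> par' l) * S x k l else 0))"

lemma kernel_rep_par:
  assumes "kernel_rep m n par T" "a \<in> {0,1}" "x \<in> gl_part m n a"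
  shows "T x i j = 0 \<or> (a = 0 \<longleftrightarrow> par i = par j)"
  using assms(1)[unfolded kernel_rep_def, THEN conjunct2, THEN conjunct2, THEN conjunct1,
    rule_format, OF assms(2,3), of i j] by blast

lemma kernel_rep_bracket:
  assumes "kernel_rep m n par T" "a \<in> {0,1}" "b \<in> {0,1}" "x \<in> gl_part m n a" "y \<in> gl_part m n b"
  shows "T (superbracket a b x y) i j =
          (\<Sum>k\<in>UNIV. T x i k * T y k j) - (-1) ^ (a * b) * (\<Sum>k\<in>UNIV. T y i k * T x k j)"
  by (rule assms(1)[unfolded kernel_rep_def, THEN conjunct2, THEN conjunct2, THEN conjunct2,
    rule_format, OF assms(2-5)])

lemma sum_UNIV_prod: "(\<Sum>r\<in>UNIV. F r) = (\<Sum>i\<in>UNIV. \<Sum>k\<in>UNIV. F (i, k))"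
  for F :: "'b::finite \<times> 'c::finite \<Rightarrow> complex"
  using sum.cartesian_product[of "\<lambda>i k. F (i, k)" UNIV UNIV] by simp

lemma tensor_mult:
  fixes T :: "complex mat \<Rightarrow> 'b::finite \<Rightarrow> 'b \<Rightarrow> complex" and S :: "complex mat \<Rightarrow> 'c::finite \<Rightarrow> 'c \<Rightarrow> complex"
  shows "(\<Sum>r\<in>UNIV. tensor par par' T S x (i,k) r * tensor par par' T S y r (j,l)) =
    (if k = l then (\<Sum>r\<in>UNIV. T x i r * T y r j) else 0) +
    sg (par j \<and> par' k \<noteq> par' l) * T x i j * S y k l +
    sg (par i \<and> par' k \<noteq> par' l) * S x k l * T y i j +
    (if i = j then sg (par i \<and> par' k \<noteq> par' l) * (\<Sum>r\<in>UNIV. S x k r * S y r l) else 0)"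
proof -
  define A where "A = (\<lambda>r s. if k = s \<and> s = l then T x i r * T y r j else 0)"
  define B where "B = (\<lambda>r s. if k = s \<and> r = j then sg (par j \<and> par' k \<noteq> par' l) * T x i j * S y k l else 0)"
  define C where "C = (\<lambda>r s. if i = r \<and> s = l then sg (par i \<and> par' k \<noteq> par' l) * S x k l * T y i j else 0)"
  define D where "D = (\<lambda>r s. if i = r \<and> r = j then sg (par i \<and> par' k \<noteq> par' l) * (S x k s * S y s l) else 0)"
  have "tensor par par' T S x (i,k) (r,s) * tensor par par' T S y (r,s) (j,l) = A r s + B r s + C r s + D r s" for r s
    unfolding tensor_def A_def B_def C_def D_def by (auto simp: sg_def algebra_simps)
  then have "(\<Sum>r\<in>UNIV. tensor par par' T S x (i,k) r * tensor par par' T S y r (j,l)) =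
     (\<Sum>r\<in>UNIV. \<Sum>s\<in>UNIV. A r s + B r s + C r s + D r s)"
    unfolding sum_UNIV_prod by simp
  also have "\<dots> = (\<Sum>r\<in>UNIV. \<Sum>s\<in>UNIV. A r s) + (\<Sum>r\<in>UNIV. \<Sum>s\<in>UNIV. B r s) +
      (\<Sum>r\<in>UNIV. \<Sum>s\<in>UNIV. C r s) + (\<Sum>r\<in>UNIV. \<Sum>s\<in>UNIV. D r s)"
    by (simp add: sum.distrib)
  also have "(\<Sum>r\<in>UNIV. \<Sum>s\<in>UNIV. A r s) = (if k = l then (\<Sum>r\<in>UNIV. T x i r * T y r j) else 0)"
  proof -
    have "A r s = (if s = k then (if k = l then T x i r * T y r j else 0) else 0)" for r s by (auto simp: A_def)
    then show ?thesis by simp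
  qed
  also have "(\<Sum>r\<in>UNIV. \<Sum>s\<in>UNIV. B r s) = sg (par j \<and> par' k \<noteq> par' l) * T x i j * S y k l"
  proof -
    have "B r s = (if s = k then (if r = j then sg (par j \<and> par' k \<noteq> par' l) * T x i j * S y k l else 0) else 0)"
      for r s by (auto simp: B_def)
    then show ?thesis by simp
  qed
  also have "(\<Sum>r\<in>UNIV. \<Sum>s\<in>UNIV. C r s) = sg (par i \<and> par' k \<noteq> par' l) * S x k l * T y i j"
  proof -
    have "C r s = (if s = l then (if r = i then sg (par i \<and> par' k \<noteq> par' l) * S x k l * T y i j else 0) else 0)"
      for r s by (auto simp: C_def)
    then show ?thesis by simp
  qed
  also have "(\<Sum>r\<in>UNIV. \<Sum>s\<in>UNIV. D r s) =
      (if i = j then sg (par i \<and> par' k \<noteq> par' l) * (\<Sum>r\<in>UNIV. S x k r * S y r l) else 0)"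
  proof -
    have "(\<Sum>s\<in>UNIV. D r s) = (if r = i then
        (if i = j then sg (par i \<and> par' k \<noteq> par' l) * (\<Sum>r\<in>UNIV. S x k r * S y r l) else 0) else 0)" for r
      by (auto simp: D_def sum_distrib_left)
    then show ?thesis by simp
  qed
  finally show ?thesis .
qed

text \<open>In the superbracket the two mixed terms cancel, since moving one operator past the other
  costs exactly \<open>(-1) ^ (a * b)\<close>; the two pure terms are the brackets in the
  factors.\<close>

lemma kernel_rep_tensor:
  fixes T :: "complex mat \<Rightarrow> 'b::finite \<Rightarrow> 'b \<Rightarrow> complex" and S :: "complex mat \<Rightarrow> 'c::finite \<Rightarrow> 'c \<Rightarrow> complex"
  assumes T: "kernel_rep m n par T" and S: "kernel_rep m n par' S"
  shows "kernel_rep m n (tensor_par par par') (tensor par par' T S)"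
proof -
  note par = kernel_rep_par[OF T] kernel_rep_par[OF S]
  note br = kernel_rep_bracket[OF T] kernel_rep_bracket[OF S]
  show ?thesis unfolding kernel_rep_def
  proof (intro conjI ballI allI impI)
    fix x y :: "complex mat" and r s :: "'b \<times> 'c" assume "x \<in> gl m n" "y \<in> gl m n"
    then show "tensor par par' T S (x + y) r s = tensor par par' T S x r s + tensor par par' T S y r s"
      using T S by (cases r; cases s) (auto simp: tensor_def kernel_rep_def algebra_simps)
  next
    fix c and x :: "complex mat" and r s :: "'b \<times> 'c" assume "x \<in> gl m n"
    then show "tensor par par' T S (c \<cdot>\<^sub>m x) r s = c * tensor par par' T S x r s"
      using T S by (cases r; cases s) (auto simp: tensor_def kernel_rep_def algebra_simps)
  next
    fix a :: nat and x and r s :: "'b \<times> 'c"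
    assume a: "a \<in> {0,1}" "x \<in> gl_part m n a" and nz: "tensor par par' T S x r s \<noteq> 0"
    obtain i k j l where rs: "r = (i,k)" "s = (j,l)" by force
    show "(a = 0) = (tensor_par par par' r = tensor_par par par' s)"
      using nz par(1)[OF a, of i j] par(2)[OF a, of k l] unfolding rs tensor_def tensor_par_def
      by (cases "k = l"; cases "i = j") auto
  next
    fix a b :: nat and x y and r s :: "'b \<times> 'c"
    assume ab: "a \<in> {0,1}" "b \<in> {0,1}" and xy: "x \<in> gl_part m n a" "y \<in> gl_part m n b"
    obtain i k j l where rs: "r = (i,k)" "s = (j,l)" by force
    \<comment> \<open>If both entries are nonzero, \<open>par\<close> changes from \<open>i\<close>
      to \<open>j\<close> exactly when \<open>a = 1\<close>, and \<open>par'\<close> from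
      \<open>k\<close> to \<open>l\<close> exactly when \<open>b = 1\<close>; so the two signs
      differ by \<open>(-1) ^ (a * b)\<close>.\<close>
    have e1: "sg (par j \<and> par' k \<noteq> par' l) * T x i j * S y k l =
        (-1) ^ (a * b) * (sg (par i \<and> par' k \<noteq> par' l) * S y k l * T x i j)"
      using par(1)[OF ab(1) xy(1), of i j] par(2)[OF ab(2) xy(2), of k l] ab
      by (cases "T x i j = 0"; cases "S y k l = 0") (auto simp: sg_def)
    have e2: "sg (par i \<and> par' k \<noteq> par' l) * S x k l * T y i j =
        (-1) ^ (a * b) * (sg (par j \<and> par' k \<noteq> par' l) * T y i j * S x k l)"
      using par(1)[OF ab(2) xy(2), of i j] par(2)[OF ab(1) xy(1), of k l] ab
      by (cases "T y i j = 0"; cases "S x k l = 0") (auto simp: sg_def)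
    have collect: "X1 + A + C + Y1 - c * (X2 + A' + C' + Y2) = (X1 - c * X2) + (Y1 - c * Y2)"
      if "A = c * C'" "C = c * A'" for X1 X2 Y1 Y2 A A' C C' c :: complex
      using that by (simp add: algebra_simps)
    have "tensor par par' T S (superbracket a b x y) r s =
      (if k = l then T (superbracket a b x y) i j else 0) +
      (if i = j then sg (par i \<and> par' k \<noteq> par' l) * S (superbracket a b x y) k l else 0)"
      by (simp add: rs tensor_def)
    then show "tensor par par' T S (superbracket a b x y) r s =
          (\<Sum>k\<in>UNIV. tensor par par' T S x r k * tensor par par' T S y k s) -
          (-1) ^ (a * b) * (\<Sum>k\<in>UNIV. tensor par par' T S y r k * tensor par par' T S x k s)"
      unfolding rs tensor_mult br[OF ab xy] collect[OF e1 e2] by (auto simp: algebra_simps)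
  qed
qed

lemma app_tensor:
  fixes T :: "complex mat \<Rightarrow> 'b::finite \<Rightarrow> 'b \<Rightarrow> complex" and S :: "complex mat \<Rightarrow> 'c::finite \<Rightarrow> 'c \<Rightarrow> complex"
  assumes g: "\<And>k. g k \<noteq> 0 \<Longrightarrow> par' k = e"
  shows "app (tensor par par' T S) x (\<lambda>(i,k). f i * g k) (i,k) =
    app T x f i * g k + sg (par i \<and> par' k \<noteq> e) * f i * app S x g k"
proof -
  have "app (tensor par par' T S) x (\<lambda>(i,k). f i * g k) (i,k) =
    (\<Sum>j\<in>UNIV. \<Sum>l\<in>UNIV. tensor par par' T S x (i,k) (j,l) * (f j * g l))"
    unfolding app_def sum_UNIV_prod by simp
  also have "\<dots> = (\<Sum>j\<in>UNIV. \<Sum>l\<in>UNIV. (if l = k then T x i j * f j * g k else 0) +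
      (if j = i then sg (par i \<and> par' k \<noteq> e) * f i * (S x k l * g l) else 0))"
  proof (intro sum.cong refl)
    fix j l
    show "tensor par par' T S x (i,k) (j,l) * (f j * g l) = (if l = k then T x i j * f j * g k else 0) +
      (if j = i then sg (par i \<and> par' k \<noteq> e) * f i * (S x k l * g l) else 0)"
      using g[of l] by (cases "g l = 0") (auto simp: tensor_def algebra_simps)
  qed
  also have "\<dots> = (\<Sum>j\<in>UNIV. T x i j * f j * g k) +
      (\<Sum>j\<in>UNIV. if j = i then sg (par i \<and> par' k \<noteq> e) * f i * app S x g k else 0)"
    unfolding sum.distrib
  proof (rule arg_cong2[of _ _ _ _ "(+)"])
    show "(\<Sum>j\<in>UNIV. \<Sum>l\<in>UNIV. if j = i then sg (par i \<and> par' k \<noteq> e) * f i * (S x k l * g l) else 0) =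
      (\<Sum>j\<in>UNIV. if j = i then sg (par i \<and> par' k \<noteq> e) * f i * app S x g k else 0)"
      by (intro sum.cong) (auto simp: app_def sum_distrib_left)
  qed simp
  also have "\<dots> = app T x f i * g k + sg (par i \<and> par' k \<noteq> e) * f i * app S x g k"
    by (simp add: app_def sum_distrib_right)
  finally show ?thesis .
qed

text \<open>Elements act by a Leibniz rule with signs, and these signs are trivial where
  \<open>g\<close> is nonzero; so weights add and raising operators still kill the product.\<close>

lemma kernel_hwv_tensor:
  fixes T :: "complex mat \<Rightarrow> 'b::finite \<Rightarrow> 'b \<Rightarrow> complex" and S :: "complex mat \<Rightarrow> 'c::finite \<Rightarrow> 'c \<Rightarrow> complex"
  assumes f: "kernel_hwv m n par T \<mu> f" and g: "kernel_hwv m n par' S \<nu> g"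
  shows "kernel_hwv m n (tensor_par par par') (tensor par par' T S) (\<mu> + \<nu>) (\<lambda>(i,k). f i * g k)"
proof -
  obtain e where e: "\<And>i. f i \<noteq> 0 \<Longrightarrow> par i = e" using f by (auto simp: kernel_hwv_def)
  obtain e' where e': "\<And>k. g k \<noteq> 0 \<Longrightarrow> par' k = e'" using g by (auto simp: kernel_hwv_def)
  have "app (tensor par par' T S) x (\<lambda>(i,k). f i * g k) (i,k) =
    app T x f i * g k + sg (par i \<and> par' k \<noteq> e') * f i * app S x g k" for x i k
    by (rule app_tensor[OF e'])
  then have app: "app (tensor par par' T S) x (\<lambda>(i,k). f i * g k) = (\<lambda>(i,k).
    app T x f i * g k + sg (par i \<and> par' k \<noteq> e') * f i * app S x g k)" for x
    by auto
  show ?thesis unfolding kernel_hwv_def app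
  proof (intro conjI allI impI)
    show "\<exists>r. (case r of (i,k) \<Rightarrow> f i * g k) \<noteq> 0" using f g by (auto simp: kernel_hwv_def)
    show "\<exists>d. \<forall>r. (case r of (i,k) \<Rightarrow> f i * g k) \<noteq> 0 \<longrightarrow> tensor_par par par' r = d"
      using e e' by (intro exI[of _ "e \<noteq> e'"]) (auto simp: tensor_par_def)
    fix k assume k: "k < m + n"
    show "(\<lambda>(i,l). app T (munit (m+n) k k) f i * g l + sg (par i \<and> par' l \<noteq> e') * f i * app S (munit (m+n) k k) g l) =
      (\<lambda>r. (\<mu> + \<nu>) (crd m k) * (case r of (i,k) \<Rightarrow> f i * g k))"
    proof -
      have "app T (munit (m+n) k k) f i * g l + sg (par i \<and> par' l \<noteq> e') * f i * app S (munit (m+n) k k) g l =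
        (\<mu> + \<nu>) (crd m k) * (f i * g l)" for i l
        using f g k e'[of l] unfolding kernel_hwv_def by (cases "g l = 0") (simp_all add: sg_def algebra_simps)
      then show ?thesis by auto
    qed
  next
    fix a b assume "a < m + n" "b < m + n" "a < b"
    then show "(\<lambda>(i,l). app T (munit (m+n) a b) f i * g l + sg (par i \<and> par' l \<noteq> e') * f i * app S (munit (m+n) a b) g l) = (\<lambda>i. 0)"
      using f g by (auto simp: kernel_hwv_def)
  qed
qed

section \<open>The natural representation, its dual and the supertrace\<close>

definition std_par :: "nat \<Rightarrow> ('i \<Rightarrow> nat) \<Rightarrow> 'i \<Rightarrow> bool" where
  "std_par m \<iota> i \<longleftrightarrow> m \<le> \<iota> i"

text \<open>A type cannot depend on \<open>m\<close> and \<open>n\<close>; hence the basis is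
  indexed by an arbitrary finite type, and \<open>\<iota>\<close> numbers it by the matrix
  indices.\<close>

definition std :: "('i \<Rightarrow> nat) \<Rightarrow> complex mat \<Rightarrow> 'i \<Rightarrow> 'i \<Rightarrow> complex" where
  "std \<iota> x i j = x $$ (\<iota> i, \<iota> j)"

text \<open>The dual of the natural representation is minus the supertranspose.\<close>

definition dual :: "nat \<Rightarrow> ('i \<Rightarrow> nat) \<Rightarrow> complex mat \<Rightarrow> 'i \<Rightarrow> 'i \<Rightarrow> complex" where
  "dual m \<iota> x i j = - sg (std_par m \<iota> j \<and> \<not> std_par m \<iota> i) * x $$ (\<iota> j, \<iota> i)"

definition strace :: "nat \<Rightarrow> nat \<Rightarrow> complex \<Rightarrow> complex mat \<Rightarrow> unit \<Rightarrow> unit \<Rightarrow> complex" where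
  "strace m n c x i j = c * (\<Sum>k<m+n. sg (m \<le> k) * x $$ (k,k))"

lemma superbracket_index:
  assumes "x \<in> gl m n" "y \<in> gl m n" "i < m + n" "j < m + n"
  shows "superbracket a b x y $$ (i,j) =
    (\<Sum>k<m+n. x $$ (i,k) * y $$ (k,j)) - (-1) ^ (a * b) * (\<Sum>k<m+n. y $$ (i,k) * x $$ (k,j))"
  using assms by (simp add: superbracket_def scalar_prod_def atLeast0LessThan)

lemma gl_part_index:
  assumes "x \<in> gl_part m n a" "i < m + n" "j < m + n"
  shows "x $$ (i,j) = 0 \<or> (a = 0 \<longleftrightarrow> (m \<le> i) = (m \<le> j))"
proof (rule disjCI)
  assume "\<not> (a = 0 \<longleftrightarrow> (m \<le> i) = (m \<le> j))"
  then have "a \<noteq> (if (i < m) = (j < m) then 0 else 1)" by (auto simp: not_less split: if_splits)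
  then show "x $$ (i,j) = 0" using assms unfolding gl_part_def by blast
qed

lemma kernel_rep_std:
  fixes \<iota> :: "'i::finite \<Rightarrow> nat"
  assumes \<iota>: "bij_betw \<iota> UNIV {..<m+n}"
  shows "kernel_rep m n (std_par m \<iota>) (std \<iota>)"
proof -
  have lt: "\<iota> i < m + n" for i using \<iota> by (auto simp: bij_betw_def)
  have re: "(\<Sum>k<m+n. h k) = (\<Sum>k\<in>UNIV. h (\<iota> k))" for h :: "nat \<Rightarrow> complex"
    by (rule sum.reindex_bij_betw[symmetric, OF \<iota>])
  have g: "x \<in> gl m n" if "x \<in> gl_part m n a" for x a using that by (simp add: gl_part_def)
  show ?thesis unfolding kernel_rep_def
  proof (intro conjI ballI allI impI)
    fix a :: nat and x i j assume "a \<in> {0,1}" "x \<in> gl_part m n a" "std \<iota> x i j \<noteq> 0"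
    then show "(a = 0) = (std_par m \<iota> i = std_par m \<iota> j)"
      using gl_part_index[OF _ lt lt, of x a i j] by (auto simp: std_def std_par_def)
  next
    fix a b :: nat and x y i j
    assume "x \<in> gl_part m n a" "y \<in> gl_part m n b"
    then show "std \<iota> (superbracket a b x y) i j = (\<Sum>k\<in>UNIV. std \<iota> x i k * std \<iota> y k j) -
        (-1) ^ (a * b) * (\<Sum>k\<in>UNIV. std \<iota> y i k * std \<iota> x k j)"
      unfolding std_def using superbracket_index[OF g g lt lt, where a=a and b=b and x=x and y=y] by (simp add: re)
  qed (use lt in \<open>auto simp: std_def\<close>)
qed

text \<open>The supertranspose reverses products up to sign: \<open>t1\<close> turns the first sum
  of the bracket into the second sum of the claim, and \<open>t2\<close> turns the second sum into
  the first.\<close>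

lemma kernel_rep_dual:
  fixes \<iota> :: "'i::finite \<Rightarrow> nat"
  assumes \<iota>: "bij_betw \<iota> UNIV {..<m+n}"
  shows "kernel_rep m n (std_par m \<iota>) (dual m \<iota>)"
proof -
  have lt: "\<iota> i < m + n" for i using \<iota> by (auto simp: bij_betw_def)
  have re: "(\<Sum>k<m+n. h k) = (\<Sum>k\<in>UNIV. h (\<iota> k))" for h :: "nat \<Rightarrow> complex"
    by (rule sum.reindex_bij_betw[symmetric, OF \<iota>])
  have g: "x \<in> gl m n" if "x \<in> gl_part m n a" for x a using that by (simp add: gl_part_def)
  show ?thesis unfolding kernel_rep_def
  proof (intro conjI ballI allI impI)
    fix a :: nat and x i j assume "a \<in> {0,1}" "x \<in> gl_part m n a" "dual m \<iota> x i j \<noteq> 0"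
    then show "(a = 0) = (std_par m \<iota> i = std_par m \<iota> j)"
      using gl_part_index[OF _ lt lt, of x a j i] by (auto simp: dual_def std_par_def)
  next
    fix a b :: nat and x y i j
    assume ab: "a \<in> {0,1}" "b \<in> {0,1}" and xy: "x \<in> gl_part m n a" "y \<in> gl_part m n b"
    let ?p = "std_par m \<iota>"
    have t1: "- sg (?p j \<and> \<not> ?p i) * (x $$ (\<iota> j, \<iota> k) * y $$ (\<iota> k, \<iota> i)) =
        - ((-1) ^ (a * b) * (dual m \<iota> y i k * dual m \<iota> x k j))" for k
      using gl_part_index[OF xy(1) lt lt, of j k] gl_part_index[OF xy(2) lt lt, of k i] ab
      by (cases "x $$ (\<iota> j, \<iota> k) = 0"; cases "y $$ (\<iota> k, \<iota> i) = 0")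
         (auto simp: dual_def sg_def std_par_def)
    have t2: "- sg (?p j \<and> \<not> ?p i) * (- ((-1) ^ (a * b) * (y $$ (\<iota> j, \<iota> k) * x $$ (\<iota> k, \<iota> i)))) =
        dual m \<iota> x i k * dual m \<iota> y k j" for k
      using gl_part_index[OF xy(2) lt lt, of j k] gl_part_index[OF xy(1) lt lt, of k i] ab
      by (cases "y $$ (\<iota> j, \<iota> k) = 0"; cases "x $$ (\<iota> k, \<iota> i) = 0")
         (auto simp: dual_def sg_def std_par_def)
    have "dual m \<iota> (superbracket a b x y) i j =
      (\<Sum>k\<in>UNIV. - sg (?p j \<and> \<not> ?p i) * (x $$ (\<iota> j, \<iota> k) * y $$ (\<iota> k, \<iota> i))) +
      (\<Sum>k\<in>UNIV. - sg (?p j \<and> \<not> ?p i) * (- ((-1) ^ (a * b) * (y $$ (\<iota> j, \<iota> k) * x $$ (\<iota> k, \<iota> i)))))"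
      unfolding dual_def superbracket_index[OF g[OF xy(1)] g[OF xy(2)] lt lt] re
      by (simp add: sum_distrib_left sum_negf algebra_simps)
    then show "dual m \<iota> (superbracket a b x y) i j = (\<Sum>k\<in>UNIV. dual m \<iota> x i k * dual m \<iota> y k j) -
        (-1) ^ (a * b) * (\<Sum>k\<in>UNIV. dual m \<iota> y i k * dual m \<iota> x k j)"
      unfolding t1 t2 by (simp add: sum_negf sum_distrib_left)
  qed (use lt in \<open>auto simp: dual_def algebra_simps\<close>)
qed

text \<open>The supertrace vanishes on superbrackets: after exchanging the summation indices, the
  sign \<open>(-1) ^ (a * b)\<close> accounts for the change of parity from one index to the other.
  The right-hand side vanishes as well, because odd elements act by zero and scalars
  commute.\<close>

lemma kernel_rep_strace: "kernel_rep m n (\<lambda>_. False) (strace m n c)"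
proof -
  have g: "x \<in> gl m n" if "x \<in> gl_part m n a" for x a using that by (simp add: gl_part_def)
  show ?thesis unfolding kernel_rep_def
  proof (intro conjI ballI allI impI)
    fix a :: nat and x i j assume a: "a \<in> {0,1}" "x \<in> gl_part m n a" and nz: "strace m n c x i j \<noteq> 0"
    show "(a = 0) = (False = False)"
    proof (rule ccontr)
      assume "\<not> ?thesis"
      then have "x $$ (k,k) = 0" if "k < m + n" for k using gl_part_index[OF a(2) that that] by auto
      then show False using nz by (simp add: strace_def)
    qed
  next
    fix a b :: nat and x y i j
    assume ab: "a \<in> {0,1}" "b \<in> {0,1}" and xy: "x \<in> gl_part m n a" "y \<in> gl_part m n b"
    have zero: "strace m n c z u v = 0" if "z \<in> gl_part m n 1" for z u v
    proof -
      have "z $$ (k,k) = 0" if "k < m + n" for k using gl_part_index[OF \<open>z \<in> _\<close> that that] by auto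
      then show ?thesis by (simp add: strace_def)
    qed
    have "(\<Sum>k<m+n. \<Sum>l<m+n. sg (m \<le> k) * ((-1) ^ (a * b) * (y $$ (k,l) * x $$ (l,k)))) =
       (\<Sum>l<m+n. \<Sum>k<m+n. sg (m \<le> k) * ((-1) ^ (a * b) * (y $$ (k,l) * x $$ (l,k))))"
      by (rule sum.swap)
    also have "\<dots> = (\<Sum>k<m+n. \<Sum>l<m+n. sg (m \<le> k) * (x $$ (k,l) * y $$ (l,k)))"
    proof (intro sum.cong refl)
      fix k l assume "k \<in> {..<m+n}" "l \<in> {..<m+n}"
      then show "sg (m \<le> l) * ((-1) ^ (a * b) * (y $$ (l,k) * x $$ (k,l))) = sg (m \<le> k) * (x $$ (k,l) * y $$ (l,k))"
        using gl_part_index[OF xy(1), of k l] gl_part_index[OF xy(2), of l k] ab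
        by (cases "x $$ (k,l) = 0"; cases "y $$ (l,k) = 0") (auto simp: sg_def)
    qed
    finally have swap: "(\<Sum>k<m+n. \<Sum>l<m+n. sg (m \<le> k) * ((-1) ^ (a * b) * (y $$ (k,l) * x $$ (l,k)))) = \<dots>" .
    have "(\<Sum>k<m+n. sg (m \<le> k) * superbracket a b x y $$ (k,k)) =
      (\<Sum>k<m+n. (\<Sum>l<m+n. sg (m \<le> k) * (x $$ (k,l) * y $$ (l,k))) -
        (\<Sum>l<m+n. sg (m \<le> k) * ((-1) ^ (a * b) * (y $$ (k,l) * x $$ (l,k)))))"
      by (intro sum.cong) (simp_all add: superbracket_index[OF g[OF xy(1)] g[OF xy(2)]]
        right_diff_distrib sum_distrib_left)
    also have "\<dots> = 0" unfolding sum_subtractf swap by simp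
    finally have "strace m n c (superbracket a b x y) i j = 0" by (simp add: strace_def)
    moreover have "strace m n c x u v * strace m n c y u v = (-1) ^ (a * b) * (strace m n c y u v * strace m n c x u v)" for u v
      using ab zero[of x u v] zero[of y u v] xy by auto
    ultimately show "strace m n c (superbracket a b x y) i j = (\<Sum>k\<in>UNIV. strace m n c x i k * strace m n c y k j) -
        (-1) ^ (a * b) * (\<Sum>k\<in>UNIV. strace m n c y i k * strace m n c x k j)"
      by (simp add: UNIV_unit)
  qed (auto simp: strace_def algebra_simps sum.distrib sum_distrib_left)
qed


section \<open>Antisymmetric highest weight vectors in tensor cubes\<close>

lemma deriv3: "(p * a) * (b * c) + a * ((q * b) * c + b * (r * c)) = (p + q + r) * (a * (b * c))"
  for a b c p q r :: complex
  by (simp add: algebra_simps)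

text \<open>A strictly triangular operator kills the alternating product. The letters
  \<open>a\<close>, \<open>b\<close>, \<open>c\<close> are the values of the three vectors at the
  three tensor positions; the bracketing and the zero terms match literally the goal that arises in
  \<open>kernel_hwv_cube\<close>.\<close>

lemma alt3:
  fixes a0 a1 a2 b0 b1 b2 c0 c1 c2 \<alpha> \<beta> \<gamma> :: complex
  shows "(0 * (b1 * c2) + a0 * ((\<alpha> * b0) * c2 + b1 * (\<beta> * c0 + \<gamma> * c1))) -
     (0 * (b2 * c1) + a0 * ((\<beta> * b0 + \<gamma> * b1) * c1 + b2 * (\<alpha> * c0))) +
     ((\<alpha> * a0 * (b2 * c0) + a1 * ((\<beta> * b0 + \<gamma> * b1) * c0 + b2 * 0)) -
      (\<alpha> * a0 * (b0 * c2) + a1 * (0 * c2 + b0 * (\<beta> * c0 + \<gamma> * c1)))) +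
     (((\<beta> * a0 + \<gamma> * a1) * (b0 * c1) + a2 * (0 * c1 + b0 * (\<alpha> * c0))) -
      ((\<beta> * a0 + \<gamma> * a1) * (b1 * c0) + a2 * (\<alpha> * b0 * c0 + b1 * 0))) = 0"
  by (simp add: algebra_simps)

text \<open>
  Three vectors \<open>u 0, u 1, u 2\<close> of equal parity, each of which is mapped by raising operators into
  the span of its predecessors: their antisymmetrisation is a highest weight vector of the tensor cube.
\<close>

lemma kernel_hwv_cube:
  fixes T :: "complex mat \<Rightarrow> 'b::finite \<Rightarrow> 'b \<Rightarrow> complex" and \<kappa> :: "nat \<Rightarrow> weight"
  assumes dist: "x\<^sub>0 \<noteq> x\<^sub>1" "x\<^sub>0 \<noteq> x\<^sub>2" "x\<^sub>1 \<noteq> x\<^sub>2"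
  defines "u \<equiv> \<lambda>s i. if i = [x\<^sub>0, x\<^sub>1, x\<^sub>2] ! s then 1 else 0 :: complex"
  assumes par: "par x\<^sub>0 = e" "par x\<^sub>1 = e" "par x\<^sub>2 = e"
    and wt: "\<And>k s. k < m + n \<Longrightarrow> s < 3 \<Longrightarrow> app T (munit (m + n) k k) (u s) = (\<lambda>i. \<kappa> s (crd m k) * u s i)"
    and raise: "\<And>a b. a < m + n \<Longrightarrow> b < m + n \<Longrightarrow> a < b \<Longrightarrow> \<exists>\<alpha> \<beta> \<gamma>.
      app T (munit (m + n) a b) (u 0) = (\<lambda>i. 0) \<and>
      app T (munit (m + n) a b) (u 1) = (\<lambda>i. \<alpha> * u 0 i) \<and>
      app T (munit (m + n) a b) (u 2) = (\<lambda>i. \<beta> * u 0 i + \<gamma> * u 1 i)"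
  shows "\<exists>f. kernel_hwv m n (tensor_par par (tensor_par par par))
    (tensor par (tensor_par par par) T (tensor par par T T)) (\<kappa> 0 + \<kappa> 1 + \<kappa> 2) f"
proof -
  let ?p2 = "tensor_par par par"
  let ?T3 = "tensor par ?p2 T (tensor par par T T)"
  define w where "w = (\<lambda>a b c. \<lambda>(i, j, k). u a i * (u b j * u c k))"
  \<comment> \<open>Ordinary permutation signs, even if the three vectors are odd: they all have one
    parity and so do their images under the operators applied, so no further signs enter.\<close>
  define f where "f = (\<lambda>r. w 0 1 2 r - w 0 2 1 r + (w 1 2 0 r - w 1 0 2 r) + (w 2 0 1 r - w 2 1 0 r))"
  have u_par: "par i = e" if "u s i \<noteq> 0" "s < 3" for s i
    using that par by (auto simp: u_def less_Suc_eq numeral_3_eq_3 numeral_2_eq_2 split: if_splits)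
  \<comment> \<open>For operators whose images of the \<open>u s\<close> keep the parity
    \<open>e\<close>, every sign of the tensor action is trivial and the plain Leibniz rule
    remains.\<close>
  have app_w: "app ?T3 x (w a b c) = (\<lambda>(i, j, k). app T x (u a) i * (u b j * u c k) +
        u a i * (app T x (u b) j * u c k + u b j * app T x (u c) k))"
    if abc: "a < 3" "b < 3" "c < 3" and x0: "\<forall>s<3. \<forall>i. app T x (u s) i \<noteq> 0 \<longrightarrow> par i = e" for x a b c
  proof -
    have x: "par i = e" if "s < 3" "app T x (u s) i \<noteq> 0" for s i using x0 that by blast
    have 2: "app (tensor par par T T) x (\<lambda>(j,k). u b j * u c k) (j,k) =
        app T x (u b) j * u c k + u b j * app T x (u c) k" for j k
    proof -
      have "sg (par j \<and> par k \<noteq> e) * u b j * app T x (u c) k = u b j * app T x (u c) k"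
        using x[OF abc(3), of k] by (cases "app T x (u c) k = 0") (auto simp: sg_def)
      then show ?thesis using app_tensor[of "u c" par e, where par=par and T=T and S=T and f="u b" and x=x and i=j and k=k] u_par abc by simp
    qed
    have "app ?T3 x (w a b c) (i,j,k) = app T x (u a) i * (u b j * u c k) +
        u a i * (app T x (u b) j * u c k + u b j * app T x (u c) k)" for i j k
    proof -
      have g: "?p2 r = False" if "(\<lambda>(j,k). u b j * u c k) r \<noteq> 0" for r
        using that u_par abc by (auto simp: tensor_par_def)
      have "sg (par i \<and> ?p2 (j,k) \<noteq> False) * u a i * app (tensor par par T T) x (\<lambda>(j,k). u b j * u c k) (j,k) =
          u a i * (app T x (u b) j * u c k + u b j * app T x (u c) k)"
        unfolding 2 using u_par[of b j] u_par[of c k] x[of b j] x[of c k] abc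
        by (cases "u b j = 0"; cases "u c k = 0"; cases "app T x (u b) j = 0"; cases "app T x (u c) k = 0")
           (simp_all add: sg_def tensor_par_def)
      moreover have "w a b c = (\<lambda>(i,r). u a i * (\<lambda>(j,k). u b j * u c k) r)" by (auto simp: w_def)
      ultimately show ?thesis using app_tensor[OF g, where par=par and T=T and S="tensor par par T T" and f="u a" and x=x and i=i and k="(j,k)"] by simp
    qed
    then show ?thesis by auto
  qed
  have app_f: "app ?T3 x f = (\<lambda>r. app ?T3 x (w 0 1 2) r - app ?T3 x (w 0 2 1) r +
      (app ?T3 x (w 1 2 0) r - app ?T3 x (w 1 0 2) r) + (app ?T3 x (w 2 0 1) r - app ?T3 x (w 2 1 0) r))" for x
    unfolding f_def by (simp only: app_add app_diff)
  have "kernel_hwv m n (tensor_par par ?p2) ?T3 (\<kappa> 0 + \<kappa> 1 + \<kappa> 2) f"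
    unfolding kernel_hwv_def
  proof (intro conjI allI impI)
    have "f (x\<^sub>0, x\<^sub>1, x\<^sub>2) = 1" using dist by (simp add: f_def w_def u_def numeral_2_eq_2)
    then show "\<exists>r. f r \<noteq> 0" by (metis zero_neq_one)
    have w_par: "tensor_par par ?p2 r = e" if "w a b c r \<noteq> 0" "a < 3" "b < 3" "c < 3" for a b c r
      using that u_par by (auto simp: w_def tensor_par_def)
    have "tensor_par par ?p2 r = e" if "f r \<noteq> 0" for r
    proof -
      have "w 0 1 2 r \<noteq> 0 \<or> w 0 2 1 r \<noteq> 0 \<or> w 1 2 0 r \<noteq> 0 \<or> w 1 0 2 r \<noteq> 0 \<or> w 2 0 1 r \<noteq> 0 \<or> w 2 1 0 r \<noteq> 0"
        using that by (auto simp: f_def)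
      then show ?thesis using w_par by (elim disjE) simp_all
    qed
    then show "\<exists>e. \<forall>r. f r \<noteq> 0 \<longrightarrow> tensor_par par ?p2 r = e" by blast
  next
    fix k assume k: "k < m + n"
    have "\<forall>s<3. \<forall>i. app T (munit (m + n) k k) (u s) i \<noteq> 0 \<longrightarrow> par i = e"
    proof (intro allI impI)
      fix s i assume si: "s < (3::nat)" "app T (munit (m + n) k k) (u s) i \<noteq> 0"
      then have "u s i \<noteq> 0" using wt[OF k, of s] by auto
      then show "par i = e" using u_par si by blast
    qed
    note hk = this
    have "app ?T3 (munit (m + n) k k) (w a b c) r =
        (\<kappa> a (crd m k) + \<kappa> b (crd m k) + \<kappa> c (crd m k)) * w a b c r" if abc: "a < 3" "b < 3" "c < 3" for a b c r
    proof -
      obtain i j l where r: "r = (i, j, l)" by (cases r)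
      show ?thesis unfolding app_w[OF abc hk] wt[OF k abc(1)] wt[OF k abc(2)] wt[OF k abc(3)] r prod.case
        unfolding w_def prod.case by (rule deriv3)
    qed
    then show "app ?T3 (munit (m + n) k k) f = (\<lambda>r. (\<kappa> 0 + \<kappa> 1 + \<kappa> 2) (crd m k) * f r)"
      unfolding app_f by (simp add: f_def algebra_simps)
  next
    fix a b assume ab: "a < m + n" "b < m + n" "a < b"
    obtain \<alpha> \<beta> \<gamma> where r:
      "app T (munit (m + n) a b) (u 0) = (\<lambda>i. 0)"
      "app T (munit (m + n) a b) (u 1) = (\<lambda>i. \<alpha> * u 0 i)"
      "app T (munit (m + n) a b) (u 2) = (\<lambda>i. \<beta> * u 0 i + \<gamma> * u 1 i)"
      using raise[OF ab] by blast
    have "\<forall>s<3. \<forall>i. app T (munit (m + n) a b) (u s) i \<noteq> 0 \<longrightarrow> par i = e"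
    proof (intro allI impI)
      fix s i assume that: "s < (3::nat)" "app T (munit (m + n) a b) (u s) i \<noteq> 0"
      have "s = 0 \<or> s = 1 \<or> s = 2" using that by auto
      then have "u 0 i \<noteq> 0 \<or> u 1 i \<noteq> 0" using that(2) r by auto
      then show "par i = e" using u_par[of 0 i] u_par[of 1 i] by auto
    qed
    note hk = this
    have W: "app ?T3 (munit (m + n) a b) (w a' b' c') (i, j, l) =
        app T (munit (m + n) a b) (u a') i * (u b' j * u c' l) +
        u a' i * (app T (munit (m + n) a b) (u b') j * u c' l + u b' j * app T (munit (m + n) a b) (u c') l)"
      if abc: "a' < 3" "b' < 3" "c' < 3" for a' b' c' i j l
      unfolding app_w[OF abc hk] by simp
    have lt: "0 < (3::nat)" "1 < (3::nat)" "2 < (3::nat)" by simp_all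
    show "app ?T3 (munit (m + n) a b) f = (\<lambda>r. 0)"
    proof (rule ext)
      fix r' :: "'b \<times> 'b \<times> 'b"
      obtain i j l where ijl: "r' = (i, j, l)" by (cases r')
      show "app ?T3 (munit (m + n) a b) f r' = 0"
        unfolding app_f ijl
          W[OF lt(1) lt(2) lt(3)] W[OF lt(1) lt(3) lt(2)] W[OF lt(2) lt(3) lt(1)]
          W[OF lt(2) lt(1) lt(3)] W[OF lt(3) lt(1) lt(2)] W[OF lt(3) lt(2) lt(1)] r
        by (rule alt3)
    qed
  qed
  then show ?thesis by blast
qed


section \<open>Simple subquotients in matrix form\<close>

lemma app_sum: "app T x (\<lambda>k. \<Sum>j\<in>J. c j * G j k) = (\<lambda>k. \<Sum>j\<in>J. c j * app T x (G j) k)"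
proof (induction J rule: infinite_finite_induct)
  case (insert j J)
  then show ?case using app_add[of T x "\<lambda>k. c j * G j k"] by (simp add: app_scale)
qed (simp_all add: app_zero)

lemma app_bracket:
  assumes T: "kernel_rep m n par T" and ab: "a \<in> {0,1}" "b \<in> {0,1}"
    and xy: "x \<in> gl_part m n a" "y \<in> gl_part m n b"
  shows "app T (superbracket a b x y) g =
    (\<lambda>i. app T x (app T y g) i - (-1) ^ (a * b) * app T y (app T x g) i)"
proof
  fix i
  have twice: "app T x (app T y g) i = (\<Sum>j\<in>UNIV. (\<Sum>k\<in>UNIV. T x i k * T y k j) * g j)" for x y
    unfolding app_def sum_distrib_left sum_distrib_right by (subst sum.swap) (simp add: mult.assoc)
  show "app T (superbracket a b x y) g i = app T x (app T y g) i - (-1) ^ (a * b) * app T y (app T x g) i"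
    unfolding twice unfolding app_def kernel_rep_bracket[OF T ab xy]
    by (simp add: left_diff_distrib sum_subtractf sum_distrib_left[of "(-1) ^ (a * b)" "\<lambda>j. _ j * g j"] mult.assoc)
qed

lemma sum_lessThan_plus: "(\<Sum>i<p+q. g i) = (\<Sum>i<p. g i) + (\<Sum>i<q. g (p + i))"
  for g :: "nat \<Rightarrow> 'a::comm_monoid_add"
  by (induction q) (simp_all add: add.assoc)

definition hcomp :: "('b \<Rightarrow> bool) \<Rightarrow> bool \<Rightarrow> ('b \<Rightarrow> complex) \<Rightarrow> 'b \<Rightarrow> complex" where
  "hcomp par e g = (\<lambda>i. if par i = e then g i else 0)"

text \<open>Quotient coordinates are chosen separately for the even and the odd part. The even ones
  come first, as the matrix model of the superspace requires, so \<open>p \<le> i\<close> says that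
  the coordinate \<open>i\<close> is odd.\<close>

lemma graded_quotient_coordinates:
  fixes par :: "'b::finite \<Rightarrow> bool" and N W :: "('b \<Rightarrow> complex) set"
  assumes N: "fs.subspace N" and W: "fs.subspace W" and NW: "N \<subseteq> W"
    and gr: "\<And>e g. g \<in> N \<Longrightarrow> hcomp par e g \<in> N" "\<And>e g. g \<in> W \<Longrightarrow> hcomp par e g \<in> W"
  obtains p q :: nat and D :: "nat \<Rightarrow> 'b \<Rightarrow> complex" and \<Phi> :: "nat \<Rightarrow> ('b \<Rightarrow> complex) \<Rightarrow> complex" where
    "\<And>i g h. \<Phi> i (\<lambda>k. g k + h k) = \<Phi> i g + \<Phi> i h" "\<And>i c g. \<Phi> i (\<lambda>k. c * g k) = c * \<Phi> i g"
    "\<And>i. i < p + q \<Longrightarrow> D i \<in> W" "\<And>i k. i < p + q \<Longrightarrow> D i k \<noteq> 0 \<Longrightarrow> par k = (p \<le> i)"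
    "\<And>i j. i < p + q \<Longrightarrow> j < p + q \<Longrightarrow> \<Phi> i (D j) = (if i = j then 1 else 0)"
    "\<And>i g. i < p + q \<Longrightarrow> g \<in> N \<Longrightarrow> \<Phi> i g = 0"
    "\<And>g. g \<in> W \<Longrightarrow> (\<lambda>k. g k - (\<Sum>i<p+q. \<Phi> i g * D i k)) \<in> N"
    "\<And>i e g. i < p + q \<Longrightarrow> \<Phi> i (hcomp par e g) = (if e = (p \<le> i) then \<Phi> i g else 0)"
proof -
  define hom where "hom = (\<lambda>e. {g :: 'b \<Rightarrow> complex. \<forall>i. g i \<noteq> 0 \<longrightarrow> par i = e})"
  have sub: "fs.subspace (X \<inter> hom e)" if "fs.subspace X" for X e
  proof -
    have "fs.subspace (hom e)"
      unfolding fs.subspace_def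
    proof (intro conjI ballI allI)
      fix g h assume gh: "g \<in> hom e" "h \<in> hom e"
      have "par i = e" if "(g + h) i \<noteq> 0" for i
      proof (cases "g i = 0")
        case True
        then have "h i \<noteq> 0" using that by simp
        then show ?thesis using gh(2) unfolding hom_def by blast
      next
        case False
        then show ?thesis using gh(1) unfolding hom_def by blast
      qed
      then show "g + h \<in> hom e" unfolding hom_def by blast
    qed (auto simp: hom_def)
    then show ?thesis using that by (rule fs.subspace_inter[rotated])
  qed
  have comp_hom: "hcomp par e g \<in> hom e" for e g by (auto simp: hcomp_def hom_def)
  have hom_comp: "hcomp par e g = g" if "g \<in> hom e" for e g using that by (force simp: hcomp_def hom_def)
  have comp_comp: "hcomp par e (hcomp par e' g) = (if e = e' then hcomp par e g else 0)" for e e' g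
    by (auto simp: hcomp_def)
  have comp_add: "hcomp par e (g + h) = hcomp par e g + hcomp par e h" for e g h by (auto simp: hcomp_def)
  have comp_scale: "hcomp par e (\<lambda>k. c * g k) = (\<lambda>k. c * hcomp par e g k)" for e c g by (auto simp: hcomp_def)
  have comp_split: "g = hcomp par False g + hcomp par True g" for g by (auto simp: hcomp_def)
  obtain ds0 :: "('b \<Rightarrow> complex) list" and \<phi>0 :: "nat \<Rightarrow> ('b \<Rightarrow> complex) \<Rightarrow> complex" where c0:
     "\<And>i v w. \<phi>0 i (v + w) = \<phi>0 i v + \<phi>0 i w" "\<And>i c v. \<phi>0 i (\<lambda>k. c * v k) = c * \<phi>0 i v"
     "set ds0 \<subseteq> W \<inter> hom False"
     "\<And>i j. i < length ds0 \<Longrightarrow> j < length ds0 \<Longrightarrow> \<phi>0 i (ds0 ! j) = (if i = j then 1 else 0)"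
     "\<And>i w. i < length ds0 \<Longrightarrow> w \<in> N \<inter> hom False \<Longrightarrow> \<phi>0 i w = 0"
     "\<And>w. w \<in> W \<inter> hom False \<Longrightarrow> w - (\<Sum>i<length ds0. (\<lambda>k. \<phi>0 i w * (ds0 ! i) k)) \<in> N \<inter> hom False"
    by (rule fs.quotient_coordinates[OF sub[OF N, of False] sub[OF W, of False]]) (use NW in blast)+
  obtain ds1 :: "('b \<Rightarrow> complex) list" and \<phi>1 :: "nat \<Rightarrow> ('b \<Rightarrow> complex) \<Rightarrow> complex" where c1:
     "\<And>i v w. \<phi>1 i (v + w) = \<phi>1 i v + \<phi>1 i w" "\<And>i c v. \<phi>1 i (\<lambda>k. c * v k) = c * \<phi>1 i v"
     "set ds1 \<subseteq> W \<inter> hom True"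
     "\<And>i j. i < length ds1 \<Longrightarrow> j < length ds1 \<Longrightarrow> \<phi>1 i (ds1 ! j) = (if i = j then 1 else 0)"
     "\<And>i w. i < length ds1 \<Longrightarrow> w \<in> N \<inter> hom True \<Longrightarrow> \<phi>1 i w = 0"
     "\<And>w. w \<in> W \<inter> hom True \<Longrightarrow> w - (\<Sum>i<length ds1. (\<lambda>k. \<phi>1 i w * (ds1 ! i) k)) \<in> N \<inter> hom True"
    by (rule fs.quotient_coordinates[OF sub[OF N, of True] sub[OF W, of True]]) (use NW in blast)+
  define p q where "p = length ds0" and "q = length ds1"
  define D where "D = (\<lambda>i. if i < p then ds0 ! i else ds1 ! (i - p))"
  \<comment> \<open>Projecting to a parity component first makes each coordinate vanish on the other
    component of an arbitrary vector.\<close>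
  define \<Phi> where "\<Phi> = (\<lambda>i g. if i < p then \<phi>0 i (hcomp par False g) else \<phi>1 (i - p) (hcomp par True g))"
  have z: "\<phi>0 i 0 = 0" "\<phi>1 i 0 = 0" for i
    using c0(2)[of i 0 0] c1(2)[of i 0 0] by (simp_all add: zero_fun_def)
  have D: "D i \<in> W \<inter> hom (p \<le> i)" if "i < p + q" for i
  proof (cases "i < p")
    case True
    then show ?thesis using c0(3) by (auto simp: D_def p_def)
  next
    case False
    then have "i - p < q" using that by simp
    then show ?thesis using False c1(3) by (auto simp: D_def q_def)
  qed
  have \<Phi>_comp: "\<Phi> i (hcomp par e g) = (if e = (p \<le> i) then \<Phi> i g else 0)" for i e g
    by (auto simp: \<Phi>_def comp_comp z)
  show ?thesis
  proof (rule that[of \<Phi> p q D])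
    show "\<Phi> i (\<lambda>k. g k + h k) = \<Phi> i g + \<Phi> i h" for i g h
    proof -
      have "(\<lambda>k. g k + h k) = g + h" by (rule ext) simp
      then show ?thesis by (simp only: \<Phi>_def comp_add c0(1) c1(1) split: if_split) simp
    qed
    show "\<Phi> i (\<lambda>k. c * g k) = c * \<Phi> i g" for i c g
      by (simp add: \<Phi>_def comp_scale c0 c1)
    show "D i \<in> W" if "i < p + q" for i using D[OF that] by simp
    show "par k = (p \<le> i)" if "i < p + q" "D i k \<noteq> 0" for i k using D[OF that(1)] that(2) by (auto simp: hom_def)
    show "\<Phi> i (D j) = (if i = j then 1 else 0)" if ij: "i < p + q" "j < p + q" for i j
    proof -
      have "hcomp par e (D j) = (if e = (p \<le> j) then D j else 0)" for e
        using D[OF ij(2)] hom_comp[of "D j" "p \<le> j"] comp_comp[of e "p \<le> j" "D j"] by auto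
      then show ?thesis using ij c0(4)[of i j] c1(4)[of "i - p" "j - p"]
        by (auto simp: \<Phi>_def D_def z p_def[symmetric] q_def[symmetric])
    qed
    show "\<Phi> i g = 0" if "i < p + q" "g \<in> N" for i g
      using that c0(5)[of i "hcomp par False g"] c1(5)[of "i - p" "hcomp par True g"] gr(1)[OF that(2)] comp_hom
      by (auto simp: \<Phi>_def p_def q_def)
    show "(\<lambda>k. g k - (\<Sum>i<p+q. \<Phi> i g * D i k)) \<in> N" if g: "g \<in> W" for g
    proof -
      have 0: "hcomp par False g - (\<Sum>i<p. (\<lambda>k. \<Phi> i g * D i k)) \<in> N"
        using c0(6)[of "hcomp par False g"] gr(2)[OF g] comp_hom by (simp add: \<Phi>_def D_def p_def)
      have 1: "hcomp par True g - (\<Sum>i<q. (\<lambda>k. \<Phi> (p + i) g * D (p + i) k)) \<in> N"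
        using c1(6)[of "hcomp par True g"] gr(2)[OF g] comp_hom by (simp add: \<Phi>_def D_def q_def)
      have "(\<lambda>k. g k - (\<Sum>i<p+q. \<Phi> i g * D i k)) =
        (hcomp par False g - (\<Sum>i<p. (\<lambda>k. \<Phi> i g * D i k))) + (hcomp par True g - (\<Sum>i<q. (\<lambda>k. \<Phi> (p + i) g * D (p + i) k)))"
      proof
        fix k
        have "g k = hcomp par False g k + hcomp par True g k" by (simp add: hcomp_def)
        then show "g k - (\<Sum>i<p+q. \<Phi> i g * D i k) = ((hcomp par False g - (\<Sum>i<p. (\<lambda>k. \<Phi> i g * D i k))) +
            (hcomp par True g - (\<Sum>i<q. (\<lambda>k. \<Phi> (p + i) g * D (p + i) k)))) k"
          by (simp add: sum_lessThan_plus sum_fun_apply)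
      qed
      then show ?thesis using fs.subspace_add[OF N 0 1] by simp
    qed
    show "\<Phi> i (hcomp par e g) = (if e = (p \<le> i) then \<Phi> i g else 0)" if "i < p + q" for i e g
      by (rule \<Phi>_comp)
  qed
qed


definition invariant :: "nat \<Rightarrow> nat \<Rightarrow> ('b::finite \<Rightarrow> bool) \<Rightarrow> (complex mat \<Rightarrow> 'b \<Rightarrow> 'b \<Rightarrow> complex) \<Rightarrow>
    ('b \<Rightarrow> complex) set \<Rightarrow> bool" where
  "invariant m n par T M \<longleftrightarrow> fs.subspace M \<and> (\<forall>e. \<forall>g\<in>M. hcomp par e g \<in> M) \<and>
     (\<forall>x\<in>gl m n. \<forall>g\<in>M. app T x g \<in> M)"

text \<open>\<open>W\<close> is the smallest invariant subspace containing \<open>f\<close>, and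
  \<open>N\<close> has the largest dimension among the invariant subspaces of \<open>W\<close> that
  avoid \<open>f\<close>. A subspace between them either contains \<open>f\<close> and is
  \<open>W\<close>, or avoids \<open>f\<close> and is \<open>N\<close> by dimension.\<close>

lemma invariant_sandwich:
  fixes f :: "'b::finite \<Rightarrow> complex"
  assumes f0: "f \<noteq> 0"
  shows "\<exists>N W. invariant m n par T N \<and> invariant m n par T W \<and> N \<subseteq> W \<and> f \<in> W \<and> f \<notin> N \<and>
    (\<forall>M. invariant m n par T M \<longrightarrow> N \<subseteq> M \<longrightarrow> M \<subseteq> W \<longrightarrow> M = N \<or> M = W)"
proof -
  let ?I = "invariant m n par T"
  define W where "W = \<Inter>{M. ?I M \<and> f \<in> M}"
  have W: "?I W" unfolding W_def invariant_def fs.subspace_def by blast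
  have "?I {0}"
    by (auto simp: invariant_def fs.subspace_def hcomp_def app_def)
  moreover have "0 \<in> W" using W by (auto simp: invariant_def fs.subspace_def)
  ultimately have "?I {0} \<and> {0} \<subseteq> W \<and> f \<notin> {0}" using f0 by auto
  then have "\<exists>N. (?I N \<and> N \<subseteq> W \<and> f \<notin> N) \<and> (\<forall>M. ?I M \<and> M \<subseteq> W \<and> f \<notin> M \<longrightarrow> fs.dim M \<le> fs.dim N)"
  proof (rule ex_has_greatest_nat)
    show "\<forall>M. ?I M \<and> M \<subseteq> W \<and> f \<notin> M \<longrightarrow>
        fs.dim M < Suc (card (range (\<lambda>(i::'b) j. if i = j then 1 else (0::complex))))"
      using fs.dim_subset_UNIV[of "M :: ('b \<Rightarrow> complex) set" for M]
      unfolding fs.dimension_def by (simp add: less_Suc_eq_le)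
  qed
  then obtain N where N: "?I N" "N \<subseteq> W" "f \<notin> N"
    and max: "\<And>M. ?I M \<Longrightarrow> M \<subseteq> W \<Longrightarrow> f \<notin> M \<Longrightarrow> fs.dim M \<le> fs.dim N" by blast
  have "M = N \<or> M = W" if M: "?I M" "N \<subseteq> M" "M \<subseteq> W" for M
    proof (cases "f \<in> M")
      case True
      then show ?thesis using M by (auto simp: W_def)
    next
      case False
      then have "fs.dim M \<le> fs.dim N" using max M by blast
      then have "N = M" using fs.subspace_dim_equal[of N M] N(1) M by (auto simp: invariant_def)
      then show ?thesis by simp
    qed
  moreover have "f \<in> W" by (auto simp: W_def)
  ultimately show ?thesis using N W by blast
qed

text \<open>The quotient of \<open>W\<close> by \<open>N\<close> is written in coordinates:
  \<open>V\<close> is the quotient map and \<open>R\<close> the induced action. Preimages of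
  submodules are invariant subspaces between \<open>N\<close> and \<open>W\<close>, which gives
  simplicity, and \<open>V f\<close> is the highest weight vector because \<open>f\<close> is not in
  \<open>N\<close>.\<close>

lemma simple_subquotient:
  fixes par :: "'b::finite \<Rightarrow> bool"
  assumes T: "kernel_rep m n par T" and hw: "kernel_hwv m n par T \<mu> f"
  shows "\<exists>p q R w. is_simple_module m n p q R \<and> hwv m n p q R (<) \<mu> w"
proof -
  have "f \<noteq> 0" using hw by (auto simp: kernel_hwv_def)
  then obtain N W where NW: "invariant m n par T N" "invariant m n par T W" "N \<subseteq> W" "f \<in> W" "f \<notin> N"
    and max: "\<And>M. invariant m n par T M \<Longrightarrow> N \<subseteq> M \<Longrightarrow> M \<subseteq> W \<Longrightarrow> M = N \<or> M = W"
    using invariant_sandwich[of f m n par T] by metis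
  have subN: "fs.subspace N" and subW: "fs.subspace W"
    and grN: "\<And>e g. g \<in> N \<Longrightarrow> hcomp par e g \<in> N" and grW: "\<And>e g. g \<in> W \<Longrightarrow> hcomp par e g \<in> W"
    and appN: "\<And>x g. x \<in> gl m n \<Longrightarrow> g \<in> N \<Longrightarrow> app T x g \<in> N"
    and appW: "\<And>x g. x \<in> gl m n \<Longrightarrow> g \<in> W \<Longrightarrow> app T x g \<in> W"
    using NW by (auto simp: invariant_def)
  obtain p q :: nat and D :: "nat \<Rightarrow> 'b \<Rightarrow> complex" and \<Phi> :: "nat \<Rightarrow> ('b \<Rightarrow> complex) \<Rightarrow> complex" where
    \<Phi>_add: "\<And>i g h. \<Phi> i (\<lambda>k. g k + h k) = \<Phi> i g + \<Phi> i h" and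
    \<Phi>_scale: "\<And>i c g. \<Phi> i (\<lambda>k. c * g k) = c * \<Phi> i g" and
    DW: "\<And>i. i < p + q \<Longrightarrow> D i \<in> W" and
    Dpar: "\<And>i k. i < p + q \<Longrightarrow> D i k \<noteq> 0 \<Longrightarrow> par k = (p \<le> i)" and
    \<Phi>D: "\<And>i j. i < p + q \<Longrightarrow> j < p + q \<Longrightarrow> \<Phi> i (D j) = (if i = j then 1 else 0)" and
    \<Phi>N: "\<And>i g. i < p + q \<Longrightarrow> g \<in> N \<Longrightarrow> \<Phi> i g = 0" and
    \<Phi>W: "\<And>g. g \<in> W \<Longrightarrow> (\<lambda>k. g k - (\<Sum>i<p+q. \<Phi> i g * D i k)) \<in> N" and
    \<Phi>_comp: "\<And>i e g. i < p + q \<Longrightarrow> \<Phi> i (hcomp par e g) = (if e = (p \<le> i) then \<Phi> i g else 0)"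
    by (rule graded_quotient_coordinates[OF subN subW NW(3) grN grW]) blast+
  define R where "R = (\<lambda>x. mat (p + q) (p + q) (\<lambda>(i,j). \<Phi> i (app T x (D j))))"
  define V where "V = (\<lambda>g. vec (p + q) (\<lambda>i. \<Phi> i g))"
  have \<Phi>_zero: "\<Phi> i (\<lambda>k. 0) = 0" for i using \<Phi>_scale[of i 0 "\<lambda>k. 0"] by simp
  have \<Phi>_diff: "\<Phi> i (\<lambda>k. g k - h k) = \<Phi> i g - \<Phi> i h" for i g h
    using \<Phi>_add[of i g "\<lambda>k. (-1) * h k"] \<Phi>_scale[of i "-1" h] by simp
  have \<Phi>_sum: "\<Phi> i (\<lambda>k. \<Sum>j\<in>J. c j * G j k) = (\<Sum>j\<in>J. c j * \<Phi> i (G j))" for i c G and J :: "nat set"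
  proof (induction J rule: infinite_finite_induct)
    case (insert j J)
    then show ?case using \<Phi>_add[of i "\<lambda>k. c j * G j k"] by (simp add: \<Phi>_scale)
  qed (simp_all add: \<Phi>_zero)
  \<comment> \<open>Replacing \<open>g\<close> by its representative in the span of the
    \<open>D j\<close> changes it by an element of \<open>N\<close>, which stays in \<open>N\<close>
    under \<open>x\<close> and is then killed by the coordinates.\<close>
  have key: "\<Phi> i (app T x g) = (\<Sum>j<p+q. \<Phi> i (app T x (D j)) * \<Phi> j g)"
    if i: "i < p + q" and x: "x \<in> gl m n" and g: "g \<in> W" for i x g
  proof -
    have "app T x (\<lambda>k. g k - (\<Sum>j<p+q. \<Phi> j g * D j k)) \<in> N" using appN[OF x] \<Phi>W[OF g] by blast
    then have "\<Phi> i (app T x (\<lambda>k. g k - (\<Sum>j<p+q. \<Phi> j g * D j k))) = 0" using \<Phi>N i by blast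
    then have "\<Phi> i (app T x g) - (\<Sum>j<p+q. \<Phi> j g * \<Phi> i (app T x (D j))) = 0"
      unfolding app_diff app_sum \<Phi>_diff \<Phi>_sum .
    then show ?thesis by (simp add: mult.commute)
  qed
  have Rgl: "R x \<in> gl p q" for x by (simp add: R_def)
  have RV: "R x *\<^sub>v V g = V (app T x g)" if "x \<in> gl m n" "g \<in> W" for x g
    using key[OF _ that] by (intro eq_vecI) (auto simp: R_def V_def scalar_prod_def atLeast0LessThan)
  have VN: "g \<in> N" if "g \<in> W" "V g = 0\<^sub>v (p + q)" for g
  proof -
    have "\<Phi> i g = 0" if "i < p + q" for i
      using arg_cong[OF \<open>V g = _\<close>, of "\<lambda>y. y $ i"] that by (simp add: V_def)
    then show ?thesis using \<Phi>W[OF that(1)] by simp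
  qed
  have VN': "V g = 0\<^sub>v (p + q)" if "g \<in> N" for g
    using \<Phi>N that by (intro eq_vecI) (auto simp: V_def)
  have V_surj: "\<exists>g\<in>W. y = V g" if y: "y \<in> carrier_vec (p + q)" for y
  proof -
    define g where "g = (\<Sum>j<p+q. (\<lambda>k. y $ j * D j k))"
    have "g \<in> W" unfolding g_def
      by (rule fs.subspace_sum[OF subW], rule fs.subspace_scale[OF subW]) (simp add: DW)
    moreover have "\<Phi> i g = y $ i" if "i < p + q" for i
    proof -
      have "\<Phi> i g = (\<Sum>j<p+q. y $ j * \<Phi> i (D j))"
        unfolding \<Phi>_sum[symmetric] by (rule arg_cong[of _ _ "\<Phi> i"]) (auto simp: g_def sum_fun_apply)
      also have "\<dots> = (\<Sum>j<p+q. if j = i then y $ i else 0)" using that \<Phi>D by (intro sum.cong) auto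
      finally show ?thesis using that by simp
    qed
    ultimately show ?thesis using y by (intro bexI[of _ g] eq_vecI) (auto simp: V_def)
  qed
  have mod: "is_module m n p q R"
    unfolding is_module_def
  proof (intro conjI ballI allI)
    fix x y assume xy: "x \<in> gl m n" "y \<in> gl m n"
    then have "app T (x + y) g = (\<lambda>k. app T x g k + app T y g k)" for g
      using T by (auto simp: kernel_rep_def app_def distrib_right sum.distrib)
    then show "R (x + y) = R x + R y" by (intro eq_matI) (auto simp: R_def \<Phi>_add)
  next
    fix c x assume "x \<in> gl m n"
    then have "app T (c \<cdot>\<^sub>m x) g = (\<lambda>k. c * app T x g k)" for g
      using T by (auto simp: kernel_rep_def app_def sum_distrib_left mult.assoc)
    then show "R (c \<cdot>\<^sub>m x) = c \<cdot>\<^sub>m R x" by (intro eq_matI) (auto simp: R_def \<Phi>_scale)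
  next
    fix a :: nat and x assume a: "a \<in> {0,1}" and x: "x \<in> gl_part m n a"
    have "a = (if (i < p) = (j < p) then 0 else 1)" if ij: "i < p + q" "j < p + q" and nz: "R x $$ (i,j) \<noteq> 0" for i j
    proof -
      have "par k = ((p \<le> j) \<noteq> (a = 1))" if k: "app T x (D j) k \<noteq> 0" for k
      proof -
        obtain l where "T x k l * D j l \<noteq> 0"
          using k sum.neutral[of UNIV "\<lambda>l. T x k l * D j l"] by (auto simp: app_def)
        then have "T x k l \<noteq> 0" "par l = (p \<le> j)" using Dpar[OF ij(2)] by auto
        then show ?thesis using kernel_rep_par[OF T a x, of k l] a by auto
      qed
      then have "hcomp par ((p \<le> j) \<noteq> (a = 1)) (app T x (D j)) k = app T x (D j) k" for k
        by (cases "app T x (D j) k = 0") (simp_all add: hcomp_def)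
      then have "hcomp par ((p \<le> j) \<noteq> (a = 1)) (app T x (D j)) = app T x (D j)" by blast
      then have "((p \<le> j) \<noteq> (a = 1)) = (p \<le> i)"
        using \<Phi>_comp[OF ij(1), of "(p \<le> j) \<noteq> (a = 1)" "app T x (D j)"] nz ij by (auto simp: R_def split: if_splits)
      then show ?thesis using a by auto
    qed
    then show "R x \<in> gl_part p q a" using Rgl unfolding gl_part_def by blast
  next
    fix a b :: nat and x y
    assume ab: "a \<in> {0,1}" "b \<in> {0,1}" and xy: "x \<in> gl_part m n a" "y \<in> gl_part m n b"
    have g: "x \<in> gl m n" "y \<in> gl m n" using xy by (auto simp: gl_part_def)
    have prod: "\<Phi> i (app T x (app T y (D j))) = (R x * R y) $$ (i,j)"
      if "i < p + q" "j < p + q" "x \<in> gl m n" "y \<in> gl m n" for i j x y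
      using key[OF that(1,3) appW[OF that(4) DW[OF that(2)]]] that
      by (simp add: R_def scalar_prod_def atLeast0LessThan)
    show "R (superbracket a b x y) = superbracket a b (R x) (R y)"
    proof (rule eq_matI)
      fix i j assume "i < dim_row (superbracket a b (R x) (R y))" "j < dim_col (superbracket a b (R x) (R y))"
      then have ij: "i < p + q" "j < p + q" by (auto simp: superbracket_def R_def)
      have "R (superbracket a b x y) $$ (i,j) =
          \<Phi> i (app T x (app T y (D j))) - (-1) ^ (a * b) * \<Phi> i (app T y (app T x (D j)))"
        using ij by (simp add: R_def app_bracket[OF T ab xy] \<Phi>_diff \<Phi>_scale)
      also have "\<dots> = superbracket a b (R x) (R y) $$ (i,j)"
        unfolding prod[OF ij g] prod[OF ij g(2,1)] using ij by (simp add: superbracket_def R_def)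
      finally show "R (superbracket a b x y) $$ (i,j) = superbracket a b (R x) (R y) $$ (i,j)" .
    qed (auto simp: superbracket_def R_def)
  qed (use Rgl in auto)
  have Vf: "V f \<noteq> 0\<^sub>v (p + q)" using VN NW by blast
  have "is_simple_module m n p q R"
    unfolding is_simple_module_def
  proof (intro conjI allI impI mod)
    show "0 < p + q" using Vf by (auto simp: V_def)
    fix M' assume M': "is_submodule m n p q R M'"
    define M where "M = {g \<in> W. V g \<in> M'}"
    have V_add: "V (\<lambda>k. g k + h k) = V g + V h" and V_scale: "V (\<lambda>k. c * g k) = c \<cdot>\<^sub>v V g" for g h c
      by (auto simp: V_def \<Phi>_add \<Phi>_scale)
    have closed: "0\<^sub>v (p + q) \<in> M'" "\<And>v w. v \<in> M' \<Longrightarrow> w \<in> M' \<Longrightarrow> v + w \<in> M'" "\<And>c v. v \<in> M' \<Longrightarrow> c \<cdot>\<^sub>v v \<in> M'"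
      "\<And>v. v \<in> M' \<Longrightarrow> vpart p q True v \<in> M'" "\<And>x v. x \<in> gl m n \<Longrightarrow> v \<in> M' \<Longrightarrow> R x *\<^sub>v v \<in> M'"
      "M' \<subseteq> carrier_vec (p + q)"
      using M' by (auto simp: is_submodule_def vpart_def)
    have odd: "vpart p q False v \<in> M'" if "v \<in> M'" for v
    proof -
      have "vpart p q False v = v + (-1) \<cdot>\<^sub>v vpart p q True v"
        using that closed(6) by (intro eq_vecI) (auto simp: vpart_def)
      then show ?thesis using that closed by metis
    qed
    have inv: "invariant m n par T M"
      unfolding invariant_def
    proof (intro conjI allI ballI)
      show "fs.subspace M"
        unfolding fs.subspace_def
      proof (intro conjI ballI allI)
        show "0 \<in> M" using VN' closed(1) fs.subspace_0[OF subN] fs.subspace_0[OF subW] by (auto simp: M_def)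
        show "g + h \<in> M" if "g \<in> M" "h \<in> M" for g h
          using that fs.subspace_add[OF subW] V_add[of g h] closed(2) by (auto simp: M_def plus_fun_def)
        show "(\<lambda>i. c * g i) \<in> M" if "g \<in> M" for c g
          using that fs.subspace_scale[OF subW] V_scale[of c g] closed(3) by (auto simp: M_def)
      qed
    next
      fix e g assume g: "g \<in> M"
      have "V (hcomp par e g) = vpart p q (\<not> e) (V g)"
        by (intro eq_vecI) (auto simp: V_def vpart_def \<Phi>_comp)
      then show "hcomp par e g \<in> M" using g grW closed(4) odd by (cases e) (auto simp: M_def)
    next
      fix x g assume "x \<in> gl m n" "g \<in> M"
      then show "app T x g \<in> M" using appW[of x g] RV[of x g] closed(5)[of x "V g"] by (simp add: M_def)
    qed
    have "N \<subseteq> M" using VN' closed(1) NW(3) by (auto simp: M_def)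
    then consider "M = N" | "M = W" using max[OF inv] by (auto simp: M_def)
    then show "M' = {0\<^sub>v (p + q)} \<or> M' = carrier_vec (p + q)"
    proof cases
      case 1
      have "y = 0\<^sub>v (p + q)" if y: "y \<in> M'" for y
      proof -
        obtain g where "g \<in> W" "y = V g" using V_surj y closed(6) by blast
        then have "g \<in> N" using 1 y by (auto simp: M_def)
        then show ?thesis using VN' \<open>y = V g\<close> by simp
      qed
      then show ?thesis using closed(1) by blast
    next
      case 2
      have "y \<in> M'" if y: "y \<in> carrier_vec (p + q)" for y
      proof -
        obtain g where "g \<in> W" "y = V g" using V_surj y by blast
        then show ?thesis using 2 by (auto simp: M_def)
      qed
      then show ?thesis using closed(6) by blast
    qed
  qed
  moreover have "hwv m n p q R (<) \<mu> (V f)"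
    unfolding hwv_def
  proof (intro conjI allI impI Vf)
    show "V f \<in> carrier_vec (p + q)" by (simp add: V_def)
    show "R (munit (m + n) k k) *\<^sub>v V f = \<mu> (crd m k) \<cdot>\<^sub>v V f" if "k < m + n" for k
      using hw that RV[OF munit_carrier NW(4), of k k] by (auto simp: kernel_hwv_def V_def \<Phi>_scale)
    show "R (munit (m + n) a b) *\<^sub>v V f = 0\<^sub>v (p + q)" if "a < m + n" "b < m + n" "a < b" for a b
      using hw that RV[OF munit_carrier NW(4), of a b] by (auto simp: kernel_hwv_def V_def \<Phi>_zero)
  qed
  ultimately show ?thesis by blast
qed


section \<open>The exterior cubes and the supertrace module used for the weight\<close>

lemma app_unit: "app T x (\<lambda>i. if i = k then 1 else 0) = (\<lambda>i. T x i k)"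
proof
  fix i
  have "app T x (\<lambda>i. if i = k then 1 else 0) i = (\<Sum>j\<in>UNIV. if j = k then T x i k else 0)"
    unfolding app_def by (intro sum.cong) auto
  then show "app T x (\<lambda>i. if i = k then 1 else 0) i = T x i k" by simp
qed

text \<open>The vector is the wedge of the first three basis vectors; \<open>3 \<le> m\<close> makes
  all three even.\<close>

lemma kernel_hwv_std_cube:
  fixes \<iota> :: "'i::finite \<Rightarrow> nat"
  assumes \<iota>: "bij_betw \<iota> UNIV {..<m+n}" and m: "3 \<le> m"
  shows "\<exists>f. kernel_hwv m n (tensor_par (std_par m \<iota>) (tensor_par (std_par m \<iota>) (std_par m \<iota>)))
    (tensor (std_par m \<iota>) (tensor_par (std_par m \<iota>) (std_par m \<iota>)) (std \<iota>)
      (tensor (std_par m \<iota>) (std_par m \<iota>) (std \<iota>) (std \<iota>))) (ev m 0 + ev m 1 + ev m 2) f"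
proof -
  have lt: "\<iota> i < m + n" for i using \<iota> by (auto simp: bij_betw_def)
  have inj: "\<iota> i = \<iota> j \<longleftrightarrow> i = j" for i j using \<iota> by (auto simp: bij_betw_def inj_def)
  have ex: "\<exists>i. \<iota> i = k" if "k < m + n" for k using \<iota> that unfolding bij_betw_def by (metis imageE lessThan_iff)
  have n3: "0 < m + n" "1 < m + n" "2 < m + n" using m by auto
  then obtain x\<^sub>0 x\<^sub>1 x\<^sub>2 where x: "\<iota> x\<^sub>0 = 0" "\<iota> x\<^sub>1 = 1" "\<iota> x\<^sub>2 = 2"
    using ex by metis
  have eq: "i = x\<^sub>0 \<longleftrightarrow> \<iota> i = 0" "i = x\<^sub>1 \<longleftrightarrow> \<iota> i = 1" "i = x\<^sub>2 \<longleftrightarrow> \<iota> i = 2" for i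
    using inj[of i] x by metis+
  have *: "app (std \<iota>) (munit (m + n) a b) (\<lambda>i. if i = [x\<^sub>0, x\<^sub>1, x\<^sub>2] ! s then 1 else 0) =
      (\<lambda>i. if \<iota> i = a \<and> s = b then 1 else 0)" if "s = 0 \<or> s = 1 \<or> s = 2" for s a b
  proof -
    have "std \<iota> (munit (m + n) a b) i ([x\<^sub>0, x\<^sub>1, x\<^sub>2] ! s) = (if \<iota> i = a \<and> s = b then 1 else 0)" for i
      unfolding std_def using that x n3 by (elim disjE) (simp_all only: nth_Cons_0 nth_Cons_Suc One_nat_def
        numeral_2_eq_2 munit_index[OF lt])
    then show ?thesis unfolding app_unit by blast
  qed
  show ?thesis
  proof (rule kernel_hwv_cube[where x\<^sub>0 = x\<^sub>0 and x\<^sub>1 = x\<^sub>1 and x\<^sub>2 = x\<^sub>2 and e = False and \<kappa> = "ev m"])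
    show "x\<^sub>0 \<noteq> x\<^sub>1" "x\<^sub>0 \<noteq> x\<^sub>2" "x\<^sub>1 \<noteq> x\<^sub>2" using x by auto
    show "std_par m \<iota> x\<^sub>0 = False" "std_par m \<iota> x\<^sub>1 = False" "std_par m \<iota> x\<^sub>2 = False"
      using x m by (auto simp: std_par_def)
    fix k s :: nat assume k: "k < m + n" and s: "s < 3"
    have "i = [x\<^sub>0, x\<^sub>1, x\<^sub>2] ! s \<longleftrightarrow> \<iota> i = s" for i
      using s eq[of i] by (auto simp: less_Suc_eq numeral_3_eq_3 numeral_2_eq_2)
    then show "app (std \<iota>) (munit (m + n) k k) (\<lambda>i. if i = [x\<^sub>0, x\<^sub>1, x\<^sub>2] ! s then 1 else 0) =
      (\<lambda>i. ev m s (crd m k) * (if i = [x\<^sub>0, x\<^sub>1, x\<^sub>2] ! s then 1 else 0))"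
      using s k by (subst *) (auto simp: fun_eq_iff)
  next
    fix a b :: nat assume ab: "a < m + n" "b < m + n" "a < b"
    show "\<exists>\<alpha> \<beta> \<gamma>.
      app (std \<iota>) (munit (m + n) a b) (\<lambda>i. if i = [x\<^sub>0, x\<^sub>1, x\<^sub>2] ! 0 then 1 else 0) = (\<lambda>i. 0) \<and>
      app (std \<iota>) (munit (m + n) a b) (\<lambda>i. if i = [x\<^sub>0, x\<^sub>1, x\<^sub>2] ! 1 then 1 else 0) =
        (\<lambda>i. \<alpha> * (if i = [x\<^sub>0, x\<^sub>1, x\<^sub>2] ! 0 then 1 else 0)) \<and>
      app (std \<iota>) (munit (m + n) a b) (\<lambda>i. if i = [x\<^sub>0, x\<^sub>1, x\<^sub>2] ! 2 then 1 else 0) =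
        (\<lambda>i. \<beta> * (if i = [x\<^sub>0, x\<^sub>1, x\<^sub>2] ! 0 then 1 else 0) + \<gamma> * (if i = [x\<^sub>0, x\<^sub>1, x\<^sub>2] ! 1 then 1 else 0))"
    \<comment> \<open>\<open>E a b\<close> sends the basis vector \<open>b\<close> to the basis
      vector \<open>a\<close>, so only \<open>b = 1, a = 0\<close> and \<open>b = 2, a < 2\<close>
      give nonzero coefficients.\<close>
    proof (rule exI[of _ "if b = 1 then 1 else 0"], rule exI[of _ "if a = 0 \<and> b = 2 then 1 else 0"],
          rule exI[of _ "if a = 1 \<and> b = 2 then 1 else 0"], intro conjI ext)
      fix i
      have u: "i = [x\<^sub>0, x\<^sub>1, x\<^sub>2] ! 0 \<longleftrightarrow> \<iota> i = 0" "i = [x\<^sub>0, x\<^sub>1, x\<^sub>2] ! 1 \<longleftrightarrow> \<iota> i = 1"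
        "i = [x\<^sub>0, x\<^sub>1, x\<^sub>2] ! 2 \<longleftrightarrow> \<iota> i = 2" using eq by simp_all
      show "app (std \<iota>) (munit (m + n) a b) (\<lambda>i. if i = [x\<^sub>0, x\<^sub>1, x\<^sub>2] ! 0 then 1 else 0) i = 0"
        using ab by (subst *) auto
      show "app (std \<iota>) (munit (m + n) a b) (\<lambda>i. if i = [x\<^sub>0, x\<^sub>1, x\<^sub>2] ! 1 then 1 else 0) i =
        (if b = 1 then 1 else 0) * (if i = [x\<^sub>0, x\<^sub>1, x\<^sub>2] ! 0 then 1 else 0)"
        unfolding u *[OF disjI2[OF disjI1[OF refl]]] using ab by auto
      show "app (std \<iota>) (munit (m + n) a b) (\<lambda>i. if i = [x\<^sub>0, x\<^sub>1, x\<^sub>2] ! 2 then 1 else 0) i =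
        (if a = 0 \<and> b = 2 then 1 else 0) * (if i = [x\<^sub>0, x\<^sub>1, x\<^sub>2] ! 0 then 1 else 0) +
        (if a = 1 \<and> b = 2 then 1 else 0) * (if i = [x\<^sub>0, x\<^sub>1, x\<^sub>2] ! 1 then 1 else 0)"
        unfolding u *[OF disjI2[OF disjI2[OF refl]]] using ab by auto
    qed
  qed
qed

text \<open>On the dual, \<open>E a b\<close> moves the dual basis vector \<open>a\<close> to
  \<open>b\<close>, so raising operators move towards the last index and the wedge starts from the
  end. The condition \<open>3 \<le> n\<close> makes the three vectors odd.\<close>

lemma kernel_hwv_dual_cube:
  fixes \<iota> :: "'i::finite \<Rightarrow> nat"
  assumes \<iota>: "bij_betw \<iota> UNIV {..<m+n}" and n: "3 \<le> n"
  shows "\<exists>f. kernel_hwv m n (tensor_par (std_par m \<iota>) (tensor_par (std_par m \<iota>) (std_par m \<iota>)))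
    (tensor (std_par m \<iota>) (tensor_par (std_par m \<iota>) (std_par m \<iota>)) (dual m \<iota>)
      (tensor (std_par m \<iota>) (std_par m \<iota>) (dual m \<iota>) (dual m \<iota>)))
    (- ev m (m + n - 1) + - ev m (m + n - 2) + - ev m (m + n - 3)) f"
proof -
  have lt: "\<iota> i < m + n" for i using \<iota> by (auto simp: bij_betw_def)
  have inj: "\<iota> i = \<iota> j \<longleftrightarrow> i = j" for i j using \<iota> by (auto simp: bij_betw_def inj_def)
  have ex: "\<exists>i. \<iota> i = k" if "k < m + n" for k using \<iota> that unfolding bij_betw_def by (metis imageE lessThan_iff)
  have "m + n - 1 < m + n" "m + n - 2 < m + n" "m + n - 3 < m + n" using n by auto
  then obtain x\<^sub>0 x\<^sub>1 x\<^sub>2 where x: "\<iota> x\<^sub>0 = m + n - 1" "\<iota> x\<^sub>1 = m + n - 2" "\<iota> x\<^sub>2 = m + n - 3"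
    using ex by metis
  have eq: "i = x\<^sub>0 \<longleftrightarrow> \<iota> i = m + n - 1" "i = x\<^sub>1 \<longleftrightarrow> \<iota> i = m + n - 2" "i = x\<^sub>2 \<longleftrightarrow> \<iota> i = m + n - 3" for i
    using inj[of i] x by metis+
  \<comment> \<open>The start vector is odd, so the sign of the supertranspose shows up exactly when
    the target index \<open>b\<close> is even; for the raising operators that contribute below, the
    coefficient is always -1.\<close>
  have coeff: "app (dual m \<iota>) (munit (m + n) a b) (\<lambda>i. if i = [x\<^sub>0, x\<^sub>1, x\<^sub>2] ! s then 1 else 0) =
      (\<lambda>i. if \<iota> i = b \<and> m + n - Suc s = a then (if b < m then 1 else - 1) else 0)"
    if "s = 0 \<or> s = 1 \<or> s = 2" for s a b
    using that n by (elim disjE) (auto simp: app_unit dual_def lt x fun_eq_iff sg_def std_par_def)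
  define \<kappa> where "\<kappa> = (\<lambda>s. - ev m (m + n - Suc s))"
  have "- ev m (m + n - 1) + - ev m (m + n - 2) + - ev m (m + n - 3) = \<kappa> 0 + \<kappa> 1 + \<kappa> 2"
    by (simp add: \<kappa>_def numeral_2_eq_2 numeral_3_eq_3)
  moreover have "\<exists>f. kernel_hwv m n (tensor_par (std_par m \<iota>) (tensor_par (std_par m \<iota>) (std_par m \<iota>)))
    (tensor (std_par m \<iota>) (tensor_par (std_par m \<iota>) (std_par m \<iota>)) (dual m \<iota>)
      (tensor (std_par m \<iota>) (std_par m \<iota>) (dual m \<iota>) (dual m \<iota>))) (\<kappa> 0 + \<kappa> 1 + \<kappa> 2) f"
  proof (rule kernel_hwv_cube[where x\<^sub>0 = x\<^sub>0 and x\<^sub>1 = x\<^sub>1 and x\<^sub>2 = x\<^sub>2 and e = True and \<kappa> = \<kappa>])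
    show "x\<^sub>0 \<noteq> x\<^sub>1" "x\<^sub>0 \<noteq> x\<^sub>2" "x\<^sub>1 \<noteq> x\<^sub>2" using x n by auto
    show "std_par m \<iota> x\<^sub>0 = True" "std_par m \<iota> x\<^sub>1 = True" "std_par m \<iota> x\<^sub>2 = True"
      using x n by (auto simp: std_par_def)
    fix k s :: nat assume k: "k < m + n" and s: "s < 3"
    have "i = [x\<^sub>0, x\<^sub>1, x\<^sub>2] ! s \<longleftrightarrow> \<iota> i = m + n - Suc s" for i
      using s eq[of i] by (auto simp: less_Suc_eq numeral_3_eq_3 numeral_2_eq_2)
    then show "app (dual m \<iota>) (munit (m + n) k k) (\<lambda>i. if i = [x\<^sub>0, x\<^sub>1, x\<^sub>2] ! s then 1 else 0) =
      (\<lambda>i. \<kappa> s (crd m k) * (if i = [x\<^sub>0, x\<^sub>1, x\<^sub>2] ! s then 1 else 0))"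
      using s n k by (subst coeff) (auto simp: \<kappa>_def fun_eq_iff)
  next
    fix a b :: nat assume ab: "a < m + n" "b < m + n" "a < b"
    show "\<exists>\<alpha> \<beta> \<gamma>.
      app (dual m \<iota>) (munit (m + n) a b) (\<lambda>i. if i = [x\<^sub>0, x\<^sub>1, x\<^sub>2] ! 0 then 1 else 0) = (\<lambda>i. 0) \<and>
      app (dual m \<iota>) (munit (m + n) a b) (\<lambda>i. if i = [x\<^sub>0, x\<^sub>1, x\<^sub>2] ! 1 then 1 else 0) =
        (\<lambda>i. \<alpha> * (if i = [x\<^sub>0, x\<^sub>1, x\<^sub>2] ! 0 then 1 else 0)) \<and>
      app (dual m \<iota>) (munit (m + n) a b) (\<lambda>i. if i = [x\<^sub>0, x\<^sub>1, x\<^sub>2] ! 2 then 1 else 0) =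
        (\<lambda>i. \<beta> * (if i = [x\<^sub>0, x\<^sub>1, x\<^sub>2] ! 0 then 1 else 0) + \<gamma> * (if i = [x\<^sub>0, x\<^sub>1, x\<^sub>2] ! 1 then 1 else 0))"
    proof (rule exI[of _ "if a = m + n - 2 then - 1 else 0"],
          rule exI[of _ "if a = m + n - 3 \<and> b = m + n - 1 then - 1 else 0"],
          rule exI[of _ "if a = m + n - 3 \<and> b = m + n - 2 then - 1 else 0"], intro conjI ext)
      fix i
      have sub: "m + n - Suc 0 = m + n - 1" "m + n - Suc 1 = m + n - 2" "m + n - Suc 2 = m + n - 3" by auto
      have u: "i = [x\<^sub>0, x\<^sub>1, x\<^sub>2] ! 0 \<longleftrightarrow> \<iota> i = m + n - 1" "i = [x\<^sub>0, x\<^sub>1, x\<^sub>2] ! 1 \<longleftrightarrow> \<iota> i = m + n - 2"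
        "i = [x\<^sub>0, x\<^sub>1, x\<^sub>2] ! 2 \<longleftrightarrow> \<iota> i = m + n - 3" using eq by simp_all
      have c: "app (dual m \<iota>) (munit (m + n) a b) (\<lambda>i. if i = [x\<^sub>0, x\<^sub>1, x\<^sub>2] ! s then 1 else 0) i =
          (if \<iota> i = b \<and> m + n - Suc s = a then - 1 else 0)" if "s = 0 \<or> s = 1 \<or> s = 2" for s
        using that n ab unfolding coeff[OF that] by auto
      show "app (dual m \<iota>) (munit (m + n) a b) (\<lambda>i. if i = [x\<^sub>0, x\<^sub>1, x\<^sub>2] ! 0 then 1 else 0) i = 0"
        using ab by (subst c) auto
      show "app (dual m \<iota>) (munit (m + n) a b) (\<lambda>i. if i = [x\<^sub>0, x\<^sub>1, x\<^sub>2] ! 1 then 1 else 0) i =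
        (if a = m + n - 2 then - 1 else 0) * (if i = [x\<^sub>0, x\<^sub>1, x\<^sub>2] ! 0 then 1 else 0)"
        unfolding u c[OF disjI2[OF disjI1[OF refl]]] sub using ab by auto
      show "app (dual m \<iota>) (munit (m + n) a b) (\<lambda>i. if i = [x\<^sub>0, x\<^sub>1, x\<^sub>2] ! 2 then 1 else 0) i =
        (if a = m + n - 3 \<and> b = m + n - 1 then - 1 else 0) * (if i = [x\<^sub>0, x\<^sub>1, x\<^sub>2] ! 0 then 1 else 0) +
        (if a = m + n - 3 \<and> b = m + n - 2 then - 1 else 0) * (if i = [x\<^sub>0, x\<^sub>1, x\<^sub>2] ! 1 then 1 else 0)"
        unfolding u c[OF disjI2[OF disjI2[OF refl]]] sub using ab n by auto
    qed
  qed
  ultimately show ?thesis by simp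
qed

text \<open>The value \<open>- c\<close> is also given at 0 and outside the index range, which is
  harmless because \<open>kernel_hwv\<close> looks only at the coordinates
  \<open>crd m k\<close>.\<close>

lemma kernel_hwv_strace: "kernel_hwv m n (\<lambda>_. False) (strace m n c) (\<lambda>z. if 0 < z then c else - c) (\<lambda>_. 1)"
  unfolding kernel_hwv_def
proof (intro conjI allI impI)
  fix k assume k: "k < m + n"
  have "(\<Sum>l<m+n. sg (m \<le> l) * munit (m + n) k k $$ (l,l)) = (\<Sum>l<m+n. if l = k then sg (m \<le> k) else 0)"
    by (intro sum.cong) auto
  also have "\<dots> = sg (m \<le> k)" using k by simp
  finally show "app (strace m n c) (munit (m + n) k k) (\<lambda>_. 1) = (\<lambda>i. (if 0 < crd m k then c else - c) * 1)"
    by (auto simp: app_def strace_def UNIV_unit sg_def crd_def)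
next
  fix a b assume ab: "a < m + n" "b < m + n" "a < b"
  then have "strace m n c (munit (m + n) a b) = (\<lambda>i j. 0)"
    by (auto simp: strace_def fun_eq_iff intro!: sum.neutral)
  then show "app (strace m n c) (munit (m + n) a b) (\<lambda>_. 1) = (\<lambda>i. 0)" by (simp add: app_def)
qed auto

lemma simple_module_exists:
  fixes \<iota> :: "'i::finite \<Rightarrow> nat"
  assumes \<iota>: "bij_betw \<iota> UNIV {..<m+n}" and "3 \<le> m" "3 \<le> n"
  defines "\<alpha> \<equiv> ev m 0 + ev m 1 + ev m 2"
    and "\<beta> \<equiv> - ev m (m + n - 1) + - ev m (m + n - 2) + - ev m (m + n - 3)"
  shows "\<exists>p q R w. is_simple_module m n p q R \<and>
    hwv m n p q R (<) (\<alpha> + \<alpha> + (\<beta> + \<beta> + (\<lambda>z. if 0 < z then c else - c))) w"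
proof -
  obtain f where f: "kernel_hwv m n (tensor_par (std_par m \<iota>) (tensor_par (std_par m \<iota>) (std_par m \<iota>)))
    (tensor (std_par m \<iota>) (tensor_par (std_par m \<iota>) (std_par m \<iota>)) (std \<iota>)
      (tensor (std_par m \<iota>) (std_par m \<iota>) (std \<iota>) (std \<iota>))) \<alpha> f"
    using kernel_hwv_std_cube[OF \<iota>] assms(2) unfolding \<alpha>_def by blast
  obtain g where g: "kernel_hwv m n (tensor_par (std_par m \<iota>) (tensor_par (std_par m \<iota>) (std_par m \<iota>)))
    (tensor (std_par m \<iota>) (tensor_par (std_par m \<iota>) (std_par m \<iota>)) (dual m \<iota>)
      (tensor (std_par m \<iota>) (std_par m \<iota>) (dual m \<iota>) (dual m \<iota>))) \<beta> g"
    using kernel_hwv_dual_cube[OF \<iota>] assms(3) unfolding \<beta>_def by blast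
  note F = kernel_rep_tensor[OF kernel_rep_std[OF \<iota>] kernel_rep_tensor[OF kernel_rep_std[OF \<iota>] kernel_rep_std[OF \<iota>]]]
  note G = kernel_rep_tensor[OF kernel_rep_dual[OF \<iota>] kernel_rep_tensor[OF kernel_rep_dual[OF \<iota>] kernel_rep_dual[OF \<iota>]]]
  show ?thesis
    by (rule simple_subquotient[OF kernel_rep_tensor[OF kernel_rep_tensor[OF F F]
          kernel_rep_tensor[OF kernel_rep_tensor[OF G G] kernel_rep_strace]]
        kernel_hwv_tensor[OF kernel_hwv_tensor[OF f f]
          kernel_hwv_tensor[OF kernel_hwv_tensor[OF g g] kernel_hwv_strace]]])
qed

section \<open>Bases and orderings\<close>

interpretation wt: vector_space "\<lambda>(c::complex) (\<nu>::weight) k. c * \<nu> k"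
  by unfold_locales (auto simp: fun_eq_iff algebra_simps)

lemma lin_indep_zero:
  assumes "lin_indep S" "finite S" "\<And>k. (\<Sum>\<alpha>\<in>S. c \<alpha> * \<alpha> k) = 0" "\<alpha> \<in> S"
  shows "c \<alpha> = 0"
proof -
  have "(\<Sum>\<alpha>\<in>S. (\<lambda>k. c \<alpha> * \<alpha> k)) = 0" using assms(3) by (auto simp: sum_fun_apply fun_eq_iff)
  then show ?thesis
    using wt.independentD[of S S c \<alpha>] assms unfolding lin_indep_def by blast
qed

text \<open>Independence by dual functionals, each of which is the sum of the coordinates in a set
  \<open>L \<alpha>\<close>; such functionals suffice for consecutive differences.\<close>

lemma lin_indep_dual:
  assumes "finite S" and dual: "\<And>\<alpha> \<beta>. \<alpha> \<in> S \<Longrightarrow> \<beta> \<in> S \<Longrightarrow> (\<Sum>k\<in>L \<alpha>. \<beta> k) = (if \<beta> = \<alpha> then 1 else 0)"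
  shows "lin_indep S"
  unfolding lin_indep_def
proof (rule wt.independent_if_scalars_zero[OF assms(1)])
  fix c \<alpha> assume z: "(\<Sum>\<beta>\<in>S. (\<lambda>k. c \<beta> * \<beta> k)) = 0" and \<alpha>: "\<alpha> \<in> S"
  have "0 = (\<Sum>k\<in>L \<alpha>. \<Sum>\<beta>\<in>S. c \<beta> * \<beta> k)"
    using fun_cong[OF z] by (simp add: sum_fun_apply)
  also have "\<dots> = (\<Sum>\<beta>\<in>S. c \<beta> * (\<Sum>k\<in>L \<alpha>. \<beta> k))" by (subst sum.swap) (simp add: sum_distrib_left)
  also have "\<dots> = (\<Sum>\<beta>\<in>S. if \<beta> = \<alpha> then c \<alpha> else 0)" using \<alpha> dual by (intro sum.cong) auto
  finally show "c \<alpha> = 0" using assms(1) \<alpha> by simp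
qed

lemma lin_indep_subset: "lin_indep S \<Longrightarrow> T \<subseteq> S \<Longrightarrow> lin_indep T"
  unfolding lin_indep_def using wt.dependent_mono by blast

lemma eps_ev: "1 \<le> i \<Longrightarrow> i \<le> m \<Longrightarrow> eps i = ev m (i - 1)"
  by (auto simp: eps_def ev_def crd_def)

lemma del_ev: "1 \<le> j \<Longrightarrow> del j = ev m (m + j - 1)"
  by (auto simp: del_def ev_def crd_def)

lemma ev_diff_eq_iff:
  assumes "a \<noteq> b"
  shows "ev m a - ev m b = ev m c - ev m d \<longleftrightarrow> a = c \<and> b = d"
proof
  assume eq: "ev m a - ev m b = ev m c - ev m d"
  from fun_cong[OF eq, of "crd m a"] fun_cong[OF eq, of "crd m b"] assms
  show "a = c \<and> b = d" by (auto split: if_splits)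
qed auto

lemma even_roots_ev:
  "even_roots m n = {ev m a - ev m b | a b. a < m + n \<and> b < m + n \<and> a \<noteq> b \<and> (a < m) = (b < m)}"
proof (intro equalityI subsetI)
  fix x assume "x \<in> even_roots m n"
  then consider i j where "x = eps i - eps j" "i \<in> {1..m}" "j \<in> {1..m}" "i \<noteq> j"
    | i j where "x = del i - del j" "i \<in> {1..n}" "j \<in> {1..n}" "i \<noteq> j"
    unfolding even_roots_def by blast
  then show "x \<in> {ev m a - ev m b | a b. a < m + n \<and> b < m + n \<and> a \<noteq> b \<and> (a < m) = (b < m)}"
  proof cases
    case 1
    then have "x = ev m (i - 1) - ev m (j - 1)" using eps_ev[of i m] eps_ev[of j m] by simp
    moreover have "i - 1 < m" "j - 1 < m" "i - 1 \<noteq> j - 1" "i - 1 < m + n" "j - 1 < m + n" using 1 by auto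
    ultimately show ?thesis by blast
  next
    case 2
    then have "x = ev m (m + i - 1) - ev m (m + j - 1)" using del_ev[of i m] del_ev[of j m] by simp
    moreover have "m + i - 1 < m + n" "m + j - 1 < m + n" "m + i - 1 \<noteq> m + j - 1" "\<not> m + i - 1 < m" "\<not> m + j - 1 < m"
      using 2 by auto
    ultimately show ?thesis by blast
  qed
next
  fix x assume "x \<in> {ev m a - ev m b | a b. a < m + n \<and> b < m + n \<and> a \<noteq> b \<and> (a < m) = (b < m)}"
  then obtain a b where x: "x = ev m a - ev m b" and ab: "a < m + n" "b < m + n" "a \<noteq> b" "(a < m) = (b < m)" by blast
  show "x \<in> even_roots m n"
  proof (cases "a < m")
    case True
    then have "x = eps (a + 1) - eps (b + 1)" "a + 1 \<in> {1..m}" "b + 1 \<in> {1..m}" "a + 1 \<noteq> b + 1"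
      using x ab eps_ev[of "a + 1" m] eps_ev[of "b + 1" m] by auto
    then show ?thesis unfolding even_roots_def by blast
  next
    case False
    then have "x = del (a - m + 1) - del (b - m + 1)" "a - m + 1 \<in> {1..n}" "b - m + 1 \<in> {1..n}" "a - m + 1 \<noteq> b - m + 1"
      using x ab del_ev[of "a - m + 1" m] del_ev[of "b - m + 1" m] by auto
    then show ?thesis unfolding even_roots_def by blast
  qed
qed

lemma odd_roots_ev:
  "odd_roots m n = {ev m a - ev m b | a b. a < m + n \<and> b < m + n \<and> a \<noteq> b \<and> (a < m) \<noteq> (b < m)}"
proof (intro equalityI subsetI)
  fix x assume "x \<in> odd_roots m n"
  then obtain i j where ij: "i \<in> {1..m}" "j \<in> {1..n}" "x = eps i - del j \<or> x = del j - eps i"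
    unfolding odd_roots_def by blast
  then consider "x = ev m (i - 1) - ev m (m + j - 1)" | "x = ev m (m + j - 1) - ev m (i - 1)"
    using eps_ev[of i m] del_ev[of j m] by auto
  moreover have "i - 1 < m" "\<not> m + j - 1 < m" "m + j - 1 < m + n" "i - 1 < m + n" "i - 1 \<noteq> m + j - 1"
    "m + j - 1 \<noteq> i - 1" using ij by auto
  ultimately show "x \<in> {ev m a - ev m b | a b. a < m + n \<and> b < m + n \<and> a \<noteq> b \<and> (a < m) \<noteq> (b < m)}" by cases blast+
next
  fix x assume "x \<in> {ev m a - ev m b | a b. a < m + n \<and> b < m + n \<and> a \<noteq> b \<and> (a < m) \<noteq> (b < m)}"
  then obtain a b where x: "x = ev m a - ev m b" and ab: "a < m + n" "b < m + n" "(a < m) \<noteq> (b < m)" by blast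
  show "x \<in> odd_roots m n"
  proof (cases "a < m")
    case True
    then have "x = eps (a + 1) - del (b - m + 1)" "a + 1 \<in> {1..m}" "b - m + 1 \<in> {1..n}"
      using x ab eps_ev[of "a + 1" m] del_ev[of "b - m + 1" m] by auto
    then show ?thesis unfolding odd_roots_def by blast
  next
    case False
    then have "x = del (a - m + 1) - eps (b + 1)" "b + 1 \<in> {1..m}" "a - m + 1 \<in> {1..n}"
      using x ab eps_ev[of "b + 1" m] del_ev[of "a - m + 1" m] by auto
    then show ?thesis unfolding odd_roots_def by blast
  qed
qed

lemma roots_ev: "roots m n = {ev m a - ev m b | a b. a < m + n \<and> b < m + n \<and> a \<noteq> b}"
  unfolding roots_def even_roots_ev odd_roots_ev by blast

lemma finite_roots: "finite (roots m n)"
proof -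
  have "roots m n \<subseteq> (\<lambda>(a,b). ev m a - ev m b) ` ({..<m+n} \<times> {..<m+n})"
    unfolding roots_ev by auto
  then show ?thesis by (rule finite_subset) simp
qed

section \<open>The base attached to a total order of the indices\<close>

definition order_base :: "nat \<Rightarrow> nat \<Rightarrow> (nat \<Rightarrow> nat) \<Rightarrow> weight set" where
  "order_base m n \<sigma> = {ev m (\<sigma> t) - ev m (\<sigma> (Suc t)) | t. Suc t < m + n}"

context
  fixes m n :: nat and \<sigma> :: "nat \<Rightarrow> nat"
  assumes \<sigma>: "bij_betw \<sigma> {..<m+n} {..<m+n}"
begin

lemma \<sigma>_lt: "t < m + n \<Longrightarrow> \<sigma> t < m + n"
  using \<sigma> by (auto simp: bij_betw_def)

lemma \<sigma>_eq: "s < m + n \<Longrightarrow> t < m + n \<Longrightarrow> \<sigma> s = \<sigma> t \<longleftrightarrow> s = t"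
  using \<sigma> by (auto simp: bij_betw_def inj_on_def)

text \<open>The sum of the coordinates at the first \<open>t + 1\<close> places of the order is the
  functional dual to the \<open>t\<close>-th simple root. It serves both for independence and for
  reading off coefficients.\<close>

lemma partial_sum:
  assumes "s < m + n" "t < m + n"
  shows "(\<Sum>k \<in> (\<lambda>r. crd m (\<sigma> r)) ` {..t}. ev m (\<sigma> s) k) = (if s \<le> t then 1 else 0)"
proof -
  have inj: "inj_on (\<lambda>r. crd m (\<sigma> r)) {..t}" using assms \<sigma>_eq by (auto simp: inj_on_def)
  have "(\<Sum>k \<in> (\<lambda>r. crd m (\<sigma> r)) ` {..t}. ev m (\<sigma> s) k) = (\<Sum>r\<le>t. if r = s then 1 else 0)"
    unfolding sum.reindex[OF inj] using assms \<sigma>_eq[of s] by (intro sum.cong) auto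
  then show ?thesis by simp
qed

lemma partial_sum_diff:
  assumes "s < m + n" "s' < m + n" "t < m + n"
  shows "(\<Sum>k \<in> (\<lambda>r. crd m (\<sigma> r)) ` {..t}. (ev m (\<sigma> s) - ev m (\<sigma> s')) k) =
    (if s \<le> t then 1 else 0) - (if s' \<le> t then 1 else 0)"
  using partial_sum[OF assms(1,3)] partial_sum[OF assms(2,3)] by (simp add: sum_subtractf)

lemma order_base_image: "order_base m n \<sigma> = (\<lambda>t. ev m (\<sigma> t) - ev m (\<sigma> (Suc t))) ` {t. Suc t < m + n}"
  by (auto simp: order_base_def)

lemma order_base_inj: "inj_on (\<lambda>t. ev m (\<sigma> t) - ev m (\<sigma> (Suc t))) {t. Suc t < m + n}"
proof (rule inj_onI)
  fix s t assume st: "s \<in> {t. Suc t < m + n}" "t \<in> {t. Suc t < m + n}"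
    "ev m (\<sigma> s) - ev m (\<sigma> (Suc s)) = ev m (\<sigma> t) - ev m (\<sigma> (Suc t))"
  have "\<sigma> s \<noteq> \<sigma> (Suc s)" using \<sigma>_eq[of s "Suc s"] st by auto
  from st(3)[unfolded ev_diff_eq_iff[OF this]] show "s = t" using \<sigma>_eq[of s t] st by auto
qed

lemma order_base_indep: "lin_indep (order_base m n \<sigma>)"
proof -
  let ?f = "\<lambda>t. ev m (\<sigma> t) - ev m (\<sigma> (Suc t))"
  define L where "L = (\<lambda>\<alpha>. (\<lambda>r. crd m (\<sigma> r)) ` {..the_inv_into {t. Suc t < m + n} ?f \<alpha>})"
  show ?thesis
  proof (rule lin_indep_dual[where L = L])
    show "finite (order_base m n \<sigma>)" unfolding order_base_image
      by (rule finite_imageI, rule finite_subset[of _ "{..<m+n}"]) auto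
    fix \<alpha> \<beta> assume "\<alpha> \<in> order_base m n \<sigma>" "\<beta> \<in> order_base m n \<sigma>"
    then obtain s t where st: "\<alpha> = ?f t" "\<beta> = ?f s" "Suc s < m + n" "Suc t < m + n"
      by (auto simp: order_base_def)
    have "L \<alpha> = (\<lambda>r. crd m (\<sigma> r)) ` {..t}"
      using st by (simp add: L_def the_inv_into_f_f[OF order_base_inj])
    then have "(\<Sum>k\<in>L \<alpha>. \<beta> k) = (if s \<le> t then 1 else 0) - (if Suc s \<le> t then 1 else 0)"
      using partial_sum_diff[of s "Suc s" t] st by simp
    also have "\<dots> = (if \<beta> = \<alpha> then 1 else 0)"
    proof (cases "s = t")
      case False
      then have "?f s \<noteq> ?f t" using inj_onD[OF order_base_inj, of s t] st by blast
      then show ?thesis using False st by simp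
    qed (use st in simp)
    finally show "(\<Sum>k\<in>L \<alpha>. \<beta> k) = (if \<beta> = \<alpha> then 1 else 0)" .
  qed
qed

text \<open>A telescoping sum over the simple roots from place \<open>s\<close> to place
  \<open>t\<close>; the coefficients are written as a function of the root since this is the form
  used in \<open>positive_roots\<close>.\<close>

lemma order_base_telescope:
  assumes "s \<le> t" "t < m + n"
  shows "(\<Sum>\<alpha>\<in>order_base m n \<sigma>. of_int (if \<exists>r. s \<le> r \<and> r < t \<and> \<alpha> = ev m (\<sigma> r) - ev m (\<sigma> (Suc r)) then 1 else 0) * \<alpha> k) =
    (ev m (\<sigma> s) - ev m (\<sigma> t)) k"
proof -
  let ?f = "\<lambda>t. ev m (\<sigma> t) - ev m (\<sigma> (Suc t))"
  have ex: "(\<exists>r'. s \<le> r' \<and> r' < t \<and> ?f r = ?f r') \<longleftrightarrow> s \<le> r \<and> r < t" if "Suc r < m + n" for r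
    using inj_onD[OF order_base_inj, of r] that assms(2) by (auto simp del: minus_apply)
  have "(\<Sum>\<alpha>\<in>order_base m n \<sigma>. of_int (if \<exists>r. s \<le> r \<and> r < t \<and> \<alpha> = ?f r then 1 else 0) * \<alpha> k) =
    (\<Sum>r | Suc r < m + n. if s \<le> r \<and> r < t then ?f r k else 0)"
    unfolding order_base_image sum.reindex[OF order_base_inj] o_def
    using ex by (intro sum.cong) (auto simp del: minus_apply)
  also have "\<dots> = (\<Sum>r\<in>{s..<t}. ?f r k)"
    using assms by (intro sum.mono_neutral_cong_right) (auto intro: finite_subset[of _ "{..<m+n}"])
  also have "\<dots> = ev m (\<sigma> s) k - ev m (\<sigma> t) k"
    using assms(1) by (induction t rule: dec_induct) auto
  finally show ?thesis by simp
qed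

lemma positive_order_base:
  "positive_roots m n (order_base m n \<sigma>) = {ev m (\<sigma> s) - ev m (\<sigma> t) | s t. s < t \<and> t < m + n}" (is "_ = ?P")
  and negative_order_base:
  "s < t \<Longrightarrow> t < m + n \<Longrightarrow> ev m (\<sigma> t) - ev m (\<sigma> s) \<in> negative_roots m n (order_base m n \<sigma>)"
proof -
  let ?f = "\<lambda>t. ev m (\<sigma> t) - ev m (\<sigma> (Suc t))"
  let ?c = "\<lambda>s t \<alpha>. if \<exists>r. s \<le> r \<and> r < t \<and> \<alpha> = ?f r then 1 else (0::int)"
  have root: "ev m (\<sigma> s) - ev m (\<sigma> t) \<in> roots m n" if "s < m + n" "t < m + n" "s \<noteq> t" for s t
    using that \<sigma>_lt \<sigma>_eq unfolding roots_ev by blast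
  show "ev m (\<sigma> t) - ev m (\<sigma> s) \<in> negative_roots m n (order_base m n \<sigma>)" if "s < t" "t < m + n" for s t
  proof -
    have "(\<Sum>\<alpha>\<in>order_base m n \<sigma>. of_int (- ?c s t \<alpha>) * \<alpha> k) = (ev m (\<sigma> t) - ev m (\<sigma> s)) k" for k
      using order_base_telescope[of s t k] that by (simp add: sum_negf)
    then show ?thesis unfolding negative_roots_def using root[of t s] that
      by (auto intro!: exI[of _ "\<lambda>\<alpha>. - ?c s t \<alpha>"] simp del: minus_apply)
  qed
  show "positive_roots m n (order_base m n \<sigma>) = ?P"
  proof (intro equalityI subsetI)
    fix x assume "x \<in> ?P"
    then obtain s t where st: "x = ev m (\<sigma> s) - ev m (\<sigma> t)" "s < t" "t < m + n" by blast
    then show "x \<in> positive_roots m n (order_base m n \<sigma>)"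
      unfolding positive_roots_def using root[of s t] order_base_telescope[of s t]
      by (auto intro!: exI[of _ "?c s t"] simp del: minus_apply)
  next
    fix x assume x: "x \<in> positive_roots m n (order_base m n \<sigma>)"
    then obtain a b where ab: "x = ev m a - ev m b" "a < m + n" "b < m + n" "a \<noteq> b"
      by (auto simp: positive_roots_def roots_ev)
    obtain c where c: "\<And>\<alpha>. \<alpha> \<in> order_base m n \<sigma> \<Longrightarrow> (0::int) \<le> c \<alpha>"
      and xc: "\<And>k. x k = (\<Sum>\<alpha>\<in>order_base m n \<sigma>. of_int (c \<alpha>) * \<alpha> k)"
      using x by (auto simp: positive_roots_def)
    have "a \<in> \<sigma> ` {..<m+n}" "b \<in> \<sigma> ` {..<m+n}" using ab \<sigma> by (auto simp: bij_betw_def)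
    then obtain s t where st: "a = \<sigma> s" "b = \<sigma> t" "s < m + n" "t < m + n" by auto
    have "s < t"
    proof (rule ccontr)
      assume "\<not> s < t"
      then have ts: "t < s" using st ab by (cases s t rule: linorder_cases) auto
      \<comment> \<open>The functional dual to the \<open>t\<close>-th simple root gives -1 on
        \<open>x\<close>, so that root would have the coefficient -1.\<close>
      let ?L = "(\<lambda>r. crd m (\<sigma> r)) ` {..t}"
      have "(\<Sum>k\<in>?L. x k) = - 1" using partial_sum_diff[OF st(3,4,4)] ts by (simp add: ab(1) st(1,2))
      moreover have "(\<Sum>k\<in>?L. x k) = (\<Sum>\<alpha>\<in>order_base m n \<sigma>. of_int (c \<alpha>) * (\<Sum>k\<in>?L. \<alpha> k))"
        unfolding xc by (subst sum.swap) (simp add: sum_distrib_left)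
      moreover have "(\<Sum>\<alpha>\<in>order_base m n \<sigma>. of_int (c \<alpha>) * (\<Sum>k\<in>?L. \<alpha> k)) = of_int (c (?f t))"
      proof -
        have t: "Suc t < m + n" using ts st by simp
        have "(\<Sum>\<alpha>\<in>order_base m n \<sigma>. of_int (c \<alpha>) * (\<Sum>k\<in>?L. \<alpha> k)) =
          (\<Sum>r | Suc r < m + n. of_int (c (?f r)) * (\<Sum>k\<in>?L. ?f r k))"
          unfolding order_base_image sum.reindex[OF order_base_inj] o_def ..
        also have "\<dots> = (\<Sum>r | Suc r < m + n. if r = t then of_int (c (?f t)) else 0)"
          using partial_sum_diff[OF _ _ st(4)] by (intro sum.cong) (auto simp del: minus_apply)
        finally show ?thesis using t by (subst (asm) sum.delta) (auto intro: finite_subset[of _ "{..<m+n}"])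
      qed
      ultimately have "of_int (c (?f t)) = (- 1 :: complex)" by simp
      then have "c (?f t) = - 1" by (metis of_int_1 of_int_eq_iff of_int_minus)
      moreover have "?f t \<in> order_base m n \<sigma>" using ts st unfolding order_base_def by auto
      ultimately show False using c[of "?f t"] by simp
    qed
    then show "x \<in> ?P" using ab st by blast
  qed
qed

lemma is_base_order_base: "is_base m n (order_base m n \<sigma>)"
  unfolding is_base_def
proof (intro conjI order_base_indep subsetI)
  fix x assume "x \<in> order_base m n \<sigma>"
  then obtain t where "x = ev m (\<sigma> t) - ev m (\<sigma> (Suc t))" "Suc t < m + n" by (auto simp: order_base_def)
  then show "x \<in> roots m n" unfolding roots_ev using \<sigma>_lt[of t] \<sigma>_lt[of "Suc t"] \<sigma>_eq[of t "Suc t"] by auto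
next
  fix x assume "x \<in> roots m n"
  then obtain a b where ab: "x = ev m a - ev m b" "a < m + n" "b < m + n" "a \<noteq> b" by (auto simp: roots_ev)
  have "a \<in> \<sigma> ` {..<m+n}" "b \<in> \<sigma> ` {..<m+n}" using ab \<sigma> by (auto simp: bij_betw_def)
  then obtain s t where st: "a = \<sigma> s" "b = \<sigma> t" "s < m + n" "t < m + n" by auto
  then show "x \<in> positive_roots m n (order_base m n \<sigma>) \<union> negative_roots m n (order_base m n \<sigma>)"
    using ab positive_order_base negative_order_base[of t s] by (cases s t rule: linorder_cases) auto
qed

end

text \<open>
  \<open>h i\<close> is the number of \<open>\<delta>\<close>'s that precede \<open>\<epsilon>\<^bsub>i+1\<^esub>\<close>; this is an order if \<open>h\<close> increases.
\<close>

definition shuffle :: "nat \<Rightarrow> nat \<Rightarrow> (nat \<Rightarrow> nat) \<Rightarrow> nat \<Rightarrow> nat \<Rightarrow> bool" where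
  "shuffle m n h a b \<longleftrightarrow> a < m + n \<and> b < m + n \<and>
     (if a < m then if b < m then a < b else h a \<le> b - m
      else if b < m then a - m < h b else a < b)"

section \<open>Bases with the prescribed even part as shuffles\<close>

lemma shuffle_total: "a < m + n \<Longrightarrow> b < m + n \<Longrightarrow> a = b \<or> shuffle m n h a b \<or> shuffle m n h b a"
  by (auto simp: shuffle_def)

lemma shuffle_irrefl: "\<not> shuffle m n h a a"
  by (auto simp: shuffle_def)

lemma shuffle_trans:
  assumes mono: "\<And>i j. i \<le> j \<Longrightarrow> j < m \<Longrightarrow> h i \<le> h j"
    and ab: "shuffle m n h a b" and bc: "shuffle m n h b c"
  shows "shuffle m n h a c"
proof -
  have "a < c" if "a < m" "h a < h c" using mono[of c a] that by linarith
  then show ?thesis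
    using ab bc mono[of a b] mono[of b c] mono[of a c] unfolding shuffle_def by (auto split: if_splits)
qed

text \<open>Positivity of \<open>ev m a - ev m b\<close> is a strict total order on the indices.
  Totality is the definition of a base and transitivity adds coefficients; for antisymmetry, two
  nonnegative combinations with sum zero have zero coefficients by independence.\<close>

lemma base_order:
  assumes \<Sigma>: "is_base m n \<Sigma>"
  shows base_antisym: "\<And>a b. ev m a - ev m b \<in> positive_roots m n \<Sigma> \<Longrightarrow> ev m b - ev m a \<in> positive_roots m n \<Sigma> \<Longrightarrow> False"
    and base_total: "\<And>a b. a < m + n \<Longrightarrow> b < m + n \<Longrightarrow> a \<noteq> b \<Longrightarrow>
      ev m a - ev m b \<in> positive_roots m n \<Sigma> \<or> ev m b - ev m a \<in> positive_roots m n \<Sigma>"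
    and base_trans: "\<And>a b c. ev m a - ev m b \<in> positive_roots m n \<Sigma> \<Longrightarrow> ev m b - ev m c \<in> positive_roots m n \<Sigma> \<Longrightarrow>
      a < m + n \<Longrightarrow> c < m + n \<Longrightarrow> ev m a - ev m c \<in> positive_roots m n \<Sigma>"
proof -
  have fin: "finite \<Sigma>" and indep: "lin_indep \<Sigma>" using \<Sigma> finite_roots finite_subset by (auto simp: is_base_def)
  have ne: "a \<noteq> b" if "ev m a - ev m b \<in> roots m n" for a b
  proof
    assume "a = b"
    then have "0 \<in> roots m n" using that by simp
    then obtain c d where "(0::weight) = ev m c - ev m d" "c \<noteq> d" unfolding roots_ev by blast
    from fun_cong[OF this(1), of "crd m c"] this(2) show False by simp
  qed
  have expand: "\<exists>c. (\<forall>\<alpha>\<in>\<Sigma>. (0::int) \<le> c \<alpha>) \<and> (\<forall>k. \<beta> k = (\<Sum>\<alpha>\<in>\<Sigma>. of_int (c \<alpha>) * \<alpha> k))"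
    if "\<beta> \<in> positive_roots m n \<Sigma>" for \<beta>
    using that by (auto simp: positive_roots_def)
  show antisym: False if P: "ev m a - ev m b \<in> positive_roots m n \<Sigma>" "ev m b - ev m a \<in> positive_roots m n \<Sigma>" for a b
  proof -
    obtain c where c: "\<forall>\<alpha>\<in>\<Sigma>. (0::int) \<le> c \<alpha>" "\<forall>k. (ev m a - ev m b) k = (\<Sum>\<alpha>\<in>\<Sigma>. of_int (c \<alpha>) * \<alpha> k)"
      using expand[OF P(1)] by blast
    obtain d where d: "\<forall>\<alpha>\<in>\<Sigma>. (0::int) \<le> d \<alpha>" "\<forall>k. (ev m b - ev m a) k = (\<Sum>\<alpha>\<in>\<Sigma>. of_int (d \<alpha>) * \<alpha> k)"
      using expand[OF P(2)] by blast
    have "(\<Sum>\<alpha>\<in>\<Sigma>. of_int (c \<alpha> + d \<alpha>) * \<alpha> k) = (ev m a - ev m b) k + (ev m b - ev m a) k" for k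
      using c(2) d(2) by (simp add: distrib_right sum.distrib)
    then have "(\<Sum>\<alpha>\<in>\<Sigma>. of_int (c \<alpha> + d \<alpha>) * \<alpha> k) = 0" for k by simp
    from lin_indep_zero[OF indep fin this] have "c \<alpha> + d \<alpha> = 0" if "\<alpha> \<in> \<Sigma>" for \<alpha>
      using that by (metis of_int_eq_0_iff)
    then have "c \<alpha> = 0" if "\<alpha> \<in> \<Sigma>" for \<alpha> using c(1) d(1) that by (metis add_nonneg_eq_0_iff)
    then have "(\<Sum>\<alpha>\<in>\<Sigma>. of_int (c \<alpha>) * \<alpha> (crd m a)) = 0" by (intro sum.neutral) auto
    then have "(ev m a - ev m b) (crd m a) = 0" using c(2) by metis
    moreover have "a \<noteq> b" using ne P(1) by (simp add: positive_roots_def)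
    ultimately show False by simp
  qed
  show "ev m a - ev m b \<in> positive_roots m n \<Sigma> \<or> ev m b - ev m a \<in> positive_roots m n \<Sigma>"
    if ab: "a < m + n" "b < m + n" "a \<noteq> b" for a b
  proof -
    have "ev m a - ev m b \<in> roots m n" "ev m b - ev m a \<in> roots m n" using ab by (auto simp: roots_ev)
    moreover have "ev m b - ev m a \<in> positive_roots m n \<Sigma>"
      if neg: "ev m a - ev m b \<in> negative_roots m n \<Sigma>" and r: "ev m b - ev m a \<in> roots m n"
    proof -
      obtain c where c: "\<forall>\<alpha>\<in>\<Sigma>. c \<alpha> \<le> (0::int)" "ev m a - ev m b = (\<lambda>k. \<Sum>\<alpha>\<in>\<Sigma>. of_int (c \<alpha>) * \<alpha> k)"
        using neg by (auto simp: negative_roots_def)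
      have "ev m b - ev m a = - (ev m a - ev m b)" by simp
      also have "\<dots> = (\<lambda>k. \<Sum>\<alpha>\<in>\<Sigma>. of_int (- c \<alpha>) * \<alpha> k)"
        unfolding c(2) by (auto simp: fun_eq_iff sum_negf)
      finally show ?thesis using c(1) r unfolding positive_roots_def by (auto intro!: exI[of _ "\<lambda>\<alpha>. - c \<alpha>"])
    qed
    ultimately show ?thesis using \<Sigma> unfolding is_base_def by blast
  qed
  show "ev m a - ev m c \<in> positive_roots m n \<Sigma>"
    if P: "ev m a - ev m b \<in> positive_roots m n \<Sigma>" "ev m b - ev m c \<in> positive_roots m n \<Sigma>"
      and ac: "a < m + n" "c < m + n" for a b c
  proof -
    obtain u where u: "\<forall>\<alpha>\<in>\<Sigma>. (0::int) \<le> u \<alpha>" "\<forall>k. (ev m a - ev m b) k = (\<Sum>\<alpha>\<in>\<Sigma>. of_int (u \<alpha>) * \<alpha> k)"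
      using expand[OF P(1)] by blast
    obtain v where v: "\<forall>\<alpha>\<in>\<Sigma>. (0::int) \<le> v \<alpha>" "\<forall>k. (ev m b - ev m c) k = (\<Sum>\<alpha>\<in>\<Sigma>. of_int (v \<alpha>) * \<alpha> k)"
      using expand[OF P(2)] by blast
    have "a \<noteq> c" using antisym P by blast
    then have "ev m a - ev m c \<in> roots m n" using ac by (auto simp: roots_ev)
    moreover have "(\<Sum>\<alpha>\<in>\<Sigma>. of_int (u \<alpha> + v \<alpha>) * \<alpha> k) = (ev m a - ev m b) k + (ev m b - ev m c) k" for k
      using u(2) v(2) by (simp add: distrib_right sum.distrib)
    ultimately show ?thesis using u(1) v(1) unfolding positive_roots_def
      by (auto intro!: exI[of _ "\<lambda>\<alpha>. u \<alpha> + v \<alpha>"] simp: fun_eq_iff simp del: of_int_add)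
  qed
qed

text \<open>The prescribed even roots fix the order among the \<epsilon>'s and among the \<delta>'s,
  and the order of a base is total, so only the interleaving remains. By transitivity the \<delta>'s
  before a given \<epsilon> form an initial segment, hence their number determines them.\<close>

lemma bases_shuffle:
  assumes \<Sigma>: "\<Sigma> \<in> bases m n"
  obtains h where "\<And>i j. i \<le> j \<Longrightarrow> j < m \<Longrightarrow> h i \<le> h j" "\<And>i. h i \<le> n"
    "positive_roots m n \<Sigma> = pos_of m n (shuffle m n h)"
proof -
  let ?P = "positive_roots m n \<Sigma>"
  have base: "is_base m n \<Sigma>" and even: "?P \<inter> even_roots m n =
       {eps i - eps j | i j. 1 \<le> i \<and> i < j \<and> j \<le> m} \<union> {del i - del j | i j. 1 \<le> i \<and> i < j \<and> j \<le> n}"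
    using \<Sigma> by (auto simp: bases_def)
  note anti = base_antisym[OF base] and total = base_total[OF base] and trans = base_trans[OF base]
  have eps: "ev m a - ev m b \<in> ?P" if "a < b" "b < m" for a b
  proof -
    have "ev m a - ev m b = eps (a + 1) - eps (b + 1)" using that eps_ev[of "a + 1" m] eps_ev[of "b + 1" m] by simp
    moreover have "1 \<le> a + 1 \<and> a + 1 < b + 1 \<and> b + 1 \<le> m" using that by simp
    ultimately show ?thesis using even by blast
  qed
  have del: "ev m (m + a) - ev m (m + b) \<in> ?P" if "a < b" "b < n" for a b
  proof -
    have "ev m (m + a) - ev m (m + b) = del (a + 1) - del (b + 1)"
      using that del_ev[of "a + 1" m] del_ev[of "b + 1" m] by simp
    moreover have "1 \<le> a + 1 \<and> a + 1 < b + 1 \<and> b + 1 \<le> n" using that by simp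
    ultimately show ?thesis using even by blast
  qed
  define h where "h = (\<lambda>i. card {j. j < n \<and> ev m (m + j) - ev m i \<in> ?P})"
  have hn: "h i \<le> n" for i
  proof -
    have "h i \<le> card {..<n}" unfolding h_def by (rule card_mono) auto
    then show ?thesis by simp
  qed
  have down: "ev m (m + j') - ev m i \<in> ?P" if "ev m (m + j) - ev m i \<in> ?P" "j' \<le> j" "j < n" "i < m" for i j j'
  proof (cases "j' = j")
    case False
    then show ?thesis using trans[OF del[of j' j] that(1)] that by simp
  qed (use that in simp)
  have h: "ev m (m + j) - ev m i \<in> ?P \<longleftrightarrow> j < h i" if ij: "i < m" "j < n" for i j
  proof
    assume "ev m (m + j) - ev m i \<in> ?P"
    then have "{..j} \<subseteq> {j. j < n \<and> ev m (m + j) - ev m i \<in> ?P}" using down ij by auto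
    then have "card {..j} \<le> h i" unfolding h_def by (rule card_mono[rotated]) simp
    then show "j < h i" by simp
  next
    assume j: "j < h i"
    show "ev m (m + j) - ev m i \<in> ?P"
    proof (rule ccontr)
      assume no: "ev m (m + j) - ev m i \<notin> ?P"
      have "{j. j < n \<and> ev m (m + j) - ev m i \<in> ?P} \<subseteq> {..<j}"
        using no down[of _ i j] ij by (auto simp: not_less[symmetric])
      then have "h i \<le> card {..<j}" unfolding h_def by (rule card_mono[rotated]) simp
      then show False using j by simp
    qed
  qed
  have mono: "h i \<le> h j" if "i \<le> j" "j < m" for i j
  proof (cases "i = j")
    case False
    show ?thesis unfolding h_def
    proof (rule card_mono)
      show "{k. k < n \<and> ev m (m + k) - ev m i \<in> ?P} \<subseteq> {k. k < n \<and> ev m (m + k) - ev m j \<in> ?P}"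
        using trans[OF _ eps[of i j]] that False by auto
    qed simp
  qed simp
  have prec: "ev m a - ev m b \<in> ?P \<longleftrightarrow> shuffle m n h a b" if ab: "a < m + n" "b < m + n" for a b
  proof (cases "a = b")
    case True
    then show ?thesis using anti[of a b] shuffle_irrefl by blast
  next
    case False
    have imp: "ev m a - ev m b \<in> ?P" if "shuffle m n h a b" "a < m + n" "b < m + n" for a b
    proof (cases "a < m"; cases "b < m")
      assume "a < m" "b < m"
      then show ?thesis using that eps by (simp add: shuffle_def)
    next
      assume c: "a < m" "\<not> b < m"
      then have "\<not> b - m < h a" "b - m < n" "m + (b - m) = b" using that by (auto simp: shuffle_def)
      then have "ev m b - ev m a \<notin> ?P" using h[of a "b - m"] c by simp
      then show ?thesis using total[of a b] that c by auto
    next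
      assume c: "\<not> a < m" "b < m"
      then have "a - m < h b" "a - m < n" "m + (a - m) = a" using that by (auto simp: shuffle_def)
      then show ?thesis using h[of b "a - m"] c by simp
    next
      assume c: "\<not> a < m" "\<not> b < m"
      then have "a - m < b - m" "b - m < n" using that by (auto simp: shuffle_def)
      from del[OF this] show ?thesis using c by simp
    qed
    show ?thesis using imp[of a b] imp[of b a] anti[of a b] shuffle_total[OF ab, of h] ab False by blast
  qed
  have "?P = pos_of m n (shuffle m n h)"
  proof (intro equalityI subsetI)
    fix x assume x: "x \<in> ?P"
    then obtain a b where "x = ev m a - ev m b" "a < m + n" "b < m + n" by (auto simp: positive_roots_def roots_ev)
    moreover from this have "shuffle m n h a b" using prec[of a b] x by simp
    ultimately show "x \<in> pos_of m n (shuffle m n h)" unfolding pos_of_def by blast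
  next
    fix x assume "x \<in> pos_of m n (shuffle m n h)"
    then obtain a b where "x = ev m a - ev m b" "a < m + n" "b < m + n" "shuffle m n h a b" by (auto simp: pos_of_def)
    then show "x \<in> ?P" using prec[of a b] by simp
  qed
  then show ?thesis using that mono hn by blast
qed

lemma positive_order_base_shuffle:
  assumes \<sigma>: "bij_betw \<sigma> {..<m+n} {..<m+n}"
    and sh: "\<And>s t. s < t \<Longrightarrow> t < m + n \<Longrightarrow> shuffle m n h (\<sigma> s) (\<sigma> t)"
    and mono: "\<And>i j. i \<le> j \<Longrightarrow> j < m \<Longrightarrow> h i \<le> h j"
  shows "positive_roots m n (order_base m n \<sigma>) = pos_of m n (shuffle m n h)"
  unfolding positive_order_base[OF \<sigma>]
proof (intro equalityI subsetI)
  fix x assume "x \<in> {ev m (\<sigma> s) - ev m (\<sigma> t) | s t. s < t \<and> t < m + n}"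
  then obtain s t where "x = ev m (\<sigma> s) - ev m (\<sigma> t)" "s < t" "t < m + n" by blast
  moreover from this have "shuffle m n h (\<sigma> s) (\<sigma> t)" using sh by blast
  moreover from this have "\<sigma> s < m + n" "\<sigma> t < m + n" by (simp_all add: shuffle_def)
  ultimately show "x \<in> pos_of m n (shuffle m n h)" unfolding pos_of_def by blast
next
  fix x assume "x \<in> pos_of m n (shuffle m n h)"
  then obtain a b where ab: "x = ev m a - ev m b" "a < m + n" "b < m + n" "shuffle m n h a b"
    by (auto simp: pos_of_def)
  have "a \<in> \<sigma> ` {..<m+n}" "b \<in> \<sigma> ` {..<m+n}" using ab \<sigma> by (auto simp: bij_betw_def)
  then obtain s t where st: "a = \<sigma> s" "b = \<sigma> t" "s < m + n" "t < m + n" by auto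
  have "s < t"
  proof (rule ccontr)
    assume "\<not> s < t"
    then have "s = t \<or> shuffle m n h (\<sigma> t) (\<sigma> s)" using sh[of t s] st by linarith
    then show False using ab(4) shuffle_trans[of m h n a b a, OF mono] shuffle_irrefl st by metis
  qed
  then show "x \<in> {ev m (\<sigma> s) - ev m (\<sigma> t) | s t. s < t \<and> t < m + n}" using ab st by blast
qed

lemma order_base_in_bases:
  assumes \<sigma>: "bij_betw \<sigma> {..<m+n} {..<m+n}"
    and sh: "\<And>s t. s < t \<Longrightarrow> t < m + n \<Longrightarrow> shuffle m n h (\<sigma> s) (\<sigma> t)"
    and mono: "\<And>i j. i \<le> j \<Longrightarrow> j < m \<Longrightarrow> h i \<le> h j"
  shows "order_base m n \<sigma> \<in> bases m n"
proof -
  have P: "positive_roots m n (order_base m n \<sigma>) = pos_of m n (shuffle m n h)"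
    by (rule positive_order_base_shuffle[OF \<sigma>]) (use sh mono in blast)+
  have "positive_roots m n (order_base m n \<sigma>) \<inter> even_roots m n =
      {ev m a - ev m b | a b. a < b \<and> b < m + n \<and> (a < m) = (b < m)}" (is "?L = ?R")
  proof (intro equalityI subsetI)
    fix x assume x: "x \<in> ?L"
    then have "x \<in> pos_of m n (shuffle m n h)" "x \<in> even_roots m n" using P by simp_all
    then obtain a b c d where ab: "x = ev m a - ev m b" "a < m + n" "b < m + n" "shuffle m n h a b"
      and "x = ev m c - ev m d" "c \<noteq> d" "(c < m) = (d < m)"
      unfolding pos_of_def even_roots_ev mem_Collect_eq by metis
    then have "(a < m) = (b < m)" using ev_diff_eq_iff[of c d m a b] ab(1) by auto
    moreover from this have "a < b" using ab(4) by (auto simp: shuffle_def split: if_splits)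
    ultimately show "x \<in> ?R" using ab by blast
  next
    fix x assume "x \<in> ?R"
    then obtain a b where ab: "x = ev m a - ev m b" "a < b" "b < m + n" "(a < m) = (b < m)" by blast
    then have "shuffle m n h a b" by (auto simp: shuffle_def)
    moreover have "a < m + n" "a \<noteq> b" using ab by auto
    ultimately have "x \<in> pos_of m n (shuffle m n h)" "x \<in> even_roots m n"
      using ab unfolding pos_of_def even_roots_ev by blast+
    then show "x \<in> ?L" using P by simp
  qed
  also have "\<dots> = {eps i - eps j | i j. 1 \<le> i \<and> i < j \<and> j \<le> m} \<union> {del i - del j | i j. 1 \<le> i \<and> i < j \<and> j \<le> n}" (is "_ = ?S")
  proof (intro equalityI subsetI)
    fix x assume "x \<in> ?R"
    then obtain a b where ab: "x = ev m a - ev m b" "a < b" "b < m + n" "(a < m) = (b < m)" by blast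
    show "x \<in> ?S"
    proof (cases "a < m")
      case True
      then have "x = eps (a + 1) - eps (b + 1)" "1 \<le> a + 1 \<and> a + 1 < b + 1 \<and> b + 1 \<le> m"
        using ab eps_ev[of "a + 1" m] eps_ev[of "b + 1" m] by auto
      then show ?thesis by blast
    next
      case False
      then have "x = del (a - m + 1) - del (b - m + 1)" "1 \<le> a - m + 1 \<and> a - m + 1 < b - m + 1 \<and> b - m + 1 \<le> n"
        using ab del_ev[of "a - m + 1" m] del_ev[of "b - m + 1" m] by auto
      then show ?thesis by blast
    qed
  next
    fix x assume "x \<in> ?S"
    then consider i j where "x = eps i - eps j" "1 \<le> i" "i < j" "j \<le> m" | i j where "x = del i - del j" "1 \<le> i" "i < j" "j \<le> n"
      by blast
    then show "x \<in> ?R"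
    proof cases
      case 1
      then have "x = ev m (i - 1) - ev m (j - 1)" "i - 1 < j - 1" "j - 1 < m + n" "(i - 1 < m) = (j - 1 < m)"
        using eps_ev[of i m] eps_ev[of j m] by auto
      then show ?thesis by blast
    next
      case 2
      then have "x = ev m (m + i - 1) - ev m (m + j - 1)" "m + i - 1 < m + j - 1" "m + j - 1 < m + n"
        "(m + i - 1 < m) = (m + j - 1 < m)"
        using del_ev[of i m] del_ev[of j m] by auto
      then show ?thesis by blast
    qed
  qed
  finally show ?thesis using is_base_order_base[OF \<sigma>] by (simp add: bases_def)
qed

section \<open>Weyl vectors and odd reflections in coordinates\<close>

lemma sum_pos_of:
  assumes irr: "\<And>a. \<not> prec a a" and k: "k < m + n"
  shows "(\<Sum>\<alpha> \<in> pos_of m n prec \<inter> {ev m a - ev m b | a b. a < m + n \<and> b < m + n \<and> a \<noteq> b \<and> Q a b}. \<alpha> (crd m k)) =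
    of_nat (card {b. b < m + n \<and> prec k b \<and> Q k b}) - of_nat (card {a. a < m + n \<and> prec a k \<and> Q a k})"
proof -
  let ?A = "{(a, b). a < m + n \<and> b < m + n \<and> prec a b \<and> Q a b}"
  have fin: "finite ?A" by (rule finite_subset[of _ "{..<m+n} \<times> {..<m+n}"]) auto
  have inj: "inj_on (\<lambda>(a,b). ev m a - ev m b) ?A"
    using irr by (auto simp: inj_on_def ev_diff_eq_iff) (metis ev_diff_eq_iff)+
  have "pos_of m n prec \<inter> {ev m a - ev m b | a b. a < m + n \<and> b < m + n \<and> a \<noteq> b \<and> Q a b} =
      (\<lambda>(a,b). ev m a - ev m b) ` ?A" (is "?L = ?R")
  proof (intro equalityI subsetI)
    fix x assume x: "x \<in> ?L"
    then obtain a b where ab: "x = ev m a - ev m b" "a < m + n" "b < m + n" "prec a b" by (auto simp: pos_of_def)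
    obtain c d where cd: "x = ev m c - ev m d" "c \<noteq> d" "Q c d" using x by blast
    have "c = a \<and> d = b" using ev_diff_eq_iff[OF cd(2), of m a b] ab(1) cd(1) by simp
    then show "x \<in> ?R" using ab cd by auto
  next
    fix x assume "x \<in> ?R"
    then obtain a b where "x = ev m a - ev m b" "a < m + n" "b < m + n" "prec a b" "Q a b" by auto
    moreover from this have "a \<noteq> b" using irr by auto
    ultimately show "x \<in> ?L" unfolding pos_of_def by blast
  qed
  \<comment> \<open>A root starting at \<open>k\<close> contributes 1 to this coordinate and a root
    ending at \<open>k\<close> contributes -1.\<close>
  then have "(\<Sum>\<alpha> \<in> ?L. \<alpha> (crd m k)) = (\<Sum>(a,b)\<in>?A. (if a = k then 1 else 0) - (if b = k then 1 else 0))"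
    unfolding \<open>?L = ?R\<close> sum.reindex[OF inj] o_def by (intro sum.cong) auto
  also have "\<dots> = (\<Sum>r\<in>?A. if fst r = k then 1 else 0) - (\<Sum>r\<in>?A. if snd r = k then 1 else 0)"
    by (simp add: case_prod_unfold sum_subtractf)
  also have "(\<Sum>r\<in>?A. if fst r = k then 1 else 0) = (\<Sum>r\<in>{r\<in>?A. fst r = k}. 1)"
    by (rule sum.inter_filter[OF fin, symmetric])
  also have "\<dots> = of_nat (card {b. b < m + n \<and> prec k b \<and> Q k b})"
  proof -
    have "{r\<in>?A. fst r = k} = Pair k ` {b. b < m + n \<and> prec k b \<and> Q k b}" using k by auto
    then show ?thesis by (simp add: card_image inj_on_def)
  qed
  also have "(\<Sum>r\<in>?A. if snd r = k then 1 else 0) = (\<Sum>r\<in>{r\<in>?A. snd r = k}. 1)"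
    by (rule sum.inter_filter[OF fin, symmetric])
  also have "\<dots> = of_nat (card {a. a < m + n \<and> prec a k \<and> Q a k})"
  proof -
    have "{r\<in>?A. snd r = k} = (\<lambda>a. (a, k)) ` {a. a < m + n \<and> prec a k \<and> Q a k}" using k by auto
    then show ?thesis by (simp add: card_image inj_on_def)
  qed
  finally show ?thesis .
qed


text \<open>The coordinates of \<open>rho\<close> for \<open>m = n\<close>, including the shift by
  one half. In terms of the partition, \<open>h k\<close> is a row length, and the cardinality in
  the second case is a column length: the number of \<epsilon>'s after the given \<delta>.\<close>

definition srho :: "nat \<Rightarrow> (nat \<Rightarrow> nat) \<Rightarrow> nat \<Rightarrow> int" where
  "srho n h k = (if k < n then int (h k) - int k
     else 2 * int n - 1 - int k - int (card {i. i < n \<and> k - n < h i}))"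

lemma rho_shuffle:
  assumes P: "positive_roots n n \<Sigma> = pos_of n n (shuffle n n h)" and hn: "\<And>i. h i \<le> n" and k: "k < n + n"
  shows "rho n n \<Sigma> (crd n k) = of_int (srho n h k)"
proof -
  let ?p = "shuffle n n h"
  have e: "(\<Sum>\<alpha> \<in> positive_roots n n \<Sigma> \<inter> even_roots n n. \<alpha> (crd n k)) =
    of_nat (card {b. b < n + n \<and> ?p k b \<and> (k < n) = (b < n)}) - of_nat (card {a. a < n + n \<and> ?p a k \<and> (a < n) = (k < n)})"
    unfolding P even_roots_ev using sum_pos_of[where prec = "shuffle n n h" and Q = "\<lambda>a b. (a < n) = (b < n)", OF shuffle_irrefl k] by simp
  have o: "(\<Sum>\<alpha> \<in> positive_roots n n \<Sigma> \<inter> odd_roots n n. \<alpha> (crd n k)) =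
    of_nat (card {b. b < n + n \<and> ?p k b \<and> (k < n) \<noteq> (b < n)}) - of_nat (card {a. a < n + n \<and> ?p a k \<and> (a < n) \<noteq> (k < n)})"
    unfolding P odd_roots_ev using sum_pos_of[where prec = "shuffle n n h" and Q = "\<lambda>a b. (a < n) \<noteq> (b < n)", OF shuffle_irrefl k] by simp
  have s: "(\<Sum>i = 1..n. eps i (crd n k)) - (\<Sum>j = 1..n. del j (crd n k)) = (if k < n then 1 else - 1)"
  proof (cases "k < n")
    case True
    have "(\<Sum>i = 1..n. eps i (crd n k)) = (\<Sum>i = 1..n. if i = k + 1 then 1 else 0)"
      using True by (intro sum.cong) (auto simp: eps_def crd_def)
    moreover have "(\<Sum>j = 1..n. del j (crd n k)) = 0"
      using True by (intro sum.neutral) (auto simp: del_def crd_def)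
    ultimately show ?thesis using True by simp
  next
    case False
    have "(\<Sum>j = 1..n. del j (crd n k)) = (\<Sum>j = 1..n. if j = k - n + 1 then 1 else 0)"
      using False by (intro sum.cong) (auto simp: del_def crd_def)
    moreover have "(\<Sum>i = 1..n. eps i (crd n k)) = 0"
      using False by (intro sum.neutral) (auto simp: eps_def crd_def)
    ultimately show ?thesis using False k by simp
  qed
  have r: "rho n n \<Sigma> (crd n k) = (of_nat (card {b. b < n + n \<and> ?p k b \<and> (k < n) = (b < n)}) -
      of_nat (card {a. a < n + n \<and> ?p a k \<and> (a < n) = (k < n)})) / 2 -
      (of_nat (card {b. b < n + n \<and> ?p k b \<and> (k < n) \<noteq> (b < n)}) -
       of_nat (card {a. a < n + n \<and> ?p a k \<and> (a < n) \<noteq> (k < n)})) / 2 + 1 / 2 * (if k < n then 1 else - 1)"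
    unfolding rho_def e o s by simp
  show ?thesis
  proof (cases "k < n")
    case True
    have 1: "{b. b < n + n \<and> ?p k b \<and> (k < n) = (b < n)} = {k<..<n}"
      "{a. a < n + n \<and> ?p a k \<and> (a < n) = (k < n)} = {..<k}"
      "{b. b < n + n \<and> ?p k b \<and> (k < n) \<noteq> (b < n)} = {n + h k..<n + n}"
      "{a. a < n + n \<and> ?p a k \<and> (a < n) \<noteq> (k < n)} = {n..<n + h k}"
      using True hn[of k] by (auto simp: shuffle_def)
    show ?thesis unfolding r 1 using True hn[of k] by (simp add: srho_def of_nat_diff field_simps)
  next
    case False
    have 1: "{b. b < n + n \<and> ?p k b \<and> (k < n) = (b < n)} = {k<..<n + n}"
      "{a. a < n + n \<and> ?p a k \<and> (a < n) = (k < n)} = {n..<k}"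
      "{b. b < n + n \<and> ?p k b \<and> (k < n) \<noteq> (b < n)} = {i. i < n \<and> k - n < h i}"
      "{a. a < n + n \<and> ?p a k \<and> (a < n) \<noteq> (k < n)} = {..<n} - {i. i < n \<and> k - n < h i}"
      using False k by (auto simp: shuffle_def)
    have sub: "{i. i < n \<and> k - n < h i} \<subseteq> {..<n}" by auto
    then have 2: "card ({..<n} - {i. i < n \<and> k - n < h i}) = n - card {i. i < n \<and> k - n < h i}"
      "card {i. i < n \<and> k - n < h i} \<le> n"
      using card_mono[OF _ sub] by (simp_all add: card_Diff_subset finite_subset[OF sub])
    show ?thesis unfolding r 1 2(1) using False k 2(2) by (simp add: srho_def of_nat_diff field_simps)
  qed
qed

text \<open>
  The pair \<open>(a, c)\<close> stands for the weight with coordinates \<open>(a\<^sub>1 \<dots> | - c\<^sub>1 \<dots>)\<close>.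
\<close>

definition coord :: "nat \<Rightarrow> int list \<times> int list \<Rightarrow> nat \<Rightarrow> int" where
  "coord n s k = (if k < n then fst s ! k else - (snd s ! (k - n)))"

definition refl_step :: "nat \<Rightarrow> nat \<Rightarrow> int list \<times> int list \<Rightarrow> int list \<times> int list" where
  "refl_step i j s = (if fst s ! i = snd s ! j then ((fst s)[i := fst s ! i + 1], (snd s)[j := snd s ! j + 1]) else s)"

text \<open>The state \<open>s\<close> is the shifted weight, so \<open>srho\<close> is subtracted
  to get the weight itself. All modules are quantified over because \<open>hw_at\<close> does not
  single one out.\<close>

definition reaches :: "nat \<Rightarrow> weight \<Rightarrow> (nat \<Rightarrow> nat) \<Rightarrow> int list \<times> int list \<Rightarrow> bool" where
  "reaches n lam h s \<longleftrightarrow> length (fst s) = n \<and> length (snd s) = n \<and>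
     (\<forall>p q R v. is_simple_module n n p q R \<longrightarrow> hwv n n p q R (<) lam v \<longrightarrow>
       (\<exists>\<mu> w. hwv n n p q R (shuffle n n h) \<mu> w \<and>
          (\<forall>k<n+n. \<mu> (crd n k) = of_int (coord n s k - srho n h k))))"

lemma hwv_cong:
  assumes "\<And>a b. a < m + n \<Longrightarrow> b < m + n \<Longrightarrow> prec a b = prec' a b"
    and "\<And>k. k < m + n \<Longrightarrow> \<mu> (crd m k) = \<mu>' (crd m k)"
  shows "hwv m n p q R prec \<mu> v = hwv m n p q R prec' \<mu>' v"
  using assms unfolding hwv_def by auto

text \<open>Adding a box adds the reflected root to \<open>rho\<close>. The highest weight loses
  this root unless it is orthogonal to it; so the shifted weight stays put in general and grows by
  the root in the orthogonal case. The hypothesis \<open>above\<close> says that the box is addable,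
  that is, that the root is simple.\<close>

lemma reaches_step:
  assumes s: "reaches n lam h s"
    and mono: "\<And>i j. i \<le> j \<Longrightarrow> j < n \<Longrightarrow> h i \<le> h j"
    and i: "i < n" "h i < n" and above: "\<And>i'. i < i' \<Longrightarrow> i' < n \<Longrightarrow> h i < h i'"
  shows "reaches n lam (h(i := Suc (h i))) (refl_step i (h i) s)"
proof -
  define j h' where "j = h i" and "h' = h(i := Suc (h i))"
  let ?l = "n + j"
  have len: "length (fst s) = n" "length (snd s) = n" using s by (auto simp: reaches_def)
  have up: "i < x" if "h i < h x" for x using mono[of x i] i that by (meson leD leI)
  have g: "{i'. i' < n \<and> j < h i'} = {i<..<n}"
    using up above by (auto simp: j_def)
  have g': "{i'. i' < n \<and> j < h' i'} = {i..<n}"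
    using up above i by (auto simp: j_def h'_def less_imp_le less_SucI)
  have g_other: "{i'. i' < n \<and> j' < h' i'} = {i'. i' < n \<and> j' < h i'}" if "j' \<noteq> j" for j'
    using that by (auto simp: h'_def j_def)
  \<comment> \<open>The Weyl vector is orthogonal to an isotropic simple root, so orthogonality may
    be tested on the shifted weight.\<close>
  have rho_sum: "srho n h i + srho n h ?l = 0"
    using i g by (simp add: srho_def j_def of_nat_diff)
  have rho': "srho n h' k = srho n h k + (if k = i then 1 else if k = ?l then - 1 else 0)" if "k < n + n" for k
  proof (cases "k < n")
    case True
    then show ?thesis using i by (simp add: srho_def h'_def j_def)
  next
    case False
    then show ?thesis using i g g' g_other[of "k - n"] that
      by (cases "k = ?l") (auto simp: srho_def of_nat_diff)
  qed
  have swap: "(\<lambda>a b. a = ?l \<and> b = i \<or> shuffle n n h a b \<and> \<not> (a = i \<and> b = ?l)) a b = shuffle n n h' a b"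
    if "a < n + n" "b < n + n" for a b
    using i that by (auto simp: shuffle_def h'_def j_def)
  have coord': "coord n (refl_step i j s) k = coord n s k +
      (if fst s ! i = snd s ! j then if k = i then 1 else if k = ?l then - 1 else 0 else 0)" if "k < n + n" for k
    using i that len by (auto simp: coord_def refl_step_def nth_list_update j_def)
  have "\<exists>\<mu> w. hwv n n p q R (shuffle n n h') \<mu> w \<and>
          (\<forall>k<n+n. \<mu> (crd n k) = of_int (coord n (refl_step i j s) k - srho n h' k))"
    if simple: "is_simple_module n n p q R" and v: "hwv n n p q R (<) lam v" for p q R v
  proof -
    interpret glmod n n p q R using simple by unfold_locales (simp add: is_simple_module_def)
    obtain \<mu> w where w: "hwv n n p q R (shuffle n n h) \<mu> w"
      and \<mu>: "\<And>k. k < n + n \<Longrightarrow> \<mu> (crd n k) = of_int (coord n s k - srho n h k)"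
      using s simple v unfolding reaches_def by blast
    have lt: "i < n + n" "?l < n + n" using i by (auto simp: j_def)
    have "\<mu> (crd n i) + \<mu> (crd n ?l) = of_int (coord n s i + coord n s ?l - (srho n h i + srho n h ?l))"
      using \<mu> lt by simp
    then have sum: "\<mu> (crd n i) + \<mu> (crd n ?l) = 0 \<longleftrightarrow> fst s ! i = snd s ! j"
      unfolding rho_sum using i by (simp add: coord_def del: of_int_add of_int_diff)
    have odd: "if \<mu> (crd n i) + \<mu> (crd n ?l) = 0
      then hwv n n p q R (\<lambda>a b. a = ?l \<and> b = i \<or> shuffle n n h a b \<and> \<not> (a = i \<and> b = ?l)) \<mu> w
      else hwv n n p q R (\<lambda>a b. a = ?l \<and> b = i \<or> shuffle n n h a b \<and> \<not> (a = i \<and> b = ?l))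
        (\<mu> - (ev n i - ev n ?l)) (R (munit (n + n) ?l i) *\<^sub>v w)"
    proof (rule odd_reflection[OF simple w shuffle_total _ shuffle_irrefl lt])
      show "shuffle n n h a c" if "shuffle n n h a b" "shuffle n n h b c" for a b c
        using shuffle_trans[OF mono that] by blast
      show "shuffle n n h i ?l" using i lt by (simp add: shuffle_def j_def)
      show "mpar n i ?l = 1" using i by (simp add: mpar_def)
      \<comment> \<open>Later \<epsilon>'s have more than \<open>j\<close> \<delta>'s before them
        and so come after this one, and the \<delta>'s with a smaller index already precede the
        \<epsilon>.\<close>
      show "\<not> (shuffle n n h i z \<and> shuffle n n h z ?l)" for z
        using i above[of z] by (auto simp: shuffle_def j_def split: if_splits)
    qed
    have eqv: "hwv n n p q R (\<lambda>a b. a = ?l \<and> b = i \<or> shuffle n n h a b \<and> \<not> (a = i \<and> b = ?l)) \<nu> y =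
        hwv n n p q R (shuffle n n h') \<nu> y" for \<nu> y
      by (rule hwv_cong[OF swap refl])
    show ?thesis
    proof (cases "fst s ! i = snd s ! j")
      case True
      then have "hwv n n p q R (shuffle n n h') \<mu> w"
        using odd sum unfolding eqv by simp
      then show ?thesis using True \<mu> coord' rho' by (intro exI[of _ \<mu>] exI[of _ w]) auto
    next
      case False
      then have "hwv n n p q R (shuffle n n h') (\<mu> - (ev n i - ev n ?l)) (R (munit (n + n) ?l i) *\<^sub>v w)"
        using odd sum unfolding eqv by simp
      moreover have "(\<mu> - (ev n i - ev n ?l)) (crd n k) = of_int (coord n (refl_step i j s) k - srho n h' k)"
        if "k < n + n" for k
        using False \<mu>[OF that] coord'[OF that] rho'[OF that] i by auto
      ultimately show ?thesis by blast
    qed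
  qed
  moreover have "length (fst (refl_step i j s)) = n" "length (snd (refl_step i j s)) = n"
    using len by (auto simp: refl_step_def)
  ultimately show ?thesis unfolding reaches_def h'_def j_def by blast
qed

definition refl_row :: "nat \<Rightarrow> nat \<Rightarrow> int list \<times> int list \<Rightarrow> int list \<times> int list" where
  "refl_row i r s = foldl (\<lambda>s j. refl_step i j s) s [0..<r]"

text \<open>Rows are filled from the largest index down: the rows up to \<open>i\<close> are still
  empty and the later ones have length at least \<open>r\<close>, so each intermediate
  \<open>h\<close> is increasing and each box is addable.\<close>

lemma reaches_row:
  assumes s: "reaches n lam h s" and i: "i < n" and r: "r \<le> n"
    and below: "\<And>i'. i' \<le> i \<Longrightarrow> h i' = 0" and above: "\<And>i'. i < i' \<Longrightarrow> i' < n \<Longrightarrow> r \<le> h i'"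
    and mono: "\<And>i j. i \<le> j \<Longrightarrow> j < n \<Longrightarrow> h i \<le> h j"
  shows "reaches n lam (h(i := r)) (refl_row i r s)"
  using r above
proof (induction r)
  case 0
  have "h(i := 0) = h" using below[of i] by auto
  then show ?case using s by (simp add: refl_row_def)
next
  case (Suc r)
  have IH: "reaches n lam (h(i := r)) (refl_row i r s)"
  proof (rule Suc.IH)
    show "r \<le> h i'" if "i < i'" "i' < n" for i' using Suc.prems(2)[OF that] by simp
  qed (use Suc.prems in simp)
  have "reaches n lam ((h(i := r))(i := Suc ((h(i := r)) i))) (refl_step i ((h(i := r)) i) (refl_row i r s))"
  proof (rule reaches_step[OF IH _ i])
    show "(h(i := r)) a \<le> (h(i := r)) b" if "a \<le> b" "b < n" for a b
    proof (cases "b = i")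
      case True
      then show ?thesis using below[of a] that by simp
    next
      case False
      show ?thesis
      proof (cases "a = i")
        case True
        then have "Suc r \<le> h b" using Suc.prems(2)[of b] that False by simp
        then show ?thesis using True False by simp
      next
        case ai: False
        then show ?thesis using False mono[OF that] by simp
      qed
    qed
    show "(h(i := r)) i < n" using Suc by simp
    show "(h(i := r)) i < (h(i := r)) i'" if "i < i'" "i' < n" for i' using Suc.prems(2)[OF that] that by simp
  qed
  moreover have "refl_row i (Suc r) s = refl_step i r (refl_row i r s)" by (simp add: refl_row_def)
  ultimately show ?case by (simp only: fun_upd_upd fun_upd_same)
qed

section \<open>Orthogonal roots and common subsequences\<close>

text \<open>The length of a longest common subsequence; only the upper bound for chains is proved,
  while lower bounds come from explicit chains.\<close>

fun lcs :: "int list \<Rightarrow> int list \<Rightarrow> nat" where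
  "lcs [] ys = 0"
| "lcs xs [] = 0"
| "lcs (x # xs) (y # ys) = (if x = y then Suc (lcs xs ys) else max (lcs xs (y # ys)) (lcs (x # xs) ys))"

definition is_chain :: "int list \<Rightarrow> int list \<Rightarrow> (nat \<times> nat) set \<Rightarrow> bool" where
  "is_chain xs ys C \<longleftrightarrow> (\<forall>(i, j) \<in> C. i < length xs \<and> j < length ys \<and> xs ! i = ys ! j) \<and>
     (\<forall>(i, j) \<in> C. \<forall>(i', j') \<in> C. (i, j) = (i', j') \<or> i < i' \<and> j < j' \<or> i' < i \<and> j' < j)"

lemma is_chain_finite: "is_chain xs ys C \<Longrightarrow> finite C"
  by (rule finite_subset[of _ "{..<length xs} \<times> {..<length ys}"]) (auto simp: is_chain_def)

lemma is_chain_subset: "is_chain xs ys C \<Longrightarrow> C' \<subseteq> C \<Longrightarrow> is_chain xs ys C'"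
  unfolding is_chain_def by blast

text \<open>The functions \<open>f1\<close> and \<open>f2\<close> merely express that all pairs lie
  beyond the first \<open>a\<close> rows and the first \<open>b\<close> columns, so that these can
  be cut off.\<close>

lemma is_chain_shift:
  assumes C: "is_chain xs ys C"
    and f: "\<And>i j. (i, j) \<in> C \<Longrightarrow> (i, j) = (a + f1 i, b + f2 j)"
    and a: "drop a xs = xs'" "drop b ys = ys'"
  shows "\<exists>C'. is_chain xs' ys' C' \<and> card C' = card C"
proof (intro exI conjI)
  let ?C = "(\<lambda>(i, j). (i - a, j - b)) ` C"
  have ge: "a \<le> i \<and> b \<le> j" if "(i, j) \<in> C" for i j using f[OF that] by auto
  show "card ?C = card C"
  proof (rule card_image, rule inj_onI, clarsimp)
    fix i j i' j' assume "(i, j) \<in> C" "(i', j') \<in> C" "i - a = i' - a" "j - b = j' - b"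
    then show "i = i' \<and> j = j'" using ge[of i j] ge[of i' j'] by auto
  qed
  have "(i - a, j - b) = (i' - a, j' - b) \<or> i - a < i' - a \<and> j - b < j' - b \<or> i' - a < i - a \<and> j' - b < j - b"
    if "(i, j) \<in> C" "(i', j') \<in> C" for i j i' j'
  proof -
    have "(i, j) = (i', j') \<or> i < i' \<and> j < j' \<or> i' < i \<and> j' < j" using C that unfolding is_chain_def by blast
    then show ?thesis using ge[OF that(1)] ge[OF that(2)] by auto
  qed
  moreover have "i - a < length xs' \<and> j - b < length ys' \<and> xs' ! (i - a) = ys' ! (j - b)" if "(i, j) \<in> C" for i j
  proof -
    have "i < length xs" "j < length ys" "xs ! i = ys ! j" using C that by (auto simp: is_chain_def)
    then show ?thesis using ge[OF that] unfolding a[symmetric] by auto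
  qed
  ultimately show "is_chain xs' ys' ?C" unfolding is_chain_def by (auto simp del: prod.inject)
qed

lemma card_chain_le_lcs: "is_chain xs ys C \<Longrightarrow> card C \<le> lcs xs ys"
proof (induction xs ys arbitrary: C rule: lcs.induct)
  case (1 ys)
  then have "C = {}" by (auto simp: is_chain_def)
  then show ?case by simp
next
  case (2 x xs)
  then have "C = {}" by (auto simp: is_chain_def)
  then show ?case by simp
next
  case (3 x xs y ys)
  have cmp: "(i, j) = (i', j') \<or> i < i' \<and> j < j' \<or> i' < i \<and> j' < j" if "(i, j) \<in> C" "(i', j') \<in> C" for i j i' j'
    using 3(4) that unfolding is_chain_def by blast
  show ?case
  proof (cases "x = y")
    case True
    let ?B = "{r \<in> C. fst r = 0 \<or> snd r = 0}"
    have "\<exists>C'. is_chain xs ys C' \<and> card C' = card (C - ?B)"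
    proof (rule is_chain_shift[OF is_chain_subset[OF 3(4)]])
      show "(i, j) = (1 + (i - 1), 1 + (j - 1))" if "(i, j) \<in> C - ?B" for i j using that by auto
    qed auto
    then have le: "card (C - ?B) \<le> lcs xs ys" using 3(1)[OF True] by metis
    have "card ?B \<le> 1"
    proof (rule card_le_Suc0_iff_eq[THEN iffD2, unfolded One_nat_def[symmetric]])
      show "finite ?B" using is_chain_finite[OF 3(4)] by simp
      show "\<forall>r\<in>?B. \<forall>s\<in>?B. r = s" using cmp by fastforce
    qed
    moreover have "card C = card ?B + card (C - ?B)"
      using card_Un_disjoint[of ?B "C - ?B"] is_chain_finite[OF 3(4)] by (simp add: Un_absorb1)
    ultimately show ?thesis using le True by simp
  next
    case False
    show ?thesis
    proof (cases "\<exists>j. (0, j) \<in> C")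
      case ex: True
      then obtain j0 where j0: "(0, j0) \<in> C" by blast
      then have "(x # xs) ! 0 = (y # ys) ! j0" using 3(4) unfolding is_chain_def by blast
      then have "j0 \<noteq> 0" using False by (cases j0) auto
      then have "j \<noteq> 0" if "(i, j) \<in> C" for i j using cmp[OF j0 that] by auto
      then have "\<exists>C'. is_chain (x # xs) ys C' \<and> card C' = card C"
        by (intro is_chain_shift[OF 3(4), of 0 "\<lambda>i. i" 1 "\<lambda>j. j - 1"]) auto
      then show ?thesis using 3(3)[OF False] False by (metis lcs.simps(3) le_max_iff_disj)
    next
      case nex: False
      then have "i \<noteq> 0" if "(i, j) \<in> C" for i j using that by (cases i) auto
      then have "\<exists>C'. is_chain xs (y # ys) C' \<and> card C' = card C"
        by (intro is_chain_shift[OF 3(4), of 1 "\<lambda>i. i - 1" 0 "\<lambda>j. j"]) auto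
      then show ?thesis using 3(2)[OF False] False by (metis lcs.simps(3) le_max_iff_disj)
    qed
  qed
qed

section \<open>Orthogonal odd simple roots as non-crossing pairs\<close>

lemma form_ev_diff:
  assumes "a < m + n" "b < m + n"
  shows "form m n (ev m a - ev m b) \<mu> =
    (if a < m then 1 else - 1) * \<mu> (crd m a) - (if b < m then 1 else - 1) * \<mu> (crd m b)"
proof -
  have "form m n (ev m a - ev m b) \<mu> = (\<Sum>k<m+n. (if k < m then 1 else - 1) * ((ev m a - ev m b) (crd m k) * \<mu> (crd m k)))"
  proof -
    let ?g = "\<lambda>z. (ev m a - ev m b) z * \<mu> z"
    have 1: "(\<Sum>i = 1..m. (if i - 1 < m then 1 else - 1) * ?g (int i)) = (\<Sum>i = 1..m. ?g (int i))"
      by (intro sum.cong) auto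
    have 2: "(\<Sum>j = 1..n. (if m + j - 1 < m then 1 else - 1) * ?g (- int j)) = - (\<Sum>j = 1..n. ?g (- int j))"
      unfolding sum_negf[symmetric] by (intro sum.cong) auto
    show ?thesis unfolding form_def
      using sum_crd[of "\<lambda>k z. (if k < m then 1 else - 1) * ?g z" m n] unfolding 1 2 by simp
  qed
  also have "\<dots> = (\<Sum>k<m+n. (if k = a then (if a < m then 1 else - 1) * \<mu> (crd m a) else 0) -
      (if k = b then (if b < m then 1 else - 1) * \<mu> (crd m b) else 0))"
    by (intro sum.cong) auto
  finally show ?thesis using assms by (simp add: sum_subtractf)
qed

text \<open>An element of a base is indecomposable: if it were a sum of two positive roots,
  independence would make their nonnegative integer coefficients add up to a single 1, so one
  summand would be zero.\<close>

lemma base_adjacent: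
  assumes base: "is_base m n \<Sigma>" and mem: "ev m a - ev m b \<in> \<Sigma>"
  shows "ev m a - ev m b \<in> positive_roots m n \<Sigma>"
    and "ev m a - ev m c \<in> positive_roots m n \<Sigma> \<Longrightarrow> ev m c - ev m b \<in> positive_roots m n \<Sigma> \<Longrightarrow> False"
proof -
  have fin: "finite \<Sigma>" and indep: "lin_indep \<Sigma>" and sub: "\<Sigma> \<subseteq> roots m n"
    using base finite_roots finite_subset by (auto simp: is_base_def)
  let ?\<alpha> = "ev m a - ev m b"
  have single: "(\<Sum>\<beta>\<in>\<Sigma>. of_int (if \<beta> = ?\<alpha> then 1 else 0) * \<beta> k) = ?\<alpha> k" for k
  proof -
    have "(\<Sum>\<beta>\<in>\<Sigma>. of_int (if \<beta> = ?\<alpha> then 1 else 0) * \<beta> k) = (\<Sum>\<beta>\<in>\<Sigma>. if \<beta> = ?\<alpha> then ?\<alpha> k else 0)"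
      by (intro sum.cong) (auto simp del: minus_apply)
    then show ?thesis using fin mem by (simp del: minus_apply)
  qed
  show "?\<alpha> \<in> positive_roots m n \<Sigma>"
  proof -
    have "?\<alpha> = (\<lambda>k. \<Sum>\<beta>\<in>\<Sigma>. of_int (if \<beta> = ?\<alpha> then 1 else 0) * \<beta> k)"
      by (rule ext) (rule single[symmetric])
    moreover have "\<forall>\<beta>\<in>\<Sigma>. (0::int) \<le> (if \<beta> = ?\<alpha> then 1 else 0)" by simp
    ultimately have "\<exists>c::weight \<Rightarrow> int. (\<forall>\<beta>\<in>\<Sigma>. 0 \<le> c \<beta>) \<and> ?\<alpha> = (\<lambda>k. \<Sum>\<beta>\<in>\<Sigma>. of_int (c \<beta>) * \<beta> k)"
      by (intro exI[of _ "\<lambda>\<beta>. if \<beta> = ?\<alpha> then 1 else 0"] conjI)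
    then show ?thesis using subsetD[OF sub mem] by (simp only: positive_roots_def mem_Collect_eq)
  qed
  show False if P: "ev m a - ev m c \<in> positive_roots m n \<Sigma>" "ev m c - ev m b \<in> positive_roots m n \<Sigma>"
  proof -
    obtain u where u: "\<And>\<beta>. \<beta> \<in> \<Sigma> \<Longrightarrow> (0::int) \<le> u \<beta>" "ev m a - ev m c = (\<lambda>k. \<Sum>\<beta>\<in>\<Sigma>. of_int (u \<beta>) * \<beta> k)"
      using P(1) unfolding positive_roots_def by blast
    obtain v where v: "\<And>\<beta>. \<beta> \<in> \<Sigma> \<Longrightarrow> (0::int) \<le> v \<beta>" "ev m c - ev m b = (\<lambda>k. \<Sum>\<beta>\<in>\<Sigma>. of_int (v \<beta>) * \<beta> k)"
      using P(2) unfolding positive_roots_def by blast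
    have comb: "(\<Sum>\<beta>\<in>\<Sigma>. of_int (u \<beta> + v \<beta> - (if \<beta> = ?\<alpha> then 1 else 0)) * \<beta> k) = 0" for k
    proof -
      have "(\<Sum>\<beta>\<in>\<Sigma>. of_int (u \<beta> + v \<beta> - (if \<beta> = ?\<alpha> then 1 else 0)) * \<beta> k) =
        (\<Sum>\<beta>\<in>\<Sigma>. of_int (u \<beta>) * \<beta> k) + (\<Sum>\<beta>\<in>\<Sigma>. of_int (v \<beta>) * \<beta> k) -
        (\<Sum>\<beta>\<in>\<Sigma>. of_int (if \<beta> = ?\<alpha> then 1 else 0) * \<beta> k)"
        by (simp only: of_int_add of_int_diff left_diff_distrib distrib_right sum.distrib sum_subtractf)
      then show ?thesis unfolding single fun_cong[OF u(2), symmetric] fun_cong[OF v(2), symmetric] by simp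
    qed
    have sum: "u \<beta> + v \<beta> = (if \<beta> = ?\<alpha> then 1 else 0)" if \<beta>: "\<beta> \<in> \<Sigma>" for \<beta>
    proof -
      have "of_int (u \<beta> + v \<beta> - (if \<beta> = ?\<alpha> then 1 else 0)) = (0::complex)"
        by (rule lin_indep_zero[OF indep fin comb \<beta>])
      then have "u \<beta> + v \<beta> - (if \<beta> = ?\<alpha> then 1 else 0) = 0" unfolding of_int_eq_0_iff .
      then show ?thesis by linarith
    qed
    have nz: "x \<noteq> y" if "ev m x - ev m y \<in> positive_roots m n \<Sigma>" for x y
      using base_antisym[OF base that] that by metis
    have zero: False if z: "\<And>\<beta>. \<beta> \<in> \<Sigma> \<Longrightarrow> w \<beta> = (0::int)" "ev m x - ev m y = (\<lambda>k. \<Sum>\<beta>\<in>\<Sigma>. of_int (w \<beta>) * \<beta> k)" "x \<noteq> y" for w x y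
    proof -
      have "(\<Sum>\<beta>\<in>\<Sigma>. of_int (w \<beta>) * \<beta> (crd m x)) = (0::complex)" using z(1) by (intro sum.neutral) auto
      then show False using fun_cong[OF z(2), of "crd m x"] z(3) by simp
    qed
    have "u ?\<alpha> = 0 \<or> v ?\<alpha> = 0" using sum[OF mem] u(1)[OF mem] v(1)[OF mem] by simp linarith
    then show False
    proof
      assume "u ?\<alpha> = 0"
      then have "u \<beta> = 0" if "\<beta> \<in> \<Sigma>" for \<beta> using sum[OF that] u(1)[OF that] v(1)[OF that] by (cases "\<beta> = ?\<alpha>") auto
      then show False using zero[of u] u(2) nz[OF P(1)] by blast
    next
      assume "v ?\<alpha> = 0"
      then have "v \<beta> = 0" if "\<beta> \<in> \<Sigma>" for \<beta> using sum[OF that] u(1)[OF that] v(1)[OF that] by (cases "\<beta> = ?\<alpha>") auto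
      then show False using zero[of v] v(2) nz[OF P(2)] by blast
    qed
  qed
qed

text \<open>Elements of a base join neighbours in the order. If the first \<epsilon> came before
  \<delta> number \<open>j'\<close>, then this \<delta> would separate it from \<delta> number
  \<open>j\<close>. So \<delta> number \<open>j'\<close> comes first, and the first \<epsilon>
  separates it from the second one.\<close>

lemma base_non_crossing:
  assumes \<Sigma>: "\<Sigma> \<in> bases m n"
    and \<alpha>: "ev m i - ev m (m + j) \<in> \<Sigma> \<or> ev m (m + j) - ev m i \<in> \<Sigma>"
    and \<beta>: "ev m i' - ev m (m + j') \<in> \<Sigma> \<or> ev m (m + j') - ev m i' \<in> \<Sigma>"
    and ii: "i < i'" "i' < m" and jj: "j' < j" "j < n"
  shows False
proof -
  have base: "is_base m n \<Sigma>" using \<Sigma> by (simp add: bases_def)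
  obtain h where P: "positive_roots m n \<Sigma> = pos_of m n (shuffle m n h)"
    and mono: "\<And>i j. i \<le> j \<Longrightarrow> j < m \<Longrightarrow> h i \<le> h j" by (rule bases_shuffle[OF \<Sigma>]) blast
  have pos: "ev m a - ev m b \<in> positive_roots m n \<Sigma>" if "shuffle m n h a b" for a b
  proof -
    have "a < m + n" "b < m + n" using that by (simp_all add: shuffle_def)
    then show ?thesis using that unfolding P pos_of_def by blast
  qed
  have adj: "\<not> (shuffle m n h a c \<and> shuffle m n h c b)" if "ev m a - ev m b \<in> \<Sigma>" for a b c
    using base_adjacent(2)[OF base that] pos by blast
  have pos': "shuffle m n h a b" if "ev m a - ev m b \<in> \<Sigma>" "a \<noteq> b" for a b
    using base_adjacent(1)[OF base that(1)] ev_diff_eq_iff[OF that(2)] unfolding P pos_of_def by auto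
  have 1: "shuffle m n h i i'" "shuffle m n h (m + j') (m + j)" using ii jj by (auto simp: shuffle_def)
  have tr: "shuffle m n h a c" if "shuffle m n h a b" "shuffle m n h b c" for a b c
    by (rule shuffle_trans[where h = h and b = b]) (use mono that in blast)+
  have before: "shuffle m n h (m + j') i"
  proof (rule ccontr)
    assume no: "\<not> shuffle m n h (m + j') i"
    then have "shuffle m n h i (m + j')" using shuffle_total[of i m n "m + j'" h] ii jj by auto
    moreover from this have "shuffle m n h i (m + j)" using tr 1 by blast
    moreover have "\<not> shuffle m n h (m + j) i" using tr[OF _ calculation(2)] shuffle_irrefl by blast
    ultimately show False using \<alpha> adj pos' ii 1 by (metis not_add_less1 less_trans)
  qed
  have "shuffle m n h (m + j') i'" using tr before 1 by blast
  then have "ev m (m + j') - ev m i' \<in> \<Sigma>"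
    using \<beta> pos'[of i' "m + j'"] tr[of i' "m + j'" i'] shuffle_irrefl ii by (metis not_add_less1)
  then show False using adj before 1 by blast
qed


definition orthogonal_roots :: "nat \<Rightarrow> nat \<Rightarrow> weight \<Rightarrow> weight set \<Rightarrow> bool" where
  "orthogonal_roots m n \<nu> S \<longleftrightarrow> S \<subseteq> odd_roots m n \<and> lin_indep S \<and>
     (\<forall>\<alpha>\<in>S. \<forall>\<beta>\<in>S. form m n \<alpha> \<beta> = 0) \<and> (\<forall>\<alpha>\<in>S. form m n \<alpha> \<nu> = 0) \<and>
     (\<exists>\<Sigma>' \<in> bases m n. S \<subseteq> \<Sigma>')"

lemma s_num_eq: "s_num m n \<nu> = Max (card ` {S. orthogonal_roots m n \<nu> S})"
  unfolding s_num_def orthogonal_roots_def by (rule arg_cong[of _ _ Max]) blast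

lemma finite_orthogonal_roots: "finite {S. orthogonal_roots m n \<nu> S}"
proof -
  have "{S. orthogonal_roots m n \<nu> S} \<subseteq> Pow (roots m n)" by (auto simp: orthogonal_roots_def roots_def)
  then show ?thesis using finite_roots by (meson finite_Pow_iff finite_subset)
qed

lemma s_num_ge: "orthogonal_roots m n \<nu> S \<Longrightarrow> card S \<le> s_num m n \<nu>"
  unfolding s_num_eq using finite_orthogonal_roots by (intro Max_ge) auto

lemma s_num_le:
  assumes "bases m n \<noteq> {}" and "\<And>S. orthogonal_roots m n \<nu> S \<Longrightarrow> card S \<le> b"
  shows "s_num m n \<nu> \<le> b"
proof -
  \<comment> \<open>The empty set is admissible once some base exists, so the maximum is taken over
    a nonempty set.\<close>
  have "lin_indep {}" by (simp add: lin_indep_def wt.independent_empty)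
  then have "orthogonal_roots m n \<nu> {}" using assms(1) by (auto simp: orthogonal_roots_def)
  then show ?thesis unfolding s_num_eq using finite_orthogonal_roots assms(2) by (intro Max.boundedI) auto
qed

text \<open>Each root gives a pair \<open>(i, j)\<close> regardless of its sign. Orthogonality to
  the weight means equal entries, mutual orthogonality means that no two pairs share just one index,
  and simplicity in a common base excludes crossings; so the pairs form a chain.\<close>

lemma orthogonal_roots_le_lcs:
  assumes S: "orthogonal_roots n n \<nu> S"
    and \<nu>: "\<And>k. k < n + n \<Longrightarrow> \<nu> (crd n k) = of_int (coord n s k)"
    and len: "length (fst s) = n" "length (snd s) = n"
  shows "card S \<le> lcs (fst s) (snd s)"
proof -
  obtain \<Sigma> where \<Sigma>: "\<Sigma> \<in> bases n n" "S \<subseteq> \<Sigma>" using S by (auto simp: orthogonal_roots_def)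
  have base: "is_base n n \<Sigma>" using \<Sigma> by (simp add: bases_def)
  let ?r = "\<lambda>i j \<alpha>. i < n \<and> j < n \<and> (\<alpha> = ev n i - ev n (n + j) \<or> \<alpha> = ev n (n + j) - ev n i)"
  define C where "C = {(i, j). \<exists>\<alpha>\<in>S. ?r i j \<alpha>}"
  have "\<exists>r. ?r (fst r) (snd r) \<alpha>" if "\<alpha> \<in> S" for \<alpha>
  proof -
    have "\<alpha> \<in> odd_roots n n" using that S unfolding orthogonal_roots_def by blast
    then obtain a b where ab: "\<alpha> = ev n a - ev n b" "a < n + n" "b < n + n" "(a < n) \<noteq> (b < n)"
      unfolding odd_roots_ev by blast
    show ?thesis
    proof (cases "a < n")
      case True
      then have "b = n + (b - n)" "b - n < n" using ab by auto
      then show ?thesis using True ab(1) by (intro exI[of _ "(a, b - n)"]) simp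
    next
      case False
      then have "a = n + (a - n)" "a - n < n" "b < n" using ab by auto
      then show ?thesis using ab(1) by (intro exI[of _ "(b, a - n)"]) simp
    qed
  qed
  then obtain pr where pr: "\<And>\<alpha>. \<alpha> \<in> S \<Longrightarrow> ?r (fst (pr \<alpha>)) (snd (pr \<alpha>)) \<alpha>" by metis
  \<comment> \<open>A base does not contain a root together with its negative, so forgetting the
    sign loses nothing.\<close>
  have opp: "False" if "\<alpha> \<in> S" "\<beta> \<in> S" "\<alpha> = ev n a - ev n b" "\<beta> = ev n b - ev n a" for \<alpha> \<beta> a b
    using that \<Sigma>(2) base_adjacent(1)[OF base] base_antisym[OF base] by blast
  have eq: "\<alpha> = \<beta>" if "\<alpha> \<in> S" "\<beta> \<in> S" "?r i j \<alpha>" "?r i j \<beta>" for \<alpha> \<beta> i j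
    using that opp[OF that(1,2)] opp[OF that(2,1)] by metis
  have form0: "form n n \<alpha> \<beta> = 0" if "\<alpha> \<in> S" "\<beta> \<in> S" for \<alpha> \<beta> using S that by (simp add: orthogonal_roots_def)
  have form_val: "form n n \<alpha> \<mu> = 0 \<Longrightarrow> \<mu> (crd n i) + \<mu> (crd n (n + j)) = 0" if "?r i j \<alpha>" for \<alpha> i j \<mu>
  proof -
    have "form n n (ev n i - ev n (n + j)) \<mu> = \<mu> (crd n i) + \<mu> (crd n (n + j))"
      "form n n (ev n (n + j) - ev n i) \<mu> = - (\<mu> (crd n i) + \<mu> (crd n (n + j)))"
      using that form_ev_diff[of i n n "n + j" \<mu>] form_ev_diff[of "n + j" n n i \<mu>] by auto
    then show "form n n \<alpha> \<mu> = 0 \<Longrightarrow> \<mu> (crd n i) + \<mu> (crd n (n + j)) = 0" using that by (metis neg_equal_0_iff_equal)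
  qed
  \<comment> \<open>The pairing of two such roots is, up to sign, the difference of the indicators
    of \<open>i = i'\<close> and \<open>j = j'\<close>.\<close>
  have orth: "i = i' \<longleftrightarrow> j = j'" if "\<alpha> \<in> S" "\<beta> \<in> S" "?r i j \<alpha>" "?r i' j' \<beta>" for \<alpha> \<beta> i j i' j'
  proof -
    have "\<beta> (crd n i) + \<beta> (crd n (n + j)) = 0" using form_val[OF that(3) form0[OF that(1,2)]] .
    then show ?thesis using that(3,4) by (auto split: if_splits)
  qed
  have cross: False if "\<alpha> \<in> S" "\<beta> \<in> S" "?r i j \<alpha>" "?r i' j' \<beta>" "i < i'" "j' < j" for \<alpha> \<beta> i j i' j'
  proof (rule base_non_crossing[OF \<Sigma>(1) _ _ that(5) _ that(6)])
    show "ev n i - ev n (n + j) \<in> \<Sigma> \<or> ev n (n + j) - ev n i \<in> \<Sigma>" using that(1,3) \<Sigma>(2) by blast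
    show "ev n i' - ev n (n + j') \<in> \<Sigma> \<or> ev n (n + j') - ev n i' \<in> \<Sigma>" using that(2,4) \<Sigma>(2) by blast
  qed (use that in auto)
  have "inj_on pr S" by (rule inj_onI) (metis eq pr)
  moreover have "pr ` S \<subseteq> C"
  proof (rule image_subsetI)
    fix \<alpha> assume \<alpha>: "\<alpha> \<in> S"
    obtain i j where "pr \<alpha> = (i, j)" by force
    then show "pr \<alpha> \<in> C" using pr[OF \<alpha>] \<alpha> unfolding C_def by auto
  qed
  moreover have chain: "is_chain (fst s) (snd s) C"
    unfolding is_chain_def
  proof (intro conjI ballI)
    fix r assume "r \<in> C"
    then obtain i j \<alpha> where r: "r = (i, j)" "\<alpha> \<in> S" "?r i j \<alpha>" by (auto simp: C_def)
    have "form n n \<alpha> \<nu> = 0" using S r(2) by (simp add: orthogonal_roots_def)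
    from form_val[OF r(3) this] have "of_int (coord n s i + coord n s (n + j)) = (0::complex)"
      using \<nu>[of i] \<nu>[of "n + j"] r(3) by simp
    then have "coord n s i + coord n s (n + j) = 0" unfolding of_int_eq_0_iff .
    then show "case r of (i, j) \<Rightarrow> i < length (fst s) \<and> j < length (snd s) \<and> fst s ! i = snd s ! j"
      using r len by (simp add: coord_def)
    have "(i, j) = (i', j') \<or> i < i' \<and> j < j' \<or> i' < i \<and> j' < j" if "(i', j') \<in> C" for i' j'
    proof -
      from that obtain \<beta> where r': "\<beta> \<in> S" "?r i' j' \<beta>" by (auto simp: C_def)
      have "\<not> (i < i' \<and> j' < j)" using cross[OF r(2) r'(1) r(3) r'(2)] by blast
      moreover have "\<not> (i' < i \<and> j < j')" using cross[OF r'(1) r(2) r'(2) r(3)] by blast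
      moreover have "i = i' \<longleftrightarrow> j = j'" using orth[OF r(2) r'(1) r(3) r'(2)] .
      ultimately show ?thesis by auto
    qed
    then show "case r of (i, j) \<Rightarrow> \<forall>(i', j') \<in> C. (i, j) = (i', j') \<or> i < i' \<and> j < j' \<or> i' < i \<and> j' < j"
      unfolding r(1) prod.case by blast
  qed
  ultimately have "card S \<le> card C" using card_inj_on_le is_chain_finite by blast
  also have "\<dots> \<le> lcs (fst s) (snd s)" by (rule card_chain_le_lcs[OF chain])
  finally show ?thesis .
qed

text \<open>The base \<open>\<Sigma>\<close> in which the roots are simple may differ from the base
  whose shifted weight is \<open>\<nu>\<close>, since \<open>s_num\<close> ranges over all
  bases.\<close>

lemma orthogonal_rootsI:
  assumes sub: "(\<lambda>(i, j). ev n i - ev n (n + j)) ` C \<subseteq> \<Sigma>" and \<Sigma>: "\<Sigma> \<in> bases n n"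
    and C: "is_chain (fst s) (snd s) C" and len: "length (fst s) = n" "length (snd s) = n"
    and \<nu>: "\<And>k. k < n + n \<Longrightarrow> \<nu> (crd n k) = of_int (coord n s k)"
  shows "card C \<le> s_num n n \<nu>"
proof -
  let ?f = "\<lambda>(i, j). ev n i - ev n (n + j)"
  have Cn: "i < n" "j < n" "fst s ! i = snd s ! j" if "(i, j) \<in> C" for i j using C len that by (auto simp: is_chain_def)
  have form: "form n n (ev n i - ev n (n + j)) \<mu> = \<mu> (crd n i) + \<mu> (crd n (n + j))" if "(i, j) \<in> C" for i j \<mu>
    using Cn[OF that] form_ev_diff[of i n n "n + j" \<mu>] by simp
  have "orthogonal_roots n n \<nu> (?f ` C)"
    unfolding orthogonal_roots_def
  proof (intro conjI)
    show "?f ` C \<subseteq> odd_roots n n"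
    proof (rule image_subsetI)
      fix r assume r: "r \<in> C"
      obtain i j where ij: "r = (i, j)" by force
      have "i < n + n" "n + j < n + n" "i \<noteq> n + j" "(i < n) \<noteq> (n + j < n)" using Cn[of i j] r ij by auto
      then show "?f r \<in> odd_roots n n" unfolding odd_roots_ev ij prod.case by blast
    qed
    show "lin_indep (?f ` C)" using lin_indep_subset sub \<Sigma> by (auto simp: bases_def is_base_def)
    show "\<exists>\<Sigma>'\<in>bases n n. ?f ` C \<subseteq> \<Sigma>'" using sub \<Sigma> by blast
    show "\<forall>\<alpha>\<in>?f ` C. form n n \<alpha> \<nu> = 0"
    proof (clarsimp simp del: minus_apply)
      fix i j assume ij: "(i, j) \<in> C"
      have "\<nu> (crd n i) = of_int (fst s ! i)" "\<nu> (crd n (n + j)) = - of_int (snd s ! j)"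
        using Cn[OF ij] \<nu>[of i] \<nu>[of "n + j"] by (simp_all add: coord_def)
      then show "form n n (ev n i - ev n (n + j)) \<nu> = 0" using form[OF ij] Cn[OF ij] by simp
    qed
    show "\<forall>\<alpha>\<in>?f ` C. \<forall>\<beta>\<in>?f ` C. form n n \<alpha> \<beta> = 0"
    proof (clarsimp simp del: minus_apply)
      fix i j i' j' assume ij: "(i, j) \<in> C" "(i', j') \<in> C"
      then have "(i, j) = (i', j') \<or> i < i' \<and> j < j' \<or> i' < i \<and> j' < j" using C unfolding is_chain_def by blast
      then show "form n n (ev n i - ev n (n + j)) (ev n i' - ev n (n + j')) = 0"
        using Cn[OF ij(1)] Cn[OF ij(2)] form[OF ij(1)] by auto
    qed
  qed
  then have "card (?f ` C) \<le> s_num n n \<nu>" by (rule s_num_ge)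
  moreover have "inj_on ?f C"
  proof (rule inj_onI)
    fix r r' assume rr: "r \<in> C" "r' \<in> C" "?f r = ?f r'"
    obtain i j i' j' where ij: "r = (i, j)" "r' = (i', j')" by force
    have "i \<noteq> n + j" using Cn[of i j] rr ij by auto
    from ev_diff_eq_iff[OF this, of n i' "n + j'"] show "r = r'" using rr ij by simp
  qed
  ultimately show ?thesis by (simp add: card_image)
qed

section \<open>Highest weights and diagrams read off from states\<close>

lemma crd_range: "z \<in> {1..int m} \<union> {- int n..-1} \<longleftrightarrow> (\<exists>k<m+n. z = crd m k)"
proof
  assume "z \<in> {1..int m} \<union> {- int n..-1}"
  then show "\<exists>k<m+n. z = crd m k"
  proof
    assume "z \<in> {1..int m}"
    then show ?thesis by (intro exI[of _ "nat (z - 1)"]) (auto simp: crd_def)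
  next
    assume "z \<in> {- int n..-1}"
    then show ?thesis by (intro exI[of _ "m + nat (- z - 1)"]) (auto simp: crd_def)
  qed
qed (auto simp: crd_def split: if_splits)

text \<open>This evaluates the definite description: \<open>ex\<close> provides a module,
  \<open>reaches\<close> gives the same weight in every module, and \<open>hw_unique\<close>
  excludes any other weight in it.\<close>

lemma hw_bar_coord:
  assumes lam: "lam \<in> hstar n n"
    and ex: "\<exists>p q R v. is_simple_module n n p q R \<and> hwv n n p q R (<) lam v"
    and dist: "positive_roots n n (dist_base n n) = pos_of n n (<)"
    and s: "reaches n lam h s"
    and P: "positive_roots n n \<Sigma> = pos_of n n (shuffle n n h)"
    and mono: "\<And>i j. i \<le> j \<Longrightarrow> j < n \<Longrightarrow> h i \<le> h j" and hn: "\<And>i. h i \<le> n"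
  shows "\<And>k. k < n + n \<Longrightarrow> hw_bar n n \<Sigma> lam (crd n k) = of_int (coord n s k)"
    and "hw_at n n \<Sigma> lam \<in> hstar n n"
proof -
  \<comment> \<open>\<open>reaches\<close> controls only the coordinates in the index range; the
    extension by 0 is the one in \<open>hstar\<close>.\<close>
  define \<mu> where "\<mu> = (\<lambda>z. if \<exists>k<n+n. z = crd n k then of_int (coord n s (THE k. k < n + n \<and> z = crd n k) -
    srho n h (THE k. k < n + n \<and> z = crd n k)) else (0::complex))"
  have \<mu>: "\<mu> (crd n k) = of_int (coord n s k - srho n h k)" if "k < n + n" for k
  proof -
    have "(THE l. l < n + n \<and> crd n k = crd n l) = k" using that by (intro the_equality) auto
    then show ?thesis using that by (auto simp: \<mu>_def)
  qed
  have \<mu>_hstar: "\<mu> \<in> hstar n n" unfolding hstar_def mem_Collect_eq crd_range by (auto simp: \<mu>_def)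
  have mod: "glmod n n p q R" if "is_simple_module n n p q R" for p q R
    using that by unfold_locales (simp add: is_simple_module_def)
  have hw1: "has_highest_weight n n p q R (dist_base n n) \<nu> \<longleftrightarrow> \<nu> \<in> hstar n n \<and> (\<exists>v. hwv n n p q R (<) \<nu> v)"
    if "is_simple_module n n p q R" for p q R \<nu>
    by (rule glmod.highest_weight_iff[OF mod[OF that] dist]) simp
  have hw2: "has_highest_weight n n p q R \<Sigma> \<nu> \<longleftrightarrow> \<nu> \<in> hstar n n \<and> (\<exists>v. hwv n n p q R (shuffle n n h) \<nu> v)"
    if "is_simple_module n n p q R" for p q R \<nu>
    by (rule glmod.highest_weight_iff[OF mod[OF that] P shuffle_irrefl])
  have reach: "\<exists>w. hwv n n p q R (shuffle n n h) \<mu> w"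
    if "is_simple_module n n p q R" "hwv n n p q R (<) lam v" for p q R v
  proof -
    obtain \<mu>' w where "hwv n n p q R (shuffle n n h) \<mu>' w"
      "\<forall>k<n+n. \<mu>' (crd n k) = of_int (coord n s k - srho n h k)"
      using s \<open>is_simple_module n n p q R\<close> \<open>hwv n n p q R (<) lam v\<close> unfolding reaches_def by blast
    then show ?thesis using hwv_cong[of n n "shuffle n n h" "shuffle n n h" \<mu>' \<mu> p q R w] \<mu> by auto
  qed
  have at: "hw_at n n \<Sigma> lam = \<mu>"
    unfolding hw_at_def
  proof (rule the_equality)
    obtain p q R v where simple: "is_simple_module n n p q R" and v: "hwv n n p q R (<) lam v" using ex by blast
    show "\<exists>p q R. is_simple_module n n p q R \<and>
       has_highest_weight n n p q R (dist_base n n) lam \<and> has_highest_weight n n p q R \<Sigma> \<mu>"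
      using simple v hw1[OF simple] hw2[OF simple] reach[OF simple v] lam \<mu>_hstar by blast
    fix \<nu> assume "\<exists>p q R. is_simple_module n n p q R \<and>
       has_highest_weight n n p q R (dist_base n n) lam \<and> has_highest_weight n n p q R \<Sigma> \<nu>"
    then obtain p q R v w where R: "is_simple_module n n p q R" "hwv n n p q R (<) lam v"
      "\<nu> \<in> hstar n n" "hwv n n p q R (shuffle n n h) \<nu> w" using hw1 hw2 by blast
    obtain w' where w': "hwv n n p q R (shuffle n n h) \<mu> w'" using reach[OF R(1,2)] by blast
    have tr: "shuffle n n h a c" if "shuffle n n h a b" "shuffle n n h b c" for a b c
      using shuffle_trans[OF mono that] by blast
    have "\<nu> (crd n k) = \<mu> (crd n k)" if "k < n + n" for k
      by (rule glmod.hw_unique[OF mod[OF R(1)] R(1) R(4) w' shuffle_total tr shuffle_irrefl that])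
    moreover have "\<nu> z = 0" "\<mu> z = 0" if "\<not> (\<exists>k<n+n. z = crd n k)" for z
      using R(3) \<mu>_hstar that unfolding hstar_def mem_Collect_eq crd_range by blast+
    ultimately show "\<nu> = \<mu>" by (intro ext) metis
  qed
  show "hw_bar n n \<Sigma> lam (crd n k) = of_int (coord n s k)" if "k < n + n" for k
    using \<mu>[OF that] rho_shuffle[OF P hn that] by (simp add: hw_bar_def at)
  show "hw_at n n \<Sigma> lam \<in> hstar n n" using at \<mu>_hstar by simp
qed

text \<open>The second list holds the negated \<delta>-coordinates, so both multiplicities in the
  diagram are counted at the same value \<open>p\<close>.\<close>

lemma weight_diagram_coord:
  assumes "\<And>k. k < n + n \<Longrightarrow> hw_bar n n \<Sigma> lam (crd n k) = of_int (coord n s k)"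
    and len: "length (fst s) = n" "length (snd s) = n"
  shows "weight_diagram n n \<Sigma> lam p = (let k = count_list (fst s) p; l = count_list (snd s) p in
    if k = 0 \<and> l = 0 then {#Circ#}
    else replicate_mset (min k l) Cross + replicate_mset (k - l) Gt + replicate_mset (l - k) Lt)"
proof -
  have cl: "count_list xs p = card {i. i < length xs \<and> xs ! i = p}" for xs :: "int list"
  proof -
    have "{i. i < length xs \<and> xs ! i = p} = {i. i < length xs \<and> p = xs ! i}" by auto
    then show ?thesis using length_filter_conv_card[of "(=) p" xs] by (simp add: count_list_eq_length_filter)
  qed
  have "card {i \<in> {1..n}. hw_bar n n \<Sigma> lam (int i) = of_int p} = card {i. i < length (fst s) \<and> fst s ! i = p}"
  proof (rule bij_betw_same_card[of "\<lambda>i. i - 1"], rule bij_betwI[where g = Suc])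
    have "hw_bar n n \<Sigma> lam (int i) = of_int (fst s ! (i - 1))" if "i \<in> {1..n}" for i
    proof -
      have "crd n (i - 1) = int i" "i - 1 < n" using that by (auto simp: crd_def)
      then show ?thesis using assms(1)[of "i - 1"] by (simp add: coord_def)
    qed
    then show "(\<lambda>i. i - 1) \<in> {i \<in> {1..n}. hw_bar n n \<Sigma> lam (int i) = of_int p} \<rightarrow> {i. i < length (fst s) \<and> fst s ! i = p}"
      "Suc \<in> {i. i < length (fst s) \<and> fst s ! i = p} \<rightarrow> {i \<in> {1..n}. hw_bar n n \<Sigma> lam (int i) = of_int p}"
      using len by (auto simp del: of_nat_Suc)
  qed auto
  moreover have "card {j \<in> {1..n}. hw_bar n n \<Sigma> lam (- int j) = - of_int p} = card {j. j < length (snd s) \<and> snd s ! j = p}"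
  proof (rule bij_betw_same_card[of "\<lambda>i. i - 1"], rule bij_betwI[where g = Suc])
    have "hw_bar n n \<Sigma> lam (- int j) = - of_int (snd s ! (j - 1))" if "j \<in> {1..n}" for j
    proof -
      have "crd n (n + (j - 1)) = - int j" "j - 1 < n" using that by (auto simp: crd_def)
      then show ?thesis using assms(1)[of "n + (j - 1)"] by (simp add: coord_def)
    qed
    then show "(\<lambda>i. i - 1) \<in> {i \<in> {1..n}. hw_bar n n \<Sigma> lam (- int i) = - of_int p} \<rightarrow> {i. i < length (snd s) \<and> snd s ! i = p}"
      "Suc \<in> {i. i < length (snd s) \<and> snd s ! i = p} \<rightarrow> {i \<in> {1..n}. hw_bar n n \<Sigma> lam (- int i) = - of_int p}"
      using len by (auto simp del: of_nat_Suc)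
  qed auto
  ultimately show ?thesis unfolding weight_diagram_def cl by simp
qed

section \<open>The counterexample\<close>

lemma rho_hstar: "rho m n \<Sigma> \<in> hstar m n"
  unfolding hstar_def
proof (intro CollectI allI impI, rule ccontr)
  fix z assume nz: "rho m n \<Sigma> z \<noteq> 0" and out: "z \<notin> {1..int m} \<union> {- int n..-1}"
  have "z \<noteq> crd m k" if "k < m + n" for k using out that by (auto simp: crd_def split: if_splits)
  then have "\<alpha> z = 0" if "\<alpha> \<in> roots m n" for \<alpha>
    using that by (auto simp: roots_ev ev_def)
  moreover have "positive_roots m n \<Sigma> \<subseteq> roots m n" unfolding positive_roots_def by blast
  ultimately have "(\<Sum>\<alpha> \<in> positive_roots m n \<Sigma> \<inter> even_roots m n. \<alpha> z) = 0"
    "(\<Sum>\<alpha> \<in> positive_roots m n \<Sigma> \<inter> odd_roots m n. \<alpha> z) = 0"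
    by (intro sum.neutral; blast)+
  moreover have "(\<Sum>i = 1..m. eps i z) = 0" "(\<Sum>j = 1..n. del j z) = 0"
    using out by (auto simp: eps_def del_def intro!: sum.neutral)
  ultimately show False using nz by (simp add: rho_def)
qed

lemma hstar_diff:
  assumes "\<mu> \<in> hstar m n" "\<nu> \<in> hstar m n" shows "\<mu> - \<nu> \<in> hstar m n"
  unfolding hstar_def
proof (intro CollectI allI impI)
  fix k assume "(\<mu> - \<nu>) k \<noteq> 0"
  then have "\<mu> k \<noteq> 0 \<or> \<nu> k \<noteq> 0" by auto
  then show "k \<in> {1..int m} \<union> {- int n..-1}" using assms unfolding hstar_def by blast
qed

lemma dist_base_order: "1 \<le> m \<Longrightarrow> 1 \<le> n \<Longrightarrow> dist_base m n = order_base m n (\<lambda>t. t)"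
proof (intro equalityI subsetI)
  assume mn: "1 \<le> m" "1 \<le> n"
  fix x assume "x \<in> dist_base m n"
  then consider i where "x = eps i - eps (i + 1)" "1 \<le> i" "i < m" | "x = eps m - del 1"
    | j where "x = del j - del (j + 1)" "1 \<le> j" "j < n" unfolding dist_base_def by blast
  then have "\<exists>t. x = ev m t - ev m (Suc t) \<and> Suc t < m + n"
  proof cases
    case 1
    then show ?thesis using mn eps_ev[of i m] eps_ev[of "i + 1" m] by (intro exI[of _ "i - 1"]) auto
  next
    case 2
    then show ?thesis using mn eps_ev[of m m] del_ev[of 1 m] by (intro exI[of _ "m - 1"]) auto
  next
    case 3
    then show ?thesis using mn del_ev[of j m] del_ev[of "j + 1" m] by (intro exI[of _ "m + j - 1"]) auto
  qed
  then show "x \<in> order_base m n (\<lambda>t. t)" unfolding order_base_def by blast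
next
  assume mn: "1 \<le> m" "1 \<le> n"
  fix x assume "x \<in> order_base m n (\<lambda>t. t)"
  then obtain t where t: "x = ev m t - ev m (Suc t)" "Suc t < m + n" unfolding order_base_def by blast
  consider "Suc t < m" | "Suc t = m" | "m \<le> t" by linarith
  then show "x \<in> dist_base m n"
  proof cases
    case 1
    then have "x = eps (t + 1) - eps (t + 1 + 1)" "1 \<le> t + 1 \<and> t + 1 < m"
      using t eps_ev[of "t + 1" m] eps_ev[of "t + 1 + 1" m] by auto
    then show ?thesis unfolding dist_base_def by blast
  next
    case 2
    then have "x = eps m - del 1" using mn t eps_ev[of m m] del_ev[of 1 m] by auto
    then show ?thesis unfolding dist_base_def by blast
  next
    case 3
    then have "x = del (t - m + 1) - del (t - m + 1 + 1)" "1 \<le> t - m + 1 \<and> t - m + 1 < n"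
      using t del_ev[of "t - m + 1" m] del_ev[of "t - m + 1 + 1" m] by auto
    then show ?thesis unfolding dist_base_def by blast
  qed
qed

lemma shuffle_zero: "a < m + n \<Longrightarrow> b < m + n \<Longrightarrow> shuffle m n (\<lambda>_. 0) a b \<longleftrightarrow> a < b"
  by (auto simp: shuffle_def)

lemma positive_dist_base:
  assumes "1 \<le> m" "1 \<le> n"
  shows "positive_roots m n (dist_base m n) = pos_of m n (<)"
    and "positive_roots m n (dist_base m n) = pos_of m n (shuffle m n (\<lambda>_. 0))"
    and "dist_base m n \<in> bases m n"
proof -
  have bij: "bij_betw (\<lambda>t. t) {..<m+n} {..<m+n}" by (simp add: bij_betw_def)
  have sh: "shuffle m n (\<lambda>_. 0) s t" if "s < t" "t < m + n" for s t using that by (simp add: shuffle_zero)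
  show P: "positive_roots m n (dist_base m n) = pos_of m n (shuffle m n (\<lambda>_. 0))"
    unfolding dist_base_order[OF assms] by (rule positive_order_base_shuffle[OF bij]) (use sh in auto)
  show "dist_base m n \<in> bases m n"
    unfolding dist_base_order[OF assms] by (rule order_base_in_bases[OF bij, of "\<lambda>_. 0"]) (use sh in auto)
  have "pos_of m n (shuffle m n (\<lambda>_. 0)) = pos_of m n (<)"
    unfolding pos_of_def using shuffle_zero by blast
  then show "positive_roots m n (dist_base m n) = pos_of m n (<)" using P by simp
qed

section \<open>The finite computation for gl(5|5)\<close>

definition start_state :: "int list \<times> int list" where
  "start_state = ([5, 4, 3, 0, - 1], [- 1, 0, 3, 4, 5])"

definition refl_state :: "nat \<Rightarrow> nat \<Rightarrow> nat \<Rightarrow> nat \<Rightarrow> nat \<Rightarrow> int list \<times> int list" where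
  "refl_state h0 h1 h2 h3 h4 = refl_row 0 h0 (refl_row 1 h1 (refl_row 2 h2 (refl_row 3 h3 (refl_row 4 h4 start_state))))"

definition heights :: "nat \<Rightarrow> nat \<Rightarrow> nat \<Rightarrow> nat \<Rightarrow> nat \<Rightarrow> nat \<Rightarrow> nat" where
  "heights h0 h1 h2 h3 h4 = (\<lambda>_. 0)(4 := h4, 3 := h3, 2 := h2, 1 := h1, 0 := h0)"

text \<open>The nested ranges run over all increasing heights up to 5. The second clause recovers
  the state from the two multiplicities at 0; it is what makes the tail independent of the chosen
  base.\<close>

lemma final_states:
  "\<forall>h4\<in>set [0..<6]. \<forall>h3\<in>set [0..<Suc h4]. \<forall>h2\<in>set [0..<Suc h3]. \<forall>h1\<in>set [0..<Suc h2]. \<forall>h0\<in>set [0..<Suc h1].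
     let s = refl_state h0 h1 h2 h3 h4 in lcs (fst s) (snd s) \<le> 3 \<and>
       (count_list (fst s) 0 = 2 \<longrightarrow> count_list (snd s) 0 = 2 \<longrightarrow> s = ([5, 4, 3, 0, 0], [0, 0, 3, 4, 5]))"
  by code_simp

text \<open>A single box, at the last \<epsilon> and the first \<delta>: both entries -1 become 0
  and the left cluster is merged.\<close>

lemma tail_final: "refl_state 0 0 0 0 1 = ([5, 4, 3, 0, 0], [0, 0, 3, 4, 5])"
  by code_simp

text \<open>Row 2 lifts 3 to 5 on the \<epsilon> side and row 1 lifts 4 to 5. Rows 3 and 4 must be
  at least as long as row 2; on the way they carry the left cluster from -1, 0 to 1, 2, where it
  meets no entry 3.\<close>

lemma longtail_final: "refl_state 0 3 4 4 4 = ([5, 5, 5, 2, 1], [1, 2, 5, 5, 5])"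
  by code_simp

lemma less_10: "k < (10::nat) \<Longrightarrow> k = 0 \<or> k = 1 \<or> k = 2 \<or> k = 3 \<or> k = 4 \<or> k = 5 \<or> k = 6 \<or> k = 7 \<or> k = 8 \<or> k = 9"
  by presburger

lemma less_5: "k < (5::nat) \<Longrightarrow> k = 0 \<or> k = 1 \<or> k = 2 \<or> k = 3 \<or> k = 4"
  by presburger

lemma hfun_mono:
  assumes "h0 \<le> h1" "h1 \<le> h2" "h2 \<le> h3" "h3 \<le> h4" "i \<le> j" "j < 5"
  shows "heights h0 h1 h2 h3 h4 i \<le> heights h0 h1 h2 h3 h4 j"
proof -
  have "i < 5" using assms by simp
  from less_5[OF this] less_5[OF assms(6)] show ?thesis
    using assms(1-5) by (elim disjE) (simp_all add: heights_def)
qed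

text \<open>Bounded quantifiers over lists, so that the ordering can be checked by evaluation;
  \<open>shuffle\<close> is required for every pair of places, not just for neighbours.\<close>

definition enumerates_shuffle :: "nat list \<Rightarrow> (nat \<Rightarrow> nat) \<Rightarrow> bool" where
  "enumerates_shuffle xs h \<longleftrightarrow> distinct xs \<and> length xs = 10 \<and> (\<forall>x\<in>set xs. x < 10) \<and>
     (\<forall>t\<in>set [0..<10]. \<forall>s\<in>set [0..<t]. shuffle 5 5 h (xs ! s) (xs ! t))"

lemma order_base_check:
  assumes xs: "enumerates_shuffle xs (heights h0 h1 h2 h3 h4)" and h: "h0 \<le> h1" "h1 \<le> h2" "h2 \<le> h3" "h3 \<le> h4"
  shows "order_base 5 5 ((!) xs) \<in> bases 5 5"
    and "positive_roots 5 5 (order_base 5 5 ((!) xs)) = pos_of 5 5 (shuffle 5 5 (heights h0 h1 h2 h3 h4))"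
proof -
  have dl: "distinct xs" "length xs = 10" and "set xs \<subseteq> {..<10}"
    and sh: "\<And>s t. t \<in> set [0..<10] \<Longrightarrow> s \<in> set [0..<t] \<Longrightarrow> shuffle 5 5 (heights h0 h1 h2 h3 h4) (xs ! s) (xs ! t)"
    using xs unfolding enumerates_shuffle_def by blast+
  then have set: "set xs = {..<10}"
    using card_subset_eq[of "{..<10::nat}" "set xs"] distinct_card[of xs] by simp
  have bij: "bij_betw ((!) xs) {..<5+5} {..<5+5}"
    by (rule bij_betw_nth[OF dl(1)]) (simp_all only: dl set numeral_plus_numeral add_num_simps)
  have sh': "shuffle 5 5 (heights h0 h1 h2 h3 h4) (xs ! s) (xs ! t)" if "s < t" "t < 5 + 5" for s t
  proof -
    have "t \<in> set [0..<10]" "s \<in> set [0..<t]" using that by simp_all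
    then show ?thesis using sh by blast
  qed
  show "order_base 5 5 ((!) xs) \<in> bases 5 5"
    by (rule order_base_in_bases[OF bij sh' hfun_mono[OF h]])
  show "positive_roots 5 5 (order_base 5 5 ((!) xs)) = pos_of 5 5 (shuffle 5 5 (heights h0 h1 h2 h3 h4))"
    by (rule positive_order_base_shuffle[OF bij sh' hfun_mono[OF h]])
qed

lemma reaches_final:
  assumes s: "reaches 5 lam (\<lambda>_. 0) start_state"
    and h: "h0 \<le> h1" "h1 \<le> h2" "h2 \<le> h3" "h3 \<le> h4" "h4 \<le> 5"
  shows "reaches 5 lam (heights h0 h1 h2 h3 h4) (refl_state h0 h1 h2 h3 h4)"
proof -
  have mono: "heights a b c d e i \<le> heights a b c d e j" if "i \<le> j" "j < 5" "a \<le> b" "b \<le> c" "c \<le> d" "d \<le> e" for a b c d e i j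
    using hfun_mono that by blast
  have zero: "heights 0 0 0 0 0 = (\<lambda>_. 0)" by (auto simp: heights_def)
  have upd: "(heights 0 0 0 0 0)(4 := e) = heights 0 0 0 0 e" "(heights 0 0 0 0 e)(3 := d) = heights 0 0 0 d e"
    "(heights 0 0 0 d e)(2 := c) = heights 0 0 c d e" "(heights 0 0 c d e)(1 := b) = heights 0 b c d e"
    "(heights 0 b c d e)(0 := a) = heights a b c d e" for a b c d e
    by (auto simp: heights_def fun_eq_iff)
  have 4: "reaches 5 lam ((heights 0 0 0 0 0)(4 := h4)) (refl_row 4 h4 start_state)"
    by (rule reaches_row[OF s[folded zero]]) (use h mono in \<open>auto simp: heights_def\<close>)
  have 3: "reaches 5 lam ((heights 0 0 0 0 h4)(3 := h3)) (refl_row 3 h3 (refl_row 4 h4 start_state))"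
    by (rule reaches_row[OF 4[unfolded upd]]) (use h mono[of _ _ 0 0 0 0 h4] less_5 in \<open>fastforce simp: heights_def\<close>)+
  have 2: "reaches 5 lam ((heights 0 0 0 h3 h4)(2 := h2)) (refl_row 2 h2 (refl_row 3 h3 (refl_row 4 h4 start_state)))"
    by (rule reaches_row[OF 3[unfolded upd]]) (use h mono[of _ _ 0 0 0 h3 h4] less_5 in \<open>fastforce simp: heights_def\<close>)+
  have 1: "reaches 5 lam ((heights 0 0 h2 h3 h4)(1 := h1)) (refl_row 1 h1 (refl_row 2 h2 (refl_row 3 h3 (refl_row 4 h4 start_state))))"
    by (rule reaches_row[OF 2[unfolded upd]]) (use h mono[of _ _ 0 0 h2 h3 h4] less_5 in \<open>fastforce simp: heights_def\<close>)+
  have "reaches 5 lam ((heights 0 h1 h2 h3 h4)(0 := h0)) (refl_row 0 h0 (refl_row 1 h1 (refl_row 2 h2 (refl_row 3 h3 (refl_row 4 h4 start_state)))))"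
    by (rule reaches_row[OF 1[unfolded upd]]) (use h mono[of _ _ 0 h1 h2 h3 h4] less_5 in \<open>fastforce simp: heights_def\<close>)+
  then show ?thesis unfolding upd refl_state_def .
qed

theorem mainTheorem5:
  fixes lam :: weight
  assumes lam_def: "lam = weight_of [5, 4, 3, 0, -1] [1, 0, -3, -4, -5] - rho 5 5 (dist_base 5 5)"
  shows "lam \<in> dominant 5 5 \<and>
         hw_bar 5 5 (dist_base 5 5) lam = weight_of [5, 4, 3, 0, -1] [1, 0, -3, -4, -5] \<and>
         tail 5 5 lam = 2 \<and> longtail 5 5 lam = 3 \<and> tail 5 5 lam < longtail 5 5 lam \<and>
         \<not> (\<forall>m n. 1 \<le> m \<longrightarrow> 1 \<le> n \<longrightarrow> (\<forall>\<nu> \<in> dominant m n. tail m n \<nu> = longtail m n \<nu>))"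
proof -
  have dist: "positive_roots 5 5 (dist_base 5 5) = pos_of 5 5 (<)"
    "positive_roots 5 5 (dist_base 5 5) = pos_of 5 5 (shuffle 5 5 (\<lambda>_. 0))" "dist_base 5 5 \<in> bases 5 5"
    using positive_dist_base[of 5 5] by simp_all
  have start_coord: "weight_of [5, 4, 3, 0, -1] [1, 0, -3, -4, -5] (crd 5 k) = of_int (coord 5 start_state k)"
    if "k < 5 + 5" for k
    using less_10[of k] that by (auto simp: weight_of_def crd_def coord_def start_state_def)
  have lam_rho: "lam (crd 5 k) = of_int (coord 5 start_state k - srho 5 (\<lambda>_. 0) k)" if "k < 5 + 5" for k
    using rho_shuffle[OF dist(2) _ that] start_coord[OF that] by (simp add: lam_def)
  have lam_val: "lam (crd 5 k) = of_int ([5, 5, 5, 3, 3, -3, -3, -5, -5, -5] ! k)" if "k < 10" for k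
    using less_10[OF that] lam_rho[of k] by (auto simp: coord_def start_state_def srho_def)
  have bar_hstar: "weight_of [5, 4, 3, 0, -1] [1, 0, -3, -4, -5] \<in> hstar 5 5"
    by (auto simp: hstar_def weight_of_def split: if_splits)
  then have hstar: "lam \<in> hstar 5 5"
    unfolding lam_def using rho_hstar by (rule hstar_diff)
  have cases5: "i = 1 \<or> i = 2 \<or> i = 3 \<or> i = 4 \<or> i = 5" if "1 \<le> i" "i \<le> 5" for i :: nat
    using that by presburger
  have lam_pos: "lam (int i) = of_int ([5, 5, 5, 3, 3] ! (i - 1))" if i: "1 \<le> i" "i \<le> 5" for i
  proof -
    have "lam (int i) = lam (crd 5 (i - 1))" using i by (auto simp: crd_def)
    also have "\<dots> = of_int ([5, 5, 5, 3, 3, -3, -3, -5, -5, -5] ! (i - 1))" using i by (intro lam_val) simp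
    also have "\<dots> = of_int ([5, 5, 5, 3, 3] ! (i - 1))" using cases5[OF i] by (elim disjE) simp_all
    finally show ?thesis .
  qed
  have lam_neg: "lam (- int i) = of_int ([-3, -3, -5, -5, -5] ! (i - 1))" if i: "1 \<le> i" "i \<le> 5" for i
  proof -
    have "lam (- int i) = lam (crd 5 (i + 4))" using i by (auto simp: crd_def)
    also have "\<dots> = of_int ([5, 5, 5, 3, 3, -3, -3, -5, -5, -5] ! (i + 4))" using i by (intro lam_val) simp
    also have "\<dots> = of_int ([-3, -3, -5, -5, -5] ! (i - 1))" using cases5[OF i] by (elim disjE) simp_all
    finally show ?thesis .
  qed
  have lam_zero: "lam z = 0" if "z \<notin> {1..5} \<union> {-5..-1}" for z
    using hstar that unfolding hstar_def by force
  have dominant: "lam \<in> dominant 5 5"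
    unfolding dominant_def
  proof (intro CollectI conjI allI impI hstar)
    fix z :: int
    consider "1 \<le> z" "z \<le> 5" | "-5 \<le> z" "z \<le> -1" | "z \<notin> {1..5} \<union> {-5..-1}" by fastforce
    then show "lam z \<in> \<int>"
    proof cases
      case 1 then show ?thesis using lam_pos[of "nat z"] by simp
    next
      case 2 then show ?thesis using lam_neg[of "nat (- z)"] by simp
    next
      case 3 then show ?thesis using lam_zero by simp
    qed
  next
    fix i j :: nat assume ij: "1 \<le> i \<and> i \<le> j \<and> j \<le> 5"
    then have "1 \<le> i" "i \<le> 5" "1 \<le> j" "j \<le> 5" by auto
    from cases5[OF this(1,2)] cases5[OF this(3,4)] show "Re (lam (int j)) \<le> Re (lam (int i))"
      using ij lam_pos[of i] lam_pos[of j] by (elim disjE) simp_all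
  next
    fix i j :: nat assume ij: "1 \<le> i \<and> i \<le> j \<and> j \<le> 5"
    then have "1 \<le> i" "i \<le> 5" "1 \<le> j" "j \<le> 5" by auto
    from cases5[OF this(1,2)] cases5[OF this(3,4)] show "Re (lam (- int j)) \<le> Re (lam (- int i))"
      using ij lam_neg[of i] lam_neg[of j] by (elim disjE) simp_all
  qed
  have ex: "\<exists>p q R v. is_simple_module 5 5 p q R \<and> hwv 5 5 p q R (<) lam v"
  proof -
    \<comment> \<open>The numeral type \<open>10\<close> supplies an index type with ten
      elements.\<close>
    obtain \<iota> :: "10 \<Rightarrow> nat" where \<iota>: "bij_betw \<iota> UNIV {..<5+5}"
      using ex_bij_betw_finite_nat[of "UNIV :: 10 set"] by (auto simp: atLeast0LessThan)
    obtain p q R w where simple: "is_simple_module 5 5 p q R" and w: "hwv 5 5 p q R (<)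
       ((ev 5 0 + ev 5 1 + ev 5 2) + (ev 5 0 + ev 5 1 + ev 5 2) +
        ((- ev 5 (5 + 5 - 1) + - ev 5 (5 + 5 - 2) + - ev 5 (5 + 5 - 3)) +
         (- ev 5 (5 + 5 - 1) + - ev 5 (5 + 5 - 2) + - ev 5 (5 + 5 - 3)) + (\<lambda>z. if 0 < z then 3 else - 3))) w"
      using simple_module_exists[OF \<iota>, of 3] by auto
    let ?\<mu> = "((ev 5 0 + ev 5 1 + ev 5 2) + (ev 5 0 + ev 5 1 + ev 5 2) +
        ((- ev 5 (5 + 5 - 1) + - ev 5 (5 + 5 - 2) + - ev 5 (5 + 5 - 3)) +
         (- ev 5 (5 + 5 - 1) + - ev 5 (5 + 5 - 2) + - ev 5 (5 + 5 - 3)) + (\<lambda>z. if 0 < z then 3 else - 3)))"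
    have val: "?\<mu> (crd 5 k) = lam (crd 5 k)" if "k < 5 + 5" for k
    proof -
      have "k < 10" using that by simp
      from less_10[OF this] lam_val[OF this] show ?thesis
        by (elim disjE) (simp_all, simp_all add: crd_def)
    qed
    have "hwv 5 5 p q R (<) ?\<mu> w = hwv 5 5 p q R (<) lam w"
      by (rule hwv_cong[OF refl]) (rule val)
    then show ?thesis using simple w by blast
  qed
  have reach0: "reaches 5 lam (\<lambda>_. 0) start_state"
    unfolding reaches_def
  proof (intro conjI allI impI)
    fix p q R v assume "is_simple_module 5 5 p q R" "hwv 5 5 p q R (<) lam v"
    then have "hwv 5 5 p q R (shuffle 5 5 (\<lambda>_. 0)) lam v"
      using hwv_cong[of 5 5 "shuffle 5 5 (\<lambda>_. 0)" "(<)" lam lam p q R v] shuffle_zero[of _ 5 5] by simp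
    then show "\<exists>\<mu> w. hwv 5 5 p q R (shuffle 5 5 (\<lambda>_. 0)) \<mu> w \<and>
        (\<forall>k<5+5. \<mu> (crd 5 k) = of_int (coord 5 start_state k - srho 5 (\<lambda>_. 0) k))"
      using lam_rho by blast
  qed (simp_all add: start_state_def)
  note reach = reaches_final[OF reach0]
  have bar: "hw_bar 5 5 \<Sigma> lam (crd 5 k) = of_int (coord 5 (refl_state h0 h1 h2 h3 h4) k)"
    if P: "positive_roots 5 5 \<Sigma> = pos_of 5 5 (shuffle 5 5 (heights h0 h1 h2 h3 h4))"
      and h: "h0 \<le> h1" "h1 \<le> h2" "h2 \<le> h3" "h3 \<le> h4" "h4 \<le> 5" and k: "k < 5 + 5" for \<Sigma> h0 h1 h2 h3 h4 k
  proof (rule hw_bar_coord(1)[OF hstar ex dist(1) reach[OF h] P hfun_mono[OF h(1-4)] _ k])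
    show "heights h0 h1 h2 h3 h4 i \<le> 5" for i using h by (auto simp: heights_def)
  qed
  have len: "length (fst (refl_state h0 h1 h2 h3 h4)) = 5" "length (snd (refl_state h0 h1 h2 h3 h4)) = 5"
    if "h0 \<le> h1" "h1 \<le> h2" "h2 \<le> h3" "h3 \<le> h4" "h4 \<le> 5" for h0 h1 h2 h3 h4
    using reach[OF that] by (auto simp: reaches_def)
  have classify: "\<exists>h0 h1 h2 h3 h4. h0 \<le> h1 \<and> h1 \<le> h2 \<and> h2 \<le> h3 \<and> h3 \<le> h4 \<and> h4 \<le> 5 \<and>
      (\<forall>k<5+5. hw_bar 5 5 \<Sigma> lam (crd 5 k) = of_int (coord 5 (refl_state h0 h1 h2 h3 h4) k))"
    if \<Sigma>: "\<Sigma> \<in> bases 5 5" for \<Sigma>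
  proof -
    obtain h where mono: "\<And>i j. i \<le> j \<Longrightarrow> j < 5 \<Longrightarrow> h i \<le> h j" and h5: "\<And>i. h i \<le> 5"
      and P: "positive_roots 5 5 \<Sigma> = pos_of 5 5 (shuffle 5 5 h)" by (rule bases_shuffle[OF \<Sigma>]) blast
    \<comment> \<open>\<open>h\<close> and \<open>heights\<close> need to agree only below 5, since
      \<open>shuffle\<close> evaluates them at \<epsilon>-indices alone.\<close>
    have eq: "heights (h 0) (h 1) (h 2) (h 3) (h 4) i = h i" if "i < 5" for i
      using less_5[OF that] by (auto simp: heights_def)
    have "shuffle 5 5 h a b = shuffle 5 5 (heights (h 0) (h 1) (h 2) (h 3) (h 4)) a b" for a b
      unfolding shuffle_def using eq[of a] eq[of b] by (cases "a < 5"; cases "b < 5") simp_all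
    then have "shuffle 5 5 h = shuffle 5 5 (heights (h 0) (h 1) (h 2) (h 3) (h 4))" by blast
    with P have P': "positive_roots 5 5 \<Sigma> = pos_of 5 5 (shuffle 5 5 (heights (h 0) (h 1) (h 2) (h 3) (h 4)))" by simp
    have hh: "h 0 \<le> h 1" "h 1 \<le> h 2" "h 2 \<le> h 3" "h 3 \<le> h 4" "h 4 \<le> 5" by (auto intro: mono h5)
    show ?thesis
      by (rule exI[of _ "h 0"], rule exI[of _ "h 1"], rule exI[of _ "h 2"], rule exI[of _ "h 3"],
          rule exI[of _ "h 4"], intro conjI hh allI impI bar[OF P' hh])
  qed
  have states: "lcs (fst s) (snd s) \<le> 3"
    "count_list (fst s) 0 = 2 \<Longrightarrow> count_list (snd s) 0 = 2 \<Longrightarrow> s = ([5, 4, 3, 0, 0], [0, 0, 3, 4, 5])"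
    if h: "h0 \<le> h1" "h1 \<le> h2" "h2 \<le> h3" "h3 \<le> h4" "h4 \<le> 5" and s: "s = refl_state h0 h1 h2 h3 h4" for s h0 h1 h2 h3 h4
  proof -
    have "h4 \<in> set [0..<6]" "h3 \<in> set [0..<Suc h4]" "h2 \<in> set [0..<Suc h3]" "h1 \<in> set [0..<Suc h2]" "h0 \<in> set [0..<Suc h1]"
      using h by auto
    from final_states[rule_format, OF this] show "lcs (fst s) (snd s) \<le> 3"
      "count_list (fst s) 0 = 2 \<Longrightarrow> count_list (snd s) 0 = 2 \<Longrightarrow> s = ([5, 4, 3, 0, 0], [0, 0, 3, 4, 5])"
      unfolding s[symmetric] Let_def by blast+
  qed
  have ne: "bases 5 5 \<noteq> {}" using dist(3) by blast
  have le3: "s_num 5 5 (hw_bar 5 5 \<Sigma> lam) \<le> 3" if \<Sigma>: "\<Sigma> \<in> bases 5 5" for \<Sigma>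
  proof -
    obtain h0 h1 h2 h3 h4 where h: "h0 \<le> h1" "h1 \<le> h2" "h2 \<le> h3" "h3 \<le> h4" "h4 \<le> 5"
      and c: "\<And>k. k < 5 + 5 \<Longrightarrow> hw_bar 5 5 \<Sigma> lam (crd 5 k) = of_int (coord 5 (refl_state h0 h1 h2 h3 h4) k)"
      using classify[OF \<Sigma>] by blast
    show ?thesis
      by (rule s_num_le[OF ne]) (use orthogonal_roots_le_lcs[OF _ c len[OF h]] states(1)[OF h refl] in fastforce)
  qed

  \<comment> \<open>The shuffle with heights 0, 3, 4, 4, 4 as a list: indices 0 to 4 are
    \<epsilon>'s, 5 to 9 are \<delta>'s.\<close>
  let ?B3 = "order_base 5 5 ((!) [0, 5, 6, 7, 1, 8, 2, 3, 4, 9])"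
  have B3: "?B3 \<in> bases 5 5" "positive_roots 5 5 ?B3 = pos_of 5 5 (shuffle 5 5 (heights 0 3 4 4 4))"
  proof -
    have "enumerates_shuffle [0, 5, 6, 7, 1, 8, 2, 3, 4, 9] (heights 0 3 4 4 4)" by code_simp
    from order_base_check[OF this]
    show "?B3 \<in> bases 5 5" "positive_roots 5 5 ?B3 = pos_of 5 5 (shuffle 5 5 (heights 0 3 4 4 4))"
      by simp_all
  qed
  \<comment> \<open>A second base, used only as the witness in \<open>s_num\<close>: here
    \<epsilon>_1, \<delta>_3 and \<epsilon>_2, \<delta>_4 and \<epsilon>_3, \<delta>_5 are
    neighbours, so all three roots are simple.\<close>
  let ?S3 = "order_base 5 5 ((!) [5, 6, 0, 7, 1, 8, 2, 9, 3, 4])"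
  have S3: "?S3 \<in> bases 5 5"
  proof -
    have "enumerates_shuffle [5, 6, 0, 7, 1, 8, 2, 9, 3, 4] (heights 2 3 4 5 5)" by code_simp
    from order_base_check(1)[OF this] show ?thesis by simp
  qed
  have ge3: "3 \<le> s_num 5 5 (hw_bar 5 5 ?B3 lam)"
  proof -
    \<comment> \<open>The three entries 5 stand at places 0, 1, 2 of the first list and 2, 3, 4 of
      the second.\<close>
    let ?C = "{(0, 2), (1, 3), (2, 4)} :: (nat \<times> nat) set"
    have "card ?C \<le> s_num 5 5 (hw_bar 5 5 ?B3 lam)"
    proof (rule orthogonal_rootsI[OF _ S3, where s = "refl_state 0 3 4 4 4"])
      have "ev 5 0 - ev 5 (5 + 2) \<in> ?S3" unfolding order_base_def by (intro CollectI exI[of _ 2]) simp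
      moreover have "ev 5 1 - ev 5 (5 + 3) \<in> ?S3" unfolding order_base_def by (intro CollectI exI[of _ 4]) simp
      moreover have "ev 5 2 - ev 5 (5 + 4) \<in> ?S3" unfolding order_base_def by (intro CollectI exI[of _ 6]) simp
      ultimately show "(\<lambda>(i, j). ev 5 i - ev 5 (5 + j)) ` ?C \<subseteq> ?S3" by simp
      show "is_chain (fst (refl_state 0 3 4 4 4)) (snd (refl_state 0 3 4 4 4)) ?C"
        unfolding longtail_final by (simp add: is_chain_def)
      show "length (fst (refl_state 0 3 4 4 4)) = 5" "length (snd (refl_state 0 3 4 4 4)) = 5" by (simp_all add: longtail_final)
      show "hw_bar 5 5 ?B3 lam (crd 5 k) = of_int (coord 5 (refl_state 0 3 4 4 4) k)" if "k < 5 + 5" for k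
        by (rule bar[OF B3(2) _ _ _ _ _ that]) simp_all
    qed
    then show ?thesis by simp
  qed
  have longtail: "longtail 5 5 lam = 3"
    unfolding longtail_def
  proof (rule Max_eqI)
    show "finite {s_num 5 5 (hw_bar 5 5 \<Sigma> lam) | \<Sigma>. \<Sigma> \<in> bases 5 5}"
      by (rule finite_subset[of _ "{..3}"]) (use le3 in auto)
    show "3 \<in> {s_num 5 5 (hw_bar 5 5 \<Sigma> lam) | \<Sigma>. \<Sigma> \<in> bases 5 5}"
      using ge3 le3[OF B3(1)] B3(1) by (auto intro!: exI[of _ ?B3])
  qed (use le3 in auto)

  have diagram: "weight_diagram 5 5 \<Sigma> lam p = (let k = count_list (fst s) p; l = count_list (snd s) p in
    if k = 0 \<and> l = 0 then {#Circ#}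
    else replicate_mset (min k l) Cross + replicate_mset (k - l) Gt + replicate_mset (l - k) Lt)"
    if "\<And>k. k < 5 + 5 \<Longrightarrow> hw_bar 5 5 \<Sigma> lam (crd 5 k) = of_int (coord 5 s k)"
      "length (fst s) = 5" "length (snd s) = 5" for \<Sigma> s p
    by (rule weight_diagram_coord[OF that])
  have D: "weight_diagram 5 5 (dist_base 5 5) lam = (\<lambda>p. if p \<in> {-1, 0, 3, 4, 5} then {#Cross#} else {#Circ#})"
  proof
    fix p
    have "hw_bar 5 5 (dist_base 5 5) lam (crd 5 k) = of_int (coord 5 start_state k)" if "k < 5 + 5" for k
      by (rule hw_bar_coord(1)[OF hstar ex dist(1) reach0 dist(2) _ _ that]) simp_all
    from diagram[OF this, of p] show "weight_diagram 5 5 (dist_base 5 5) lam p = (if p \<in> {-1, 0, 3, 4, 5} then {#Cross#} else {#Circ#})"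
      by (auto simp: start_state_def)
  qed
  have tail_diagram: "tail_diagram 5 5 lam = (\<lambda>p. if p = 0 then replicate_mset 2 Cross
      else if p \<in> {3, 4, 5} then {#Cross#} else {#Circ#})"
  proof -
    let ?D = "\<lambda>p::int. if p \<in> {-1, 0, 3, 4, 5} then {#Cross#} else {#Circ#}"
    have X: "{p. ?D p = {#Cross#}} = {-1, 0, 3, 4, 5}" by auto
    have Min: "Min {-1, 0, 3, 4, 5 :: int} = -1" by simp
    \<comment> \<open>Position 0 carries a cross, so the first empty position right of -1 is 1;
      hence the two crosses at -1 and 0 are collected at 0.\<close>
    have L: "(LEAST d. -1 < d \<and> ?D d = {#Circ#}) = 1"
    proof (rule Least_equality)
      fix y assume y: "-1 < y \<and> ?D y = {#Circ#}"
      then have "y \<noteq> 0" by auto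
      then show "1 \<le> y" using y by simp
    qed simp
    have t: "{p \<in> {-1, 0, 3, 4, 5 :: int}. -1 \<le> p \<and> p < 1} = {-1, 0}" by auto
    have x: "{p \<in> {-1, 0, 3, 4, 5 :: int}. p < 1} = {-1, 0}" by auto
    have ne: "{-1, 0, 3, 4, 5 :: int} \<noteq> {}" by simp
    have m: "Max {-1, 0 :: int} = 0" "card {-1, 0 :: int} = 2" by simp_all
    show ?thesis unfolding tail_diagram_def D Let_def X Min L t x m if_not_P[OF ne]
      by (auto simp: fun_eq_iff)
  qed
  \<comment> \<open>The distinguished order with the last \<epsilon> and the first \<delta>
    exchanged.\<close>
  let ?B2 = "order_base 5 5 ((!) [0, 1, 2, 3, 5, 4, 6, 7, 8, 9])"
  have B2: "?B2 \<in> bases 5 5" "positive_roots 5 5 ?B2 = pos_of 5 5 (shuffle 5 5 (heights 0 0 0 0 1))"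
  proof -
    have "enumerates_shuffle [0, 1, 2, 3, 5, 4, 6, 7, 8, 9] (heights 0 0 0 0 1)" by code_simp
    from order_base_check[OF this]
    show "?B2 \<in> bases 5 5" "positive_roots 5 5 ?B2 = pos_of 5 5 (shuffle 5 5 (heights 0 0 0 0 1))"
      by simp_all
  qed
  have "weight_diagram 5 5 ?B2 lam = tail_diagram 5 5 lam"
  proof
    fix p
    have "hw_bar 5 5 ?B2 lam (crd 5 k) = of_int (coord 5 (refl_state 0 0 0 0 1) k)" if "k < 5 + 5" for k
      by (rule bar[OF B2(2) _ _ _ _ _ that]) simp_all
    from diagram[OF this, of p] show "weight_diagram 5 5 ?B2 lam p = tail_diagram 5 5 lam p"
      unfolding tail_diagram tail_final by (auto simp: numeral_2_eq_2)
  qed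
  then have tb: "tail_base 5 5 lam \<in> bases 5 5" "weight_diagram 5 5 (tail_base 5 5 lam) lam = tail_diagram 5 5 lam"
    using someI_ex[of "\<lambda>\<Sigma>. \<Sigma> \<in> bases 5 5 \<and> weight_diagram 5 5 \<Sigma> lam = tail_diagram 5 5 lam"] B2(1)
    unfolding tail_base_def by blast+
  obtain h0 h1 h2 h3 h4 where h: "h0 \<le> h1" "h1 \<le> h2" "h2 \<le> h3" "h3 \<le> h4" "h4 \<le> 5"
    and c: "\<And>k. k < 5 + 5 \<Longrightarrow> hw_bar 5 5 (tail_base 5 5 lam) lam (crd 5 k) = of_int (coord 5 (refl_state h0 h1 h2 h3 h4) k)"
    using classify[OF tb(1)] by blast
  let ?s = "refl_state h0 h1 h2 h3 h4"
  \<comment> \<open>The chosen base is known only through its diagram; the double cross at 0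
    suffices to identify the state.\<close>
  have tb0: "weight_diagram 5 5 (tail_base 5 5 lam) lam 0 = replicate_mset 2 Cross"
    unfolding tb(2) tail_diagram by simp
  have eq: "(let k = count_list (fst ?s) 0; l = count_list (snd ?s) 0 in
    if k = 0 \<and> l = 0 then {#Circ#}
    else replicate_mset (min k l) Cross + replicate_mset (k - l) Gt + replicate_mset (l - k) Lt) = replicate_mset 2 Cross"
    by (rule trans[OF diagram[OF c len[OF h], symmetric] tb0])
  have "k = 2 \<and> l = 2" if "(if k = 0 \<and> l = 0 then {#Circ#}
    else replicate_mset (min k l) Cross + replicate_mset (k - l) Gt + replicate_mset (l - k) Lt) = replicate_mset 2 Cross" for k l
    using arg_cong[OF that, of "\<lambda>M. count M Cross"] arg_cong[OF that, of "\<lambda>M. count M Gt"]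
      arg_cong[OF that, of "\<lambda>M. count M Lt"] by (auto split: if_splits)
  from this[OF eq[unfolded Let_def]] have s: "?s = ([5, 4, 3, 0, 0], [0, 0, 3, 4, 5])"
    using states(2)[OF h refl] by blast
  have "s_num 5 5 (hw_bar 5 5 (tail_base 5 5 lam) lam) = 2"
  proof (rule antisym)
    \<comment> \<open>The entries 5, 4, 3 precede the zeros in one list and follow them in reversed
      order in the other, so the two zeros are the best choice.\<close>
    have "lcs (fst ?s) (snd ?s) = 2" unfolding s by simp
    then show "s_num 5 5 (hw_bar 5 5 (tail_base 5 5 lam) lam) \<le> 2"
      by (intro s_num_le[OF ne]) (use orthogonal_roots_le_lcs[OF _ c len[OF h]] in fastforce)
    \<comment> \<open>The two zeros of each list; the corresponding roots \<epsilon>_4 - \<delta>_1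
      and \<epsilon>_5 - \<delta>_2 are both simple in \<open>?B2\<close>.\<close>
    let ?C = "{(3, 0), (4, 1)} :: (nat \<times> nat) set"
    have "card ?C \<le> s_num 5 5 (hw_bar 5 5 (tail_base 5 5 lam) lam)"
    proof (rule orthogonal_rootsI[OF _ B2(1) _ len[OF h] c])
      have "ev 5 3 - ev 5 (5 + 0) \<in> ?B2" unfolding order_base_def by (intro CollectI exI[of _ 3]) simp
      moreover have "ev 5 4 - ev 5 (5 + 1) \<in> ?B2" unfolding order_base_def by (intro CollectI exI[of _ 5]) simp
      ultimately show "(\<lambda>(i, j). ev 5 i - ev 5 (5 + j)) ` ?C \<subseteq> ?B2" by simp
      show "is_chain (fst ?s) (snd ?s) ?C" unfolding s by (simp add: is_chain_def)
    qed
    then show "2 \<le> s_num 5 5 (hw_bar 5 5 (tail_base 5 5 lam) lam)" by simp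
  qed
  then have tail: "tail 5 5 lam = 2" by (simp add: tail_def)

  have "hw_bar 5 5 (dist_base 5 5) lam = weight_of [5, 4, 3, 0, -1] [1, 0, -3, -4, -5]"
  proof
    fix z :: int
    show "hw_bar 5 5 (dist_base 5 5) lam z = weight_of [5, 4, 3, 0, -1] [1, 0, -3, -4, -5] z"
    proof (cases "\<exists>k<5+5. z = crd 5 k")
      case True
      then obtain k where k: "k < 5 + 5" "z = crd 5 k" by blast
      show ?thesis unfolding k(2) start_coord[OF k(1)]
        by (rule hw_bar_coord(1)[OF hstar ex dist(1) reach0 dist(2) _ _ k(1)]) simp_all
    next
      case False
      have "hw_at 5 5 (dist_base 5 5) lam \<in> hstar 5 5"
        by (rule hw_bar_coord(2)[OF hstar ex dist(1) reach0 dist(2)]) simp_all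
      then have "hw_at 5 5 (dist_base 5 5) lam z = 0" "rho 5 5 (dist_base 5 5) z = 0"
        "weight_of [5, 4, 3, 0, -1] [1, 0, -3, -4, -5] z = 0"
        using rho_hstar[of 5 5 "dist_base 5 5"] bar_hstar False
        unfolding hstar_def mem_Collect_eq crd_range by blast+
      then show ?thesis by (simp add: hw_bar_def)
    qed
  qed
  moreover have "\<not> (\<forall>m n. 1 \<le> m \<longrightarrow> 1 \<le> n \<longrightarrow> (\<forall>\<nu> \<in> dominant m n. tail m n \<nu> = longtail m n \<nu>))"
  proof
    assume "\<forall>m n. 1 \<le> m \<longrightarrow> 1 \<le> n \<longrightarrow> (\<forall>\<nu> \<in> dominant m n. tail m n \<nu> = longtail m n \<nu>)"
    then have "tail 5 5 lam = longtail 5 5 lam" using dominant by (metis numeral_le_one_iff one_le_numeral)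
    then show False using tail longtail by simp
  qed
  ultimately show ?thesis using dominant tail longtail by simp
qed

end
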